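(* There is a polynomial-time algorithm that, given a connected graph $G$, an integer $k\ge 1$, and a set $X\subseteq V(G)$ that is a twin cover of $G$, with $t:=|X|$, computes a triple $(G',k',X')$ such that $G'$ is a connected graph, $k'\ge 1$ is an integer, $X'$ is a twin cover of $G'$, $\operatorname{svcfc}(G)\le k$ holds if and only if $\operatorname{svcfc}(G')\le k'$, and \[ |V(G')|\le \max\!\left\{2,\; t+(t+1)k\,2^{t+k-1}\right\}. \] In particular, the problem of deciding, given such $(G,k,X)$, whether $\operatorname{svcfc}(G)\le k$ admits a kernel and is fixed-parameter tractable parameterized by $t+k$.
   Context: All graphs are finite, simple and undirected. For a vertex coloring $c\colon V(G)\to\mathbb{N}$, a path $P$ is conflict-free if some color appears on exactly one vertex of $P$. A coloring $c$ of a connected graph $G$ is a strong conflict-free vertex-connection (strong CFVC) coloring if for every two distinct vertices $u,v$ there is a shortest $u$-$v$ path in $G$ that is conflict-free. $\operatorname{svcfc}(G)$ is the minimum number of colors in a strong CFVC coloring of $G$. Two distinct vertices $u,v$ are true twins if $N_G[u]=N_G[v]$ (closed neighborhoods); an edge is a twin edge if its endpoints are true twins. A set $X\subseteq V(G)$ is a twin cover of $G$ if every edge of $G-X$ is a twin edge. A kernel for a parameterized problem is a polynomial-time algorithm mapping each instance to an equivalent instance whose size (plus parameter) is bounded by a computable function of the parameter; fixed-parameter tractable means solvable in time $f(\kappa)n^{O(1)}$ for computable $f$, where $\kappa$ is the parameter. *)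

theory Defs
  imports "Graph_Theory.Pair_Digraph" "Graph_Theory.Digraph_Component" "Graph_Theory.Vertex_Walk"
begin

section \<open>Strong conflict-free vertex-connection colorings\<close>

text \<open>
  Finite simple undirected graphs are the symmetric loop-free digraphs of the locale
  \<^locale>\<open>pair_graph\<close>: an undirected edge is a pair of opposite arcs.
  \<^const>\<open>Digraph_Component.connected\<close> implies that the graph has a vertex.
\<close>

definition connected_graph :: "'a pair_pre_digraph \<Rightarrow> bool" where
  "connected_graph G \<longleftrightarrow> pair_graph G \<and> Digraph_Component.connected (with_proj G)"

definition path_between :: "'a pair_pre_digraph \<Rightarrow> 'a \<Rightarrow> 'a list \<Rightarrow> 'a \<Rightarrow> bool" where
  "path_between G u p v \<longleftrightarrow> vpath p (with_proj G) \<and> hd p = u \<and> last p = v"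

definition shortest_path :: "'a pair_pre_digraph \<Rightarrow> 'a \<Rightarrow> 'a list \<Rightarrow> 'a \<Rightarrow> bool" where
  "shortest_path G u p v \<longleftrightarrow>
     path_between G u p v \<and> (\<forall>q. path_between G u q v \<longrightarrow> vwalk_length p \<le> vwalk_length q)"

definition conflict_free :: "('a \<Rightarrow> nat) \<Rightarrow> 'a list \<Rightarrow> bool" where
  "conflict_free c p \<longleftrightarrow> (\<exists>a. \<exists>!x. x \<in> set p \<and> c x = a)"

definition strong_cfvc_coloring :: "'a pair_pre_digraph \<Rightarrow> ('a \<Rightarrow> nat) \<Rightarrow> bool" where
  "strong_cfvc_coloring G c \<longleftrightarrow>
     (\<forall>u \<in> pverts G. \<forall>v \<in> pverts G. u \<noteq> v \<longrightarrow>
        (\<exists>p. shortest_path G u p v \<and> conflict_free c p))"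

definition svcfc :: "'a pair_pre_digraph \<Rightarrow> nat" where
  "svcfc G = (LEAST m. \<exists>c. strong_cfvc_coloring G c \<and> card (c ` pverts G) = m)"


section \<open>Twin covers\<close>

definition closed_nbhd :: "'a pair_pre_digraph \<Rightarrow> 'a \<Rightarrow> 'a set" where
  "closed_nbhd G u = insert u {w. (u, w) \<in> parcs G}"

definition true_twins :: "'a pair_pre_digraph \<Rightarrow> 'a \<Rightarrow> 'a \<Rightarrow> bool" where
  "true_twins G u v \<longleftrightarrow>
     u \<in> pverts G \<and> v \<in> pverts G \<and> u \<noteq> v \<and> closed_nbhd G u = closed_nbhd G v"

definition twin_cover :: "'a pair_pre_digraph \<Rightarrow> 'a set \<Rightarrow> bool" where
  "twin_cover G X \<longleftrightarrow> X \<subseteq> pverts G \<and>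
     (\<forall>(u, v) \<in> arcs (with_proj G \<restriction> (pverts G - X)). true_twins G u v)"


section \<open>Programs and their running time\<close>

text \<open>
  The model of computation is a structured imperative language in the style of Jones's WHILE
  language (\<^emph>\<open>Computability and Complexity\<close>, 1997): the store is one binary tree, which can be
  tested for being a leaf, taken apart and built up. Leaves count as false, all other
  trees as true.

  Unlike in the unit-cost model, every step is charged the size of the store it
  works on (\<^term>\<open>size\<close> is the number of inner nodes of a tree). This excludes
  building exponentially large trees in linearly many steps, so that running times agree with
  those of multi-tape Turing machines up to a polynomial: one step copies or scans the tree
  once, and conversely a machine configuration is a tree holding the tapes as
  pairs of lists.
\<close>

datatype btree = Lf | Br btree btree

datatype prog =
    Ident
  | Leaf
  | Left
  | Right
  | Join prog prog
  | Seq prog prog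
  | Cond prog prog prog
  | While prog prog

text \<open>\<open>run p x y n\<close>: on input \<open>x\<close>, program \<open>p\<close> halts with output \<open>y\<close> after time \<open>n\<close>.\<close>

inductive run :: "prog \<Rightarrow> btree \<Rightarrow> btree \<Rightarrow> nat \<Rightarrow> bool" where
  Ident: "run Ident x x (size x + 1)"
| Leaf: "run Leaf x Lf (size x + 1)"
| Left_Lf: "run Left Lf Lf 1"
| Left_Br: "run Left (Br x y) x (size (Br x y) + 1)"
| Right_Lf: "run Right Lf Lf 1"
| Right_Br: "run Right (Br x y) y (size (Br x y) + 1)"
| Join: "\<lbrakk>run p x y m; run q x z n\<rbrakk> \<Longrightarrow> run (Join p q) x (Br y z) (m + n + size x + 1)"
| Seq: "\<lbrakk>run p x y m; run q y z n\<rbrakk> \<Longrightarrow> run (Seq p q) x z (m + n + size x + 1)"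
| Cond_True: "\<lbrakk>run b x (Br v w) l; run p x y m\<rbrakk> \<Longrightarrow> run (Cond b p q) x y (l + m + size x + 1)"
| Cond_False: "\<lbrakk>run b x Lf l; run q x y m\<rbrakk> \<Longrightarrow> run (Cond b p q) x y (l + m + size x + 1)"
| While_False: "run b x Lf l \<Longrightarrow> run (While b p) x x (l + size x + 1)"
| While_True: "\<lbrakk>run b x (Br v w) l; run p x y m; run (While b p) y z n\<rbrakk>
    \<Longrightarrow> run (While b p) x z (l + m + n + size x + 1)"

lemma run_deterministic: "run p x y m \<Longrightarrow> run p x z n \<Longrightarrow> y = z \<and> m = n"
proof (induction arbitrary: z n rule: run.induct)
  case (While_False b x l p)
  from While_False.prems While_False.IH show ?case
    by (cases rule: run.cases) blast+
next
  case (While_True b x v w l p y m z' k)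
  from While_True.prems While_True.IH show ?case
    by (cases rule: run.cases) blast+
qed (erule run.cases; blast)+


lemma size_output_le_time: "run p x y n \<Longrightarrow> size y \<le> n"
  by (induction rule: run.induct) auto


section \<open>Encodings\<close>

fun enc_bool :: "bool \<Rightarrow> btree" where
  "enc_bool False = Lf"
| "enc_bool True = Br Lf Lf"

fun enc_pair :: "('a \<Rightarrow> btree) \<Rightarrow> ('b \<Rightarrow> btree) \<Rightarrow> 'a \<times> 'b \<Rightarrow> btree" where
  "enc_pair e f (x, y) = Br (e x) (f y)"

fun enc_list :: "('a \<Rightarrow> btree) \<Rightarrow> 'a list \<Rightarrow> btree" where
  "enc_list e [] = Lf"
| "enc_list e (x # xs) = Br (e x) (enc_list e xs)"

text \<open>Numbers are written in binary, least significant bit first.\<close>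

fun bits :: "nat \<Rightarrow> bool list" where
  "bits n = (if n = 0 then [] else odd n # bits (n div 2))"

declare bits.simps [simp del]

definition enc_nat :: "nat \<Rightarrow> btree" where
  "enc_nat n = enc_list enc_bool (bits n)"

definition enc_nat_set :: "nat set \<Rightarrow> btree" where
  "enc_nat_set A = enc_list enc_nat (sorted_list_of_set A)"

text \<open>Graphs are given by their adjacency lists.\<close>

definition enc_graph :: "nat pair_pre_digraph \<Rightarrow> btree" where
  "enc_graph G = enc_list (enc_pair enc_nat enc_nat_set)
     (map (\<lambda>v. (v, {w. (v, w) \<in> parcs G})) (sorted_list_of_set (pverts G)))"

lemma inj_enc_bool: "inj enc_bool"
proof (rule injI)
  fix a b show "enc_bool a = enc_bool b \<Longrightarrow> a = b" by (cases a; cases b) auto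
qed

lemma enc_list_inject:
  assumes "inj_on e A"
  shows "set xs \<subseteq> A \<Longrightarrow> set ys \<subseteq> A \<Longrightarrow> enc_list e xs = enc_list e ys \<Longrightarrow> xs = ys"
proof (induction xs arbitrary: ys)
  case Nil
  then show ?case by (cases ys) auto
next
  case (Cons x xs)
  then show ?case using assms by (cases ys) (auto dest: inj_onD)
qed

lemma bits_inject: "bits m = bits n \<Longrightarrow> m = n"
proof (induction m arbitrary: n rule: less_induct)
  case (less m)
  show ?case
  proof (cases "m = 0 \<or> n = 0")
    case True
    with less.prems show ?thesis by (auto simp: bits.simps[of m] bits.simps[of n] split: if_splits)
  next
    case False
    with less.prems have "odd m = odd n" "bits (m div 2) = bits (n div 2)"
      by (auto simp: bits.simps[of m] bits.simps[of n])
    moreover from this(2) False have "m div 2 = n div 2" by (intro less.IH) auto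
    ultimately show ?thesis by presburger
  qed
qed

lemma inj_enc_nat: "inj enc_nat"
  using enc_list_inject[OF inj_enc_bool] by (auto intro!: injI bits_inject simp: enc_nat_def)

lemma inj_on_enc_nat_set: "inj_on enc_nat_set {A. finite A}"
proof (rule inj_onI)
  fix A B assume "A \<in> {A. finite A}" "B \<in> {A. finite A}" "enc_nat_set A = enc_nat_set B"
  moreover from this(3) have "sorted_list_of_set A = sorted_list_of_set B"
    unfolding enc_nat_set_def by (intro enc_list_inject[OF inj_enc_nat]) auto
  ultimately show "A = B" using sorted_list_of_set_inject by auto
qed

lemma inj_on_enc_graph: "inj_on enc_graph {G. pair_graph G}"
proof (rule inj_onI)
  fix G H :: "nat pair_pre_digraph"
  assume "G \<in> {G. pair_graph G}" "H \<in> {G. pair_graph G}" and eq: "enc_graph G = enc_graph H"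
  then interpret G: pair_graph G + H: pair_graph H by auto
  let ?N = "\<lambda>G v. {w. (v, w) \<in> parcs G}"
  let ?xs = "\<lambda>G. map (\<lambda>v. (v, ?N G v)) (sorted_list_of_set (pverts G))"
  have fin: "finite (?N G v)" "finite (?N H v)" for v
    by (rule finite_subset[OF _ G.finite_verts] finite_subset[OF _ H.finite_verts],
        auto dest: G.in_arcsD2 H.in_arcsD2)+
  have "inj_on (enc_pair enc_nat enc_nat_set) (UNIV \<times> {A. finite A})"
    using inj_enc_nat inj_on_enc_nat_set by (auto simp: inj_on_def)
  then have xs: "?xs G = ?xs H"
    using eq fin unfolding enc_graph_def by (elim enc_list_inject) auto
  then have "map fst (?xs G) = map fst (?xs H)" by simp
  then have V: "pverts G = pverts H"
    using sorted_list_of_set_inject[OF _ G.finite_verts H.finite_verts] by (simp add: comp_def)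
  with xs have "?N G v = ?N H v" if "v \<in> pverts G" for v
    using that by auto
  then have "parcs G = parcs H"
    using V by (auto dest: G.in_arcsD1 H.in_arcsD1)
  with V show "G = H" by simp
qed


section \<open>Polynomial time, computability, kernels and fixed-parameter tractability\<close>

definition poly_time_computable ::
  "('a \<Rightarrow> btree) \<Rightarrow> ('b \<Rightarrow> btree) \<Rightarrow> 'a set \<Rightarrow> ('a \<Rightarrow> 'b) \<Rightarrow> bool" where
  "poly_time_computable e e' A f \<longleftrightarrow>
     (\<exists>p c d. \<forall>x \<in> A. \<exists>n. run p (e x) (e' (f x)) n \<and> n \<le> c * (size (e x) + 1) ^ d)"

definition computable :: "(nat \<Rightarrow> nat) \<Rightarrow> bool" where
  "computable g \<longleftrightarrow> (\<exists>p. \<forall>x. \<exists>n. run p (enc_nat x) (enc_nat (g x)) n)"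

text \<open>
  A parameterized problem is given by an encoding \<open>e\<close> of instances, the set \<open>I\<close> of instances
  (the promise), the predicate \<open>Q\<close> that holds of the yes-instances, and the parameter \<open>\<kappa>\<close>.
\<close>

definition admits_kernel ::
  "('i \<Rightarrow> btree) \<Rightarrow> 'i set \<Rightarrow> ('i \<Rightarrow> bool) \<Rightarrow> ('i \<Rightarrow> nat) \<Rightarrow> bool" where
  "admits_kernel e I Q \<kappa> \<longleftrightarrow>
     (\<exists>f g. poly_time_computable e e I f \<and> computable g \<and>
       (\<forall>x \<in> I. f x \<in> I \<and> (Q (f x) \<longleftrightarrow> Q x) \<and> size (e (f x)) + \<kappa> (f x) \<le> g (\<kappa> x)))"

definition fixed_parameter_tractable ::
  "('i \<Rightarrow> btree) \<Rightarrow> 'i set \<Rightarrow> ('i \<Rightarrow> bool) \<Rightarrow> ('i \<Rightarrow> nat) \<Rightarrow> bool" where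
  "fixed_parameter_tractable e I Q \<kappa> \<longleftrightarrow>
     (\<exists>p g d. computable g \<and>
       (\<forall>x \<in> I. \<exists>n. run p (e x) (enc_bool (Q x)) n \<and> n \<le> g (\<kappa> x) * (size (e x) + 1) ^ d))"


section \<open>The problem parameterized by twin cover size plus number of colors\<close>

type_synonym svcfc_instance = "nat pair_pre_digraph \<times> nat \<times> nat set"

definition enc_instance :: "svcfc_instance \<Rightarrow> btree" where
  "enc_instance = enc_pair enc_graph (enc_pair enc_nat enc_nat_set)"

definition svcfc_instances :: "svcfc_instance set" where
  "svcfc_instances = {(G, k, X). connected_graph G \<and> 1 \<le> k \<and> twin_cover G X}"

lemma inj_on_enc_instance: "inj_on enc_instance svcfc_instances"
proof (rule inj_onI)
  fix x y assume "x \<in> svcfc_instances" "y \<in> svcfc_instances" "enc_instance x = enc_instance y"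
  moreover have "finite X" if "pair_graph G" "twin_cover G X" for G :: "nat pair_pre_digraph" and X
    using that by (auto simp: twin_cover_def intro: finite_subset
        dest: pair_fin_digraph.pair_finite_verts[OF pair_digraph.axioms(1)[OF pair_graph.axioms(1)]])
  ultimately show "x = y"
    using inj_on_enc_graph inj_enc_nat inj_on_enc_nat_set
    by (cases x; cases y)
       (auto simp: svcfc_instances_def connected_graph_def enc_instance_def dest: inj_onD)
qed

definition svcfc_yes :: "svcfc_instance \<Rightarrow> bool" where
  "svcfc_yes = (\<lambda>(G, k, X). svcfc G \<le> k)"

definition svcfc_parameter :: "svcfc_instance \<Rightarrow> nat" where
  "svcfc_parameter = (\<lambda>(G, k, X). card X + k)"

end

theory Submission
  imports Defs
begin

text \<open>
  Every component of \<open>G - X\<close> is a clique of true twins, and the vertices outside \<open>X\<close> fall into types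
  according to their neighbourhood in \<open>X\<close>; each vertex of \<open>X\<close> is a type of its own. A geodesic whose
  ends have different types meets every type at most once. Two vertices of the same type have
  distance at most two, and a properly coloured path of length at most two is conflict-free. Hence
  whether a proper colouring is strong depends only on the set of colours of each type.

  Inside a type, a set of at most \<open>k\<close> colours can be realised by a proper colouring of the cliques as
  soon as it is at least as large as the largest clique and not larger than the number of vertices.
  So it suffices to keep a largest clique and the first \<open>k\<close> vertices of each type, at most \<open>2k\<close>
  vertices for each of the \<open>2\<^sup>t\<close> types outside \<open>X\<close>. If some clique has more than \<open>k\<close> vertices, then
  the answer is no, and a single edge with \<open>k' = 1\<close> serves as the kernel.

  The kernel is relabelled by an initial segment of the numbers, which bounds its encoding, and is
  then solved by brute force. The running time of the brute force is elementary, and every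
  elementary function is dominated by an iterate of a computable double exponential.
\<close>

section \<open>Polynomial bounds\<close>

text \<open>The two directions of the equivalence fail for different reasons, and each failure
  dictates one half of what is kept. Passing to the kept vertices can lose a colour, so at least as
  many vertices as colours must stay in every type. Going back can run out of colours inside a
  clique, so a clique of maximal size must stay: its colours are pairwise distinct and hence
  numerous enough for every other clique of that type. The distance bound of two inside a type rests
  on connectedness: a clique without a neighbour in \<open>X\<close> would be the entire graph.

  The other obstacle is the concrete machine model. The procedures are total functions on lists,
  built from folds, whose running times follow from closure rules; they know nothing of graphs.
  Graphs enter only because the encoding of an instance coincides with that of its sorted lists. For
  this reason the relabelling preserves the order. Running times are compared with an arbitrary
  measure, so that one calculus serves both the polynomial kernelization and the exponential
  search.\<close>

definition poly_bounded :: "('a \<Rightarrow> nat) \<Rightarrow> ('a \<Rightarrow> nat) \<Rightarrow> bool" where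
  "poly_bounded t b \<longleftrightarrow> (\<exists>c d. \<forall>x. t x \<le> c * (b x + 1) ^ d)"

lemma poly_boundedI: "(\<And>x. t x \<le> c * (b x + 1) ^ d) \<Longrightarrow> poly_bounded t b"
  unfolding poly_bounded_def by blast

lemma poly_bounded_mono:
  assumes "poly_bounded t b" "\<And>x. s x \<le> t x"
  shows "poly_bounded s b"
  using assms unfolding poly_bounded_def by (meson order_trans)

lemma poly_bounded_le: "(\<And>x. t x \<le> b x) \<Longrightarrow> poly_bounded t b"
  by (rule poly_boundedI[of _ 1 _ 1]) (simp add: le_SucI)

lemma poly_bounded_const: "poly_bounded (\<lambda>_. c) b"
  by (rule poly_boundedI[of _ c _ 0]) simp

lemma poly_bounded_add:
  assumes "poly_bounded s b" "poly_bounded t b"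
  shows "poly_bounded (\<lambda>x. s x + t x) b"
proof -
  from assms obtain c d c' d' where
    "\<And>x. s x \<le> c * (b x + 1) ^ d" "\<And>x. t x \<le> c' * (b x + 1) ^ d'"
    unfolding poly_bounded_def by blast
  moreover have "c * (b x + 1) ^ d \<le> c * (b x + 1) ^ (d + d')"
    "c' * (b x + 1) ^ d' \<le> c' * (b x + 1) ^ (d + d')" for x
    by (intro mult_left_mono power_increasing; simp)+
  ultimately have "s x + t x \<le> (c + c') * (b x + 1) ^ (d + d')" for x
    unfolding add_mult_distrib by (meson add_mono order_trans)
  then show ?thesis by (rule poly_boundedI)
qed

lemma poly_bounded_mult:
  assumes "poly_bounded s b" "poly_bounded t b"
  shows "poly_bounded (\<lambda>x. s x * t x) b"
proof -
  from assms obtain c d c' d' where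
    "\<And>x. s x \<le> c * (b x + 1) ^ d" "\<And>x. t x \<le> c' * (b x + 1) ^ d'"
    unfolding poly_bounded_def by blast
  then have "s x * t x \<le> (c * (b x + 1) ^ d) * (c' * (b x + 1) ^ d')" for x
    by (intro mult_mono) auto
  then have "s x * t x \<le> (c * c') * (b x + 1) ^ (d + d')" for x
    by (simp add: power_add algebra_simps)
  then show ?thesis by (rule poly_boundedI)
qed

lemma poly_bounded_power:
  "poly_bounded s b \<Longrightarrow> poly_bounded (\<lambda>x. s x ^ n) b"
  by (induction n) (auto intro: poly_bounded_const poly_bounded_mult)

lemma poly_bounded_comp: "poly_bounded t b \<Longrightarrow> poly_bounded (\<lambda>x. t (g x)) (\<lambda>x. b (g x))"
  unfolding poly_bounded_def by blast

lemma poly_bounded_trans: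
  assumes "poly_bounded t s" "poly_bounded s b"
  shows "poly_bounded t b"
proof -
  from assms(1) obtain c d where "\<And>x. t x \<le> c * (s x + 1) ^ d"
    unfolding poly_bounded_def by blast
  moreover have "poly_bounded (\<lambda>x. c * (s x + 1) ^ d) b"
    by (intro poly_bounded_mult poly_bounded_power poly_bounded_add poly_bounded_const assms)
  ultimately show ?thesis by (rule poly_bounded_mono[rotated])
qed

lemmas poly_bounded_intros = poly_bounded_add poly_bounded_mult poly_bounded_const


section \<open>Time-bounded computation on encoded data\<close>

text \<open>The measure \<open>b\<close> is free: with the input size this is polynomial time, with
  a faster growing function of the size it covers the brute force. The program must halt on every
  \<open>x\<close>, without any promise.\<close>

definition time_bounded ::
  "('a \<Rightarrow> nat) \<Rightarrow> ('a \<Rightarrow> btree) \<Rightarrow> ('b \<Rightarrow> btree) \<Rightarrow> ('a \<Rightarrow> 'b) \<Rightarrow> bool" where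
  "time_bounded b e e' f \<longleftrightarrow>
     (\<exists>p T. (\<forall>x. run p (e x) (e' (f x)) (T x)) \<and> poly_bounded T b)"

abbreviation ptime :: "('a \<Rightarrow> btree) \<Rightarrow> ('b \<Rightarrow> btree) \<Rightarrow> ('a \<Rightarrow> 'b) \<Rightarrow> bool" where
  "ptime e \<equiv> time_bounded (\<lambda>x. size (e x)) e"

lemma time_boundedI:
  assumes "\<And>x. run p (e x) (e' (f x)) (T x)" "poly_bounded T b"
  shows "time_bounded b e e' f"
  using assms unfolding time_bounded_def by blast

lemma time_boundedE:
  assumes "time_bounded b e e' f"
  obtains p T where "\<And>x. run p (e x) (e' (f x)) (T x)" "poly_bounded T b"
  using assms unfolding time_bounded_def by blast

lemma ptime_imp_poly_time_computable:
  assumes "ptime e e' f"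
  shows "poly_time_computable e e' A f"
  using assms unfolding time_bounded_def poly_bounded_def poly_time_computable_def by blast

text \<open>Every rule charges the whole store, so a run takes longer than the size of its input. A
  \<open>time_bounded\<close> premise therefore already bounds the input size by \<open>b\<close>,
  and rules with such a premise need no separate size hypothesis.\<close>

lemma size_input_le_time: "run p x y n \<Longrightarrow> size x < n"
  by (induction rule: run.induct) auto

lemma time_bounded_size_input: "time_bounded b e e' f \<Longrightarrow> poly_bounded (\<lambda>x. size (e x)) b"
  by (erule time_boundedE, erule poly_bounded_mono) (meson less_imp_le size_input_le_time)

lemma time_bounded_size_output:
  "time_bounded b e e' f \<Longrightarrow> poly_bounded (\<lambda>x. size (e' (f x))) b"
  by (erule time_boundedE, erule poly_bounded_mono) (rule size_output_le_time)

text \<open>Programs see only trees, so data types may be switched for free wherever the encodings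
  coincide: a pair of head and tail is a list, a list of bits is a number.\<close>

lemma time_bounded_recode:
  assumes "time_bounded b e e' f" "\<And>x. e' (f x) = e'' (g x)"
  shows "time_bounded b e e'' g"
  using assms unfolding time_bounded_def by simp

lemma time_bounded_id:
  "poly_bounded (\<lambda>x. size (e x)) b \<Longrightarrow> time_bounded b e e (\<lambda>x. x)"
  by (rule time_boundedI[OF run.Ident]) (intro poly_bounded_intros)

text \<open>The second program runs on the output of the first, which is no larger than the time
  spent so far; a polynomial in a quantity polynomial in \<open>b\<close> is again polynomial in
  \<open>b\<close>.\<close>

lemma time_bounded_comp:
  assumes f: "time_bounded b e e1 f" and g: "ptime e1 e2 g"
  shows "time_bounded b e e2 (\<lambda>x. g (f x))"
proof -
  obtain p T where p: "\<And>x. run p (e x) (e1 (f x)) (T x)" and T: "poly_bounded T b"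
    using f unfolding time_bounded_def by blast
  obtain q S where q: "\<And>y. run q (e1 y) (e2 (g y)) (S y)" and S: "poly_bounded S (\<lambda>y. size (e1 y))"
    using g unfolding time_bounded_def by blast
  have "poly_bounded (\<lambda>x. S (f x)) b"
    by (rule poly_bounded_trans[OF poly_bounded_comp[OF S] time_bounded_size_output[OF f]])
  then show ?thesis
    using time_bounded_size_input[OF f] T
    by (auto intro!: time_boundedI run.Seq[OF p q] poly_bounded_intros)
qed

lemma time_bounded_pair:
  assumes f: "time_bounded b e e1 f" and g: "time_bounded b e e2 g"
  shows "time_bounded b e (enc_pair e1 e2) (\<lambda>x. (f x, g x))"
proof -
  obtain p T where p: "\<And>x. run p (e x) (e1 (f x)) (T x)" and T: "poly_bounded T b"
    using f unfolding time_bounded_def by blast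
  obtain q S where q: "\<And>x. run q (e x) (e2 (g x)) (S x)" and S: "poly_bounded S b"
    using g unfolding time_bounded_def by blast
  have "run (Join p q) (e x) (enc_pair e1 e2 (f x, g x)) (T x + S x + size (e x) + 1)" for x
    by (simp only: enc_pair.simps run.Join[OF p q])
  then show ?thesis
    by (rule time_boundedI) (intro poly_bounded_intros T S time_bounded_size_input[OF f])
qed

lemma enc_bool_True_iff: "enc_bool x = (if x then Br Lf Lf else Lf)"
  by (cases x) auto

lemma time_bounded_If:
  assumes P: "time_bounded b e enc_bool P" and f: "time_bounded b e e' f"
    and g: "time_bounded b e e' g"
  shows "time_bounded b e e' (\<lambda>x. if P x then f x else g x)"
proof -
  obtain r R where r: "\<And>x. run r (e x) (enc_bool (P x)) (R x)" and R: "poly_bounded R b"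
    using P unfolding time_bounded_def by blast
  obtain p T where p: "\<And>x. run p (e x) (e' (f x)) (T x)" and T: "poly_bounded T b"
    using f unfolding time_bounded_def by blast
  obtain q S where q: "\<And>x. run q (e x) (e' (g x)) (S x)" and S: "poly_bounded S b"
    using g unfolding time_bounded_def by blast
  have run_if: "run (Cond r p q) (e x) (e' (if P x then f x else g x))
      (R x + (if P x then T x else S x) + size (e x) + 1)" for x
  proof (cases "P x")
    case True
    then show ?thesis using run.Cond_True[OF _ p] r[of x] by simp
  next
    case False
    then show ?thesis using run.Cond_False[OF _ q] r[of x] by simp
  qed
  have "poly_bounded (\<lambda>x. R x + (if P x then T x else S x) + size (e x) + 1) b"
    by (rule poly_bounded_mono[of "\<lambda>x. R x + (T x + S x) + size (e x) + 1"])
       (intro poly_bounded_intros R T S time_bounded_size_input[OF f], simp)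
  with run_if show ?thesis by (rule time_boundedI)
qed

text \<open>A tree with \<open>size t\<close> inner nodes has \<open>size t + 1\<close> leaves, and
  each leaf and each join costs \<open>size x + 1\<close>.\<close>

lemma run_constant: "\<exists>p. \<forall>x. run p x t (size t * (2 * size x + 2) + size x + 1)"
proof (induction t)
  case Lf
  show ?case by (intro exI[of _ Leaf] allI) (simp add: run.Leaf[simplified])
next
  case (Br t u)
  then obtain p q where "\<And>x. run p x t (size t * (2 * size x + 2) + size x + 1)"
    "\<And>x. run q x u (size u * (2 * size x + 2) + size x + 1)" by blast
  from run.Join[OF this] show ?case
    by (intro exI[of _ "Join p q"] allI) (simp add: algebra_simps)
qed

lemma time_bounded_const:
  assumes "poly_bounded (\<lambda>x. size (e x)) b"
  shows "time_bounded b e e' (\<lambda>_. c)"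
proof -
  obtain p where "\<And>x. run p x (e' c) (size (e' c) * (2 * size x + 2) + size x + 1)"
    using run_constant by blast
  then show ?thesis
    by (rule time_boundedI) (intro poly_bounded_intros assms)
qed

named_theorems ptime_intros

lemma poly_bounded_refl: "poly_bounded b b"
  by (rule poly_bounded_le) simp

lemmas ptime_id [ptime_intros] = time_bounded_id[OF poly_bounded_refl]
lemmas ptime_const = time_bounded_const[OF poly_bounded_refl]
lemmas [ptime_intros] = time_bounded_pair time_bounded_If

text \<open>\<open>Left\<close> maps a leaf to a leaf. The second alternative therefore covers
  default values, such as the parity of 0 or the head of an empty list.\<close>

lemma ptime_primitive_Left:
  assumes "\<And>x. \<exists>u. e x = Br (e' (f x)) u \<or> e x = Lf \<and> e' (f x) = Lf"
  shows "ptime e e' f"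
proof (rule time_boundedI[where p = Left and T = "\<lambda>x. size (e x) + 1"])
  fix x show "run Left (e x) (e' (f x)) (size (e x) + 1)"
    using assms[of x] run.Left_Br[of "e' (f x)"] run.Left_Lf by auto
qed (intro poly_bounded_intros poly_bounded_refl)

lemma ptime_primitive_Right:
  assumes "\<And>x. \<exists>u. e x = Br u (e' (f x)) \<or> e x = Lf \<and> e' (f x) = Lf"
  shows "ptime e e' f"
proof (rule time_boundedI[where p = Right and T = "\<lambda>x. size (e x) + 1"])
  fix x show "run Right (e x) (e' (f x)) (size (e x) + 1)"
    using assms[of x] run.Right_Br[of _ "e' (f x)"] run.Right_Lf by auto
qed (intro poly_bounded_intros poly_bounded_refl)

lemma enc_pair_eq: "enc_pair e f z = Br (e (fst z)) (f (snd z))"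
  by (cases z) simp

lemma ptime_fst [ptime_intros]:
  "time_bounded b e (enc_pair e1 e2) f \<Longrightarrow> time_bounded b e e1 (\<lambda>x. fst (f x))"
  by (erule time_bounded_comp[where g = fst]) (rule ptime_primitive_Left, simp add: enc_pair_eq)

lemma ptime_snd [ptime_intros]:
  "time_bounded b e (enc_pair e1 e2) f \<Longrightarrow> time_bounded b e e2 (\<lambda>x. snd (f x))"
  by (erule time_bounded_comp[where g = snd]) (rule ptime_primitive_Right, simp add: enc_pair_eq)

lemma ptime_Cons [ptime_intros]:
  assumes "time_bounded b e e1 f" "time_bounded b e (enc_list e1) g"
  shows "time_bounded b e (enc_list e1) (\<lambda>x. f x # g x)"
  by (rule time_bounded_recode[OF time_bounded_pair[OF assms]]) simp

lemma ptime_Not [ptime_intros]: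
  assumes "time_bounded b e enc_bool P"
  shows "time_bounded b e enc_bool (\<lambda>x. \<not> P x)"
proof -
  have "time_bounded b e enc_bool (\<lambda>x. if P x then False else True)"
    by (intro time_bounded_If assms time_bounded_const time_bounded_size_input[OF assms])
  then show ?thesis by (rule time_bounded_recode) simp
qed

lemma ptime_conj [ptime_intros]:
  assumes "time_bounded b e enc_bool P" "time_bounded b e enc_bool Q"
  shows "time_bounded b e enc_bool (\<lambda>x. P x \<and> Q x)"
proof -
  have "time_bounded b e enc_bool (\<lambda>x. if P x then Q x else False)"
    by (intro time_bounded_If assms time_bounded_const time_bounded_size_input[OF assms(1)])
  then show ?thesis by (rule time_bounded_recode) simp
qed

lemma ptime_disj [ptime_intros]:
  assumes "time_bounded b e enc_bool P" "time_bounded b e enc_bool Q"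
  shows "time_bounded b e enc_bool (\<lambda>x. P x \<or> Q x)"
  by (rule time_bounded_recode[OF ptime_Not[OF ptime_conj[OF assms[THEN ptime_Not]]]]) simp

lemma ptime_imp [ptime_intros]:
  assumes "time_bounded b e enc_bool P" "time_bounded b e enc_bool Q"
  shows "time_bounded b e enc_bool (\<lambda>x. P x \<longrightarrow> Q x)"
  by (rule time_bounded_recode[OF ptime_disj[OF ptime_Not[OF assms(1)] assms(2)]]) auto

lemma ptime_eq_bool [ptime_intros]:
  assumes "time_bounded b e enc_bool P" "time_bounded b e enc_bool Q"
  shows "time_bounded b e enc_bool (\<lambda>x. P x = Q x)"
  by (rule time_bounded_recode[OF time_bounded_If[OF assms ptime_Not[OF assms(2)]]]) auto


section \<open>Loops over lists\<close>

lemma run_While: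
  assumes test: "\<And>i. i < n \<Longrightarrow> \<exists>v w. run t (st i) (Br v w) (l i)"
    and stop: "run t (st n) Lf (l n)"
    and body: "\<And>i. i < n \<Longrightarrow> run p (st i) (st (Suc i)) (m i)"
  shows "run (While t p) (st 0) (st n)
    ((\<Sum>i<n. l i + m i + size (st i) + 1) + l n + size (st n) + 1)"
  using assms
proof (induction n arbitrary: st l m)
  case 0
  then show ?case using run.While_False by simp
next
  case (Suc n)
  obtain v w where "run t (st 0) (Br v w) (l 0)" using Suc.prems(1) by blast
  moreover have "run p (st 0) (st (Suc 0)) (m 0)" using Suc.prems(3) by blast
  moreover have "run (While t p) (st (Suc 0)) (st (Suc n))
    ((\<Sum>i<n. l (Suc i) + m (Suc i) + size (st (Suc i)) + 1) + l (Suc n) + size (st (Suc n)) + 1)"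
    using Suc.IH[of "\<lambda>i. st (Suc i)" "\<lambda>i. l (Suc i)" "\<lambda>i. m (Suc i)"] Suc.prems by auto
  ultimately have "run (While t p) (st 0) (st (Suc n)) (l 0 + m 0 + ((\<Sum>i<n. l (Suc i) + m (Suc i) +
      size (st (Suc i)) + 1) + l (Suc n) + size (st (Suc n)) + 1) + size (st 0) + 1)"
    by (rule run.While_True)
  then show ?case
    by (simp only: sum.lessThan_Suc_shift ac_simps)
qed

lemma length_le_size_enc_list: "length xs \<le> size (enc_list e xs)"
  by (induction xs) auto

lemma size_enc_list: "size (enc_list e xs) = (\<Sum>x\<leftarrow>xs. size (e x) + 1)"
  by (induction xs) auto

lemma size_nth_le_enc_list: "x \<in> set xs \<Longrightarrow> size (e x) < size (enc_list e xs)"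
  by (induction xs) auto

lemma size_drop_enc_list: "size (enc_list e (drop i xs)) \<le> size (enc_list e xs)"
proof (induction xs arbitrary: i)
  case (Cons x xs)
  have "size (enc_list e (drop (i - 1) xs)) \<le> size (enc_list e xs)" by (rule Cons.IH)
  then show ?case by (cases i) auto
qed simp

text \<open>A polynomial-time step alone is not enough, since an accumulator that is squared
  repeatedly explodes. The bound \<open>M\<close> therefore has to hold for every intermediate
  accumulator.\<close>

lemma time_bounded_foldl:
  fixes L :: "'a \<Rightarrow> 'c list" and a0 :: "'a \<Rightarrow> 'b"
  assumes L: "time_bounded b e (enc_list e1) L"
    and a0: "time_bounded b e e2 a0"
    and step: "ptime (enc_pair (enc_pair e e1) e2) e2 (\<lambda>z. s (fst (fst z)) (snd z) (snd (fst z)))"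
    and acc: "poly_bounded M b"
      "\<And>x i. i \<le> length (L x) \<Longrightarrow> size (e2 (foldl (s x) (a0 x) (take i (L x)))) \<le> M x"
  shows "time_bounded b e e2 (\<lambda>x. foldl (s x) (a0 x) (L x))"
proof -
  \<comment> \<open>A nonempty list is encoded like the pair of its head and tail, so the loop body is a total
    function on the data encoded by \<open>?S\<close>.\<close>
  let ?S = "enc_pair e (enc_pair (enc_pair e1 (enc_list e1)) e2)"
  let ?E = "enc_pair e (enc_pair (enc_list e1) e2)"
  define body :: "'a \<times> ('c \<times> 'c list) \<times> 'b \<Rightarrow> 'a \<times> 'c list \<times> 'b" where "body = (\<lambda>z. (fst z, snd (fst (snd z)),
      s (fst z) (snd (snd z)) (fst (fst (snd z)))))"
  have "ptime ?S (enc_pair (enc_pair e e1) e2) (\<lambda>z. ((fst z, fst (fst (snd z))), snd (snd z)))"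
    by (rule ptime_intros)+
  from time_bounded_comp[OF this step]
  have "ptime ?S e2 (\<lambda>z. s (fst z) (snd (snd z)) (fst (fst (snd z))))" by simp
  note step' = this
  have "ptime ?S ?E body"
    unfolding body_def by (rule step' ptime_intros)+
  then obtain p T where p: "\<And>z. run p (?S z) (?E (body z)) (T z)"
    and T: "poly_bounded T (\<lambda>z. size (?S z))" unfolding time_bounded_def by blast
  define st where "st x i = ?E (x, drop i (L x), foldl (s x) (a0 x) (take i (L x)))" for x i
  define arg where "arg x i = (x, (L x ! i, drop (Suc i) (L x)), foldl (s x) (a0 x) (take i (L x)))"
    for x i
  have arg: "?S (arg x i) = st x i" if "i < length (L x)" for x i
    using that by (simp add: arg_def st_def Cons_nth_drop_Suc[symmetric])
  have body: "run p (st x i) (st x (Suc i)) (T (arg x i))" if "i < length (L x)" for x i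
    using p[of "arg x i"] that unfolding arg[OF that]
    by (simp add: st_def arg_def body_def take_Suc_conv_app_nth)
  \<comment> \<open>Bounds both the store at every iteration and the number of iterations; the final
    2 counts the two pair nodes of the state.\<close>
  define N where "N x = size (e x) + size (enc_list e1 (L x)) + M x + 2" for x
  have N: "poly_bounded N b"
    unfolding N_def
    by (intro poly_bounded_intros acc(1) time_bounded_size_input[OF L] time_bounded_size_output[OF L])
  have st_le: "size (st x i) \<le> N x" if "i \<le> length (L x)" for x i
    using acc(2)[OF that] size_drop_enc_list[of e1 i "L x"] by (simp add: st_def N_def)
  obtain c d where Tcd: "\<And>z. T z \<le> c * (size (?S z) + 1) ^ d"
    using T unfolding poly_bounded_def by blast
  have T_le: "T (arg x i) \<le> c * (N x + 1) ^ d" if "i < length (L x)" for x i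
  proof -
    have "T (arg x i) \<le> c * (size (st x i) + 1) ^ d"
      using Tcd[of "arg x i"] unfolding arg[OF that] .
    also have "\<dots> \<le> c * (N x + 1) ^ d"
      using st_le[of i x] that by (intro mult_left_mono power_mono add_mono) auto
    finally show ?thesis .
  qed
  define l where "l x i = size (st x i) + 1 + (size (enc_pair (enc_list e1) e2
      (drop i (L x), foldl (s x) (a0 x) (take i (L x)))) + 1) + size (st x i) + 1" for x i
  \<comment> \<open>The loop condition returns the unread part of the list, which is a leaf, and so
    counts as false, exactly when the list is exhausted.\<close>
  let ?t = "Seq Right Left"
  have t: "run ?t (st x i) (enc_list e1 (drop i (L x))) (l x i)" for x i
    unfolding l_def st_def enc_pair.simps
    by (rule run.Seq[OF run.Right_Br run.Left_Br])
  have loop: "run (While ?t p) (st x 0) (st x (length (L x)))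
     ((\<Sum>i<length (L x). l x i + T (arg x i) + size (st x i) + 1) + l x (length (L x))
       + size (st x (length (L x))) + 1)" (is "run _ _ _ (?n x)") for x
  proof (rule run_While)
    fix i assume "i < length (L x)"
    then have "\<exists>v w. enc_list e1 (drop i (L x)) = Br v w"
      by (simp add: Cons_nth_drop_Suc[symmetric])
    then show "\<exists>v w. run ?t (st x i) (Br v w) (l x i)" using t[of x i] by metis
  qed (use t[of x "length (L x)"] body in auto)
  have l_le: "l x i \<le> 3 * N x + 3" if "i \<le> length (L x)" for x i
    using st_le[OF that] by (simp add: l_def st_def)
  have n_le: "?n x \<le> N x * (3 * N x + 3 + c * (N x + 1) ^ d + N x + 1) + (3 * N x + 3) + N x + 1" for x
  proof -
    have "(\<Sum>i<length (L x). l x i + T (arg x i) + size (st x i) + 1)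
        \<le> (\<Sum>i<length (L x). 3 * N x + 3 + c * (N x + 1) ^ d + N x + 1)"
      by (intro sum_mono add_mono l_le T_le st_le) auto
    also have "\<dots> = length (L x) * (3 * N x + 3 + c * (N x + 1) ^ d + N x + 1)" by simp
    also have "\<dots> \<le> N x * (3 * N x + 3 + c * (N x + 1) ^ d + N x + 1)"
      using length_le_size_enc_list[of "L x" e1] by (intro mult_le_mono1) (simp add: N_def)
    finally show ?thesis
      using l_le[of "length (L x)" x] st_le[of "length (L x)" x] by (intro add_mono) auto
  qed
  have "poly_bounded (\<lambda>x. N x * (3 * N x + 3 + c * (N x + 1) ^ d + N x + 1)
      + (3 * N x + 3) + N x + 1) b"
    by (intro poly_bounded_intros poly_bounded_power N)
  then have n: "poly_bounded ?n b" using n_le by (rule poly_bounded_mono)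
  have "time_bounded b e ?E (\<lambda>x. (x, L x, a0 x))"
    by (intro time_bounded_pair time_bounded_id L a0 time_bounded_size_input[OF L])
  then obtain q R where q: "\<And>x. run q (e x) (st x 0) (R x)" and R: "poly_bounded R b"
    unfolding time_bounded_def by (auto simp: st_def)
  have "time_bounded b e ?E (\<lambda>x. (x, [], foldl (s x) (a0 x) (L x)))"
  proof (rule time_boundedI)
    show "run (Seq q (While ?t p)) (e x) (?E (x, [], foldl (s x) (a0 x) (L x)))
      (R x + ?n x + size (e x) + 1)" for x
      using run.Seq[OF q loop] by (simp add: st_def)
    show "poly_bounded (\<lambda>x. R x + ?n x + size (e x) + 1) b"
      by (intro poly_bounded_intros R n time_bounded_size_input[OF L])
  qed
  from ptime_snd[OF ptime_snd[OF this]] show ?thesis by simp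
qed

text \<open>If the growth in one step depends only on the input and the list element, not on the
  accumulator, then all intermediate sizes stay below the initial size plus the size of the list
  times a polynomial.\<close>

lemma time_bounded_foldl_additive:
  assumes L: "time_bounded b e (enc_list e1) L"
    and a0: "time_bounded b e e2 a0"
    and step: "ptime (enc_pair (enc_pair e e1) e2) e2 (\<lambda>z. s (fst (fst z)) (snd z) (snd (fst z)))"
    and growth: "\<And>x a y. size (e2 (s x a y)) \<le> size (e2 a) + g (x, y)"
      "poly_bounded g (\<lambda>z. size (enc_pair e e1 z))"
  shows "time_bounded b e e2 (\<lambda>x. foldl (s x) (a0 x) (L x))"
proof -
  obtain c d where cd: "\<And>z. g z \<le> c * (size (enc_pair e e1 z) + 1) ^ d"
    using growth(2) unfolding poly_bounded_def by blast
  define N where "N x = c * (size (e x) + size (enc_list e1 (L x)) + 2) ^ d" for x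
  define M where "M x = size (e2 (a0 x)) + size (enc_list e1 (L x)) * N x" for x
  have M: "poly_bounded M b"
    unfolding M_def N_def
    by (intro poly_bounded_intros poly_bounded_power time_bounded_size_input[OF L]
        time_bounded_size_output[OF L] time_bounded_size_output[OF a0])
  have g_le: "g (x, y) \<le> N x" if "y \<in> set (L x)" for x y
  proof -
    have "g (x, y) \<le> c * (size (e x) + size (e1 y) + 1 + 1) ^ d"
      using cd[of "(x, y)"] by simp
    also have "\<dots> \<le> N x"
      using size_nth_le_enc_list[OF that, of e1] unfolding N_def
      by (intro mult_left_mono power_mono) auto
    finally show ?thesis .
  qed
  have "size (e2 (foldl (s x) (a0 x) (take i (L x)))) \<le> size (e2 (a0 x)) + i * N x"
    if "i \<le> length (L x)" for x i
    using that
  proof (induction i)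
    case (Suc i)
    then have "size (e2 (foldl (s x) (a0 x) (take (Suc i) (L x))))
        \<le> size (e2 (foldl (s x) (a0 x) (take i (L x)))) + g (x, L x ! i)"
      using growth(1) by (simp add: take_Suc_conv_app_nth)
    also have "\<dots> \<le> size (e2 (a0 x)) + i * N x + N x"
      using Suc by (intro add_mono g_le) auto
    finally show ?case by simp
  qed simp
  moreover have "i * N x \<le> size (enc_list e1 (L x)) * N x" if "i \<le> length (L x)" for x i
    using that length_le_size_enc_list[of "L x" e1] by (intro mult_le_mono1) simp
  ultimately have "size (e2 (foldl (s x) (a0 x) (take i (L x)))) \<le> M x"
    if "i \<le> length (L x)" for x i
    using that unfolding M_def by (meson add_left_mono order_trans)
  with M show ?thesis by (rule time_bounded_foldl[OF L a0 step])
qed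

section \<open>List functions and bounded quantifiers as folds\<close>

lemma foldl_Cons_rev: "foldl (\<lambda>a y. f y # a) ys xs = rev (map f xs) @ ys"
  by (induction xs arbitrary: ys) auto

lemma foldl_filter_rev:
  "foldl (\<lambda>a y. if P y then y # a else a) ys xs = rev (filter P xs) @ ys"
  by (induction xs arbitrary: ys) auto

lemma foldl_disj: "foldl (\<lambda>a y. a \<or> P y) b xs \<longleftrightarrow> b \<or> (\<exists>x \<in> set xs. P x)"
  by (induction xs arbitrary: b) auto

lemma foldl_append: "foldl (@) ys xs = ys @ concat xs"
  by (induction xs arbitrary: ys) auto

lemma foldl_Suc: "foldl (\<lambda>a _. Suc a) n xs = n + length xs"
  by (induction xs arbitrary: n) auto

lemma poly_bounded_size_snd: "poly_bounded (\<lambda>z. size (e1 (snd z))) (\<lambda>z. size (enc_pair e e1 z))"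
  by (rule poly_bounded_le) (simp add: enc_pair_eq)

declare ptime_const [ptime_intros]

text \<open>Folding with \<open>Cons\<close> produces the list backwards. This simplest loop comes
  first and is then used to restore the order in the loops for \<open>map\<close>,
  \<open>filter\<close> and append.\<close>

lemma ptime_rev [ptime_intros]:
  assumes "time_bounded b e (enc_list e1) L"
  shows "time_bounded b e (enc_list e1) (\<lambda>x. rev (L x))"
proof -
  have "ptime (enc_list e1) (enc_list e1) (\<lambda>xs. foldl (\<lambda>a y. y # a) [] xs)"
    by (rule time_bounded_foldl_additive[where g = "\<lambda>z. size (e1 (snd z)) + 1"])
       ((rule ptime_intros)+, simp, intro poly_bounded_intros poly_bounded_size_snd)
  then have "ptime (enc_list e1) (enc_list e1) rev"
    by (rule time_bounded_recode) (simp add: foldl_Cons_rev[of "\<lambda>x. x", simplified])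
  with assms show ?thesis by (rule time_bounded_comp)
qed

lemma ptime_map [ptime_intros]:
  assumes L: "time_bounded b e (enc_list e1) L"
    and f: "ptime (enc_pair e e1) e2 (\<lambda>z. f (fst z) (snd z))"
  shows "time_bounded b e (enc_list e2) (\<lambda>x. map (f x) (L x))"
proof -
  have "ptime (enc_pair (enc_pair e e1) (enc_list e2)) e2
      (\<lambda>z. f (fst (fst z)) (snd (fst z)))"
    by (rule time_bounded_comp[OF ptime_fst[OF ptime_id] f])
  note f' = this
  have "time_bounded b e (enc_list e2) (\<lambda>x. foldl (\<lambda>a y. f x y # a) [] (L x))"
  proof (rule time_bounded_foldl_additive[where g = "\<lambda>z. size (e2 (f (fst z) (snd z))) + 1"])
    show "time_bounded b e (enc_list e2) (\<lambda>_. [])"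
      by (rule time_bounded_const[OF time_bounded_size_input[OF L]])
  qed (rule L, (rule f' ptime_intros)+, simp,
       intro poly_bounded_intros time_bounded_size_output[OF f])
  from ptime_rev[OF this] show ?thesis by (simp add: foldl_Cons_rev)
qed

lemma ptime_filter [ptime_intros]:
  assumes L: "time_bounded b e (enc_list e1) L"
    and P: "ptime (enc_pair e e1) enc_bool (\<lambda>z. P (fst z) (snd z))"
  shows "time_bounded b e (enc_list e1) (\<lambda>x. filter (P x) (L x))"
proof -
  have "ptime (enc_pair (enc_pair e e1) (enc_list e1)) enc_bool
      (\<lambda>z. P (fst (fst z)) (snd (fst z)))"
    by (rule time_bounded_comp[OF ptime_fst[OF ptime_id] P])
  note P' = this
  have "time_bounded b e (enc_list e1) (\<lambda>x. foldl (\<lambda>a y. if P x y then y # a else a) [] (L x))"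
  proof (rule time_bounded_foldl_additive[where g = "\<lambda>z. size (e1 (snd z)) + 1"])
    show "time_bounded b e (enc_list e1) (\<lambda>_. [])"
      by (rule time_bounded_const[OF time_bounded_size_input[OF L]])
  qed (rule L, (rule P' ptime_intros)+, simp, intro poly_bounded_intros poly_bounded_size_snd)
  from ptime_rev[OF this] show ?thesis by (simp add: foldl_filter_rev)
qed

lemma ptime_Bex [ptime_intros]:
  assumes L: "time_bounded b e (enc_list e1) L"
    and P: "ptime (enc_pair e e1) enc_bool (\<lambda>z. P (fst z) (snd z))"
  shows "time_bounded b e enc_bool (\<lambda>x. \<exists>y \<in> set (L x). P x y)"
proof -
  have "ptime (enc_pair (enc_pair e e1) enc_bool) enc_bool (\<lambda>z. P (fst (fst z)) (snd (fst z)))"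
    by (rule time_bounded_comp[OF ptime_fst[OF ptime_id] P])
  note P' = this
  have "time_bounded b e enc_bool (\<lambda>x. foldl (\<lambda>a y. a \<or> P x y) False (L x))"
  proof (rule time_bounded_foldl_additive[where g = "\<lambda>_. 1"])
    show "time_bounded b e enc_bool (\<lambda>_. False)"
      by (rule time_bounded_const[OF time_bounded_size_input[OF L]])
  qed (rule L, (rule P' ptime_intros)+, simp add: enc_bool_True_iff, rule poly_bounded_const)
  then show ?thesis by (simp add: foldl_disj)
qed

lemma ptime_Ball [ptime_intros]:
  assumes "time_bounded b e (enc_list e1) L"
    and "ptime (enc_pair e e1) enc_bool (\<lambda>z. P (fst z) (snd z))"
  shows "time_bounded b e enc_bool (\<lambda>x. \<forall>y \<in> set (L x). P x y)"
  by (rule time_bounded_recode[OF ptime_Not[OF ptime_Bex[OF assms(1) ptime_Not[OF assms(2)]]]]) auto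

lemma ptime_append [ptime_intros]:
  assumes "time_bounded b e (enc_list e1) L" "time_bounded b e (enc_list e1) L'"
  shows "time_bounded b e (enc_list e1) (\<lambda>x. L x @ L' x)"
proof -
  have "ptime (enc_pair (enc_list e1) (enc_list e1)) (enc_list e1)
      (\<lambda>z. foldl (\<lambda>a y. y # a) (snd z) (rev (fst z)))"
    by (rule time_bounded_foldl_additive[where g = "\<lambda>z. size (e1 (snd z)) + 1"])
       ((rule ptime_intros)+, simp, intro poly_bounded_intros poly_bounded_size_snd)
  from time_bounded_comp[OF time_bounded_pair[OF assms] this] show ?thesis
    by (simp add: foldl_Cons_rev[of "\<lambda>x. x", simplified])
qed

lemma size_enc_list_append: "size (enc_list e (xs @ ys)) = size (enc_list e xs) + size (enc_list e ys)"
  by (simp add: size_enc_list)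

lemma ptime_concat [ptime_intros]:
  assumes "time_bounded b e (enc_list (enc_list e1)) L"
  shows "time_bounded b e (enc_list e1) (\<lambda>x. concat (L x))"
proof -
  have "ptime (enc_list (enc_list e1)) (enc_list e1) (\<lambda>xs. foldl (@) [] xs)"
    by (rule time_bounded_foldl_additive[where g = "\<lambda>z. size (enc_list e1 (snd z))"])
       ((rule ptime_intros)+, simp add: size_enc_list_append, rule poly_bounded_size_snd)
  from time_bounded_comp[OF assms this] show ?thesis by (simp add: foldl_append)
qed

text \<open>The language can only branch on whether a tree is a leaf; this turns the branch into a
  canonical Boolean, for instance for the test against zero.\<close>

lemma ptime_not_leaf:
  assumes f: "time_bounded b e e1 f" and P: "\<And>y. P y \<longleftrightarrow> e1 y \<noteq> Lf"
  shows "time_bounded b e enc_bool (\<lambda>x. P (f x))"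
proof -
  have "run (Cond Ident (Join Leaf Leaf) Leaf) (e1 y) (enc_bool (P y))
      (if P y then 5 * size (e1 y) + 5 else 3 * size (e1 y) + 3)" for y
  proof (cases "e1 y")
    case Lf
    have "run Ident Lf Lf 1" using run.Ident[of Lf] by simp
    from run.Cond_False[OF this run.Leaf] show ?thesis using P[of y] Lf by (simp add: numeral_3_eq_3)
  next
    case (Br u v)
    have "run Ident (e1 y) (Br u v) (size (e1 y) + 1)" using run.Ident[of "e1 y"] Br by simp
    from run.Cond_True[OF this run.Join[OF run.Leaf run.Leaf]] show ?thesis
      using P[of y] Br by (simp add: algebra_simps eval_nat_numeral)
  qed
  then have "ptime e1 enc_bool P"
  proof (rule time_boundedI)
    show "poly_bounded (\<lambda>y. if P y then 5 * size (e1 y) + 5 else 3 * size (e1 y) + 3)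
        (\<lambda>y. size (e1 y))"
      by (rule poly_bounded_mono[of "\<lambda>y. 5 * size (e1 y) + 5"])
         (intro poly_bounded_intros poly_bounded_refl, simp)
  qed
  with f show ?thesis by (rule time_bounded_comp)
qed

section \<open>Binary numbers\<close>

lemma enc_nat_rec: "enc_nat n = (if n = 0 then Lf else Br (enc_bool (odd n)) (enc_nat (n div 2)))"
  by (simp add: enc_nat_def bits.simps[of n])

lemma enc_nat_0 [simp]: "enc_nat 0 = Lf"
  by (simp add: enc_nat_rec)

lemma ptime_odd [ptime_intros]:
  assumes "time_bounded b e enc_nat f"
  shows "time_bounded b e enc_bool (\<lambda>x. odd (f x))"
proof -
  have "\<exists>u. enc_nat n = Br (enc_bool (odd n)) u \<or> enc_nat n = Lf \<and> enc_bool (odd n) = Lf" for n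
    by (subst (1 2) enc_nat_rec) auto
  then have "ptime enc_nat enc_bool (\<lambda>n. odd n)" by (rule ptime_primitive_Left)
  with assms show ?thesis by (rule time_bounded_comp[where g = odd])
qed

lemma ptime_half [ptime_intros]:
  assumes "time_bounded b e enc_nat f"
  shows "time_bounded b e enc_nat (\<lambda>x. f x div 2)"
proof -
  have "\<exists>u. enc_nat n = Br u (enc_nat (n div 2)) \<or> enc_nat n = Lf \<and> enc_nat (n div 2) = Lf" for n
    by (subst (1 3) enc_nat_rec) auto
  then have "ptime enc_nat enc_nat (\<lambda>n. n div 2)" by (rule ptime_primitive_Right)
  with assms show ?thesis by (rule time_bounded_comp[where g = "\<lambda>n. n div 2"])
qed

lemma ptime_not_0 [ptime_intros]:
  assumes "time_bounded b e enc_nat f"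
  shows "time_bounded b e enc_bool (\<lambda>x. f x \<noteq> 0)"
  by (rule ptime_not_leaf[OF assms]) (subst enc_nat_rec, auto)

lemma ptime_bits [ptime_intros]:
  assumes "time_bounded b e enc_nat f"
  shows "time_bounded b e (enc_list enc_bool) (\<lambda>x. bits (f x))"
  by (rule time_bounded_recode[OF assms]) (simp add: enc_nat_def)

text \<open>Addition of one: the state consists of the carry and the output bits in reverse order.\<close>

definition carry_step :: "bool \<times> bool list \<Rightarrow> bool \<Rightarrow> bool \<times> bool list" where
  "carry_step a d = (fst a \<and> d, (d \<noteq> fst a) # snd a)"

definition carry_finish :: "bool \<times> bool list \<Rightarrow> bool list" where
  "carry_finish a = rev (if fst a then True # snd a else snd a)"

lemma carry_finish_bits:
  "carry_finish (foldl carry_step (c, out) (bits n)) = rev out @ bits (n + of_bool c)"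
proof (induction n arbitrary: c out rule: bits.induct)
  case (1 n)
  show ?case
  proof (cases "n = 0")
    case True
    then show ?thesis by (simp add: carry_finish_def bits.simps)
  next
    case False
    have "carry_finish (foldl carry_step (c, out) (bits n))
        = carry_finish (foldl carry_step (c \<and> odd n, (odd n \<noteq> c) # out) (bits (n div 2)))"
      using False by (subst bits.simps) (simp add: carry_step_def[of "(c, out)"])
    also have "\<dots> = rev out @ (odd n \<noteq> c) # bits (n div 2 + of_bool (c \<and> odd n))"
      using 1[OF False] by simp
    also have "\<dots> = rev out @ bits (n + of_bool c)"
      using False by (subst (2) bits.simps) (auto elim!: oddE evenE)
    finally show ?thesis .
  qed
qed

lemma ptime_Suc [ptime_intros]:
  assumes "time_bounded b e enc_nat f"
  shows "time_bounded b e enc_nat (\<lambda>x. Suc (f x))"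
proof -
  have "ptime enc_nat (enc_pair enc_bool (enc_list enc_bool))
      (\<lambda>n. foldl carry_step (True, []) (bits n))"
    by (rule time_bounded_foldl_additive[where g = "\<lambda>_. 3"])
       (unfold carry_step_def, (rule ptime_intros)+,
        simp add: enc_pair_eq enc_bool_True_iff, rule poly_bounded_const)
  note fold = this
  have "ptime enc_nat (enc_list enc_bool) (\<lambda>n. carry_finish (foldl carry_step (True, []) (bits n)))"
    unfolding carry_finish_def by (rule ptime_intros fold)+
  then have "ptime enc_nat enc_nat Suc"
    by (rule time_bounded_recode) (simp add: carry_finish_bits enc_nat_def)
  with assms show ?thesis by (rule time_bounded_comp)
qed

text \<open>Scanning from the least significant bit, the flag tells whether the part of \<open>m\<close> read so far is
  at most the corresponding part of \<open>n\<close>; later bits override it.\<close>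

definition compare_step :: "bool \<times> nat \<Rightarrow> bool \<Rightarrow> bool \<times> nat" where
  "compare_step a d = (if d = odd (snd a) then fst a else odd (snd a), snd a div 2)"

text \<open>What remains of \<open>n\<close> once the bits of \<open>m\<close> are used up stands
  above the top bit of \<open>m\<close>, so a nonzero rest means \<open>m < n\<close> whatever the
  flag says. The initial flag \<open>r\<close> is the verdict for a tie.\<close>

lemma foldl_compare_step:
  "(case foldl compare_step (r, n) (bits m) of (r', n') \<Rightarrow> n' \<noteq> 0 \<or> r') \<longleftrightarrow> m < n \<or> m = n \<and> r"
proof (induction m arbitrary: r n rule: bits.induct)
  case (1 m)
  show ?case
  proof (cases "m = 0")
    case True
    then show ?thesis by (auto simp: bits.simps)
  next
    case False
    have "(m div 2 < n div 2 \<or> m div 2 = n div 2 \<and> (if odd m = odd n then r else odd n))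
        \<longleftrightarrow> m < n \<or> m = n \<and> r"
      by (cases r; cases "even m"; cases "even n"; simp; presburger)
    then show ?thesis
      using 1[OF False, of "if odd m = odd n then r else odd n" "n div 2"] False
      by (cases "odd m = odd n"; subst bits.simps; simp add: compare_step_def[of "(r, n)"])
  qed
qed

lemma size_enc_nat_half: "size (enc_nat (n div 2)) \<le> size (enc_nat n)"
  by (subst (2) enc_nat_rec) auto

lemma ptime_le [ptime_intros]:
  assumes "time_bounded b e enc_nat f" "time_bounded b e enc_nat g"
  shows "time_bounded b e enc_bool (\<lambda>x. f x \<le> g x)"
proof -
  have "ptime (enc_pair enc_nat enc_nat) (enc_pair enc_bool enc_nat)
      (\<lambda>z. foldl compare_step (True, snd z) (bits (fst z)))"
    by (rule time_bounded_foldl_additive[where g = "\<lambda>_. 1"])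
       (unfold compare_step_def, (rule ptime_intros)+,
        use size_enc_nat_half in \<open>auto simp: enc_pair_eq enc_bool_True_iff intro: le_SucI\<close>,
        rule poly_bounded_const)
  note fold = this
  have "ptime (enc_pair enc_nat enc_nat) enc_bool
      (\<lambda>z. snd (foldl compare_step (True, snd z) (bits (fst z))) \<noteq> 0
         \<or> fst (foldl compare_step (True, snd z) (bits (fst z))))"
    by (rule fold ptime_intros)+
  then have "ptime (enc_pair enc_nat enc_nat) enc_bool (\<lambda>z. fst z \<le> snd z)"
    by (rule time_bounded_recode) (use foldl_compare_step[of True] in \<open>auto simp: case_prod_unfold le_less\<close>)
  from time_bounded_comp[OF time_bounded_pair[OF assms] this] show ?thesis by simp
qed

lemma ptime_less [ptime_intros]:
  assumes "time_bounded b e enc_nat f" "time_bounded b e enc_nat g"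
  shows "time_bounded b e enc_bool (\<lambda>x. f x < g x)"
  by (rule time_bounded_recode[OF ptime_Not[OF ptime_le[OF assms(2,1)]]]) (simp add: not_le)

lemma ptime_eq_nat [ptime_intros]:
  assumes "time_bounded b e enc_nat f" "time_bounded b e enc_nat g"
  shows "time_bounded b e enc_bool (\<lambda>x. f x = g x)"
  by (rule time_bounded_recode[OF ptime_conj[OF ptime_le[OF assms] ptime_le[OF assms(2,1)]]]) (simp add: eq_iff)

lemma size_enc_nat_Suc: "size (enc_nat (Suc n)) \<le> size (enc_nat n) + 2"
proof (induction n rule: less_induct)
  case (less n)
  have "size (enc_nat (Suc (n div 2))) \<le> size (enc_nat (n div 2)) + 2" if "n \<noteq> 0"
    using that by (intro less.IH) simp
  then show ?case
    by (subst (1 2) enc_nat_rec) (auto simp: enc_bool_True_iff elim!: oddE evenE)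
qed

lemma ptime_length [ptime_intros]:
  assumes "time_bounded b e (enc_list e1) L"
  shows "time_bounded b e enc_nat (\<lambda>x. length (L x))"
proof -
  have "ptime (enc_list e1) enc_nat (\<lambda>xs. foldl (\<lambda>a _. Suc a) 0 xs)"
    by (rule time_bounded_foldl_additive[where g = "\<lambda>_. 2"])
       ((rule ptime_intros)+, rule size_enc_nat_Suc, rule poly_bounded_const)
  from time_bounded_comp[OF assms this] show ?thesis by (simp add: foldl_Suc)
qed

lemma ptime_member [ptime_intros]:
  assumes f: "ptime e enc_nat f" and L: "ptime e (enc_list enc_nat) L"
  shows "ptime e enc_bool (\<lambda>x. f x \<in> set (L x))"
proof -
  have f': "ptime (enc_pair e enc_nat) enc_nat (\<lambda>z. f (fst z))"
    by (rule time_bounded_comp[OF ptime_fst[OF ptime_id] f])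
  have "ptime e enc_bool (\<lambda>x. \<exists>y \<in> set (L x). f x = y)"
    by (rule L f' ptime_intros)+
  then show ?thesis by (rule time_bounded_recode) simp
qed

text \<open>The value \<open>0\<close> at the empty list is what \<^const>\<open>Left\<close> computes on its encoding.\<close>

definition hd0 :: "nat list \<Rightarrow> nat" where
  "hd0 xs = (case xs of [] \<Rightarrow> 0 | x # _ \<Rightarrow> x)"

lemma hd0_simps [simp]: "hd0 [] = 0" "hd0 (x # xs) = x"
  by (simp_all add: hd0_def)

lemma ptime_hd0 [ptime_intros]:
  assumes "time_bounded b e (enc_list enc_nat) L"
  shows "time_bounded b e enc_nat (\<lambda>x. hd0 (L x))"
proof -
  have "\<exists>u. enc_list enc_nat xs = Br (enc_nat (hd0 xs)) u
      \<or> enc_list enc_nat xs = Lf \<and> enc_nat (hd0 xs) = Lf" for xs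
    by (cases xs) auto
  then have "ptime (enc_list enc_nat) enc_nat hd0" by (rule ptime_primitive_Left)
  with assms show ?thesis by (rule time_bounded_comp)
qed

section \<open>Exponential and elementary time\<close>

lemma time_bounded_mono:
  assumes "time_bounded b e e' f" "poly_bounded b b'"
  shows "time_bounded b' e e' f"
  using assms poly_bounded_trans unfolding time_bounded_def by blast

section \<open>Enumerating all lists of bounded length\<close>

definition expand :: "'a list \<Rightarrow> 'a list list \<Rightarrow> 'a list list" where
  "expand ys zs = [] # concat (map (\<lambda>y. map ((#) y) zs) ys)"

text \<open>The second list serves only as a unary counter, so that the iteration is a fold.
  \<open>expand\<close> always puts the empty list back, which is why all shorter lists occur as
  well.\<close>

definition all_lists :: "'a list \<Rightarrow> 'b list \<Rightarrow> 'a list list" where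
  "all_lists ys xs = foldl (\<lambda>zs _. expand ys zs) [[]] xs"

lemma set_all_lists: "set (all_lists ys xs) = {zs. set zs \<subseteq> set ys \<and> length zs \<le> length xs}"
proof (induction xs rule: rev_induct)
  case Nil
  then show ?case by (auto simp: all_lists_def)
next
  case (snoc x xs)
  have "all_lists ys (xs @ [x]) = expand ys (all_lists ys xs)" by (simp add: all_lists_def)
  then have "zs \<in> set (all_lists ys (xs @ [x])) \<longleftrightarrow> set zs \<subseteq> set ys \<and> length zs \<le> Suc (length xs)" for zs
    using snoc.IH by (cases zs) (auto simp: expand_def)
  then show ?case by auto
qed

lemma size_enc_list_expand:
  "size (enc_list (enc_list e) (expand ys zs))
    \<le> 2 * size (enc_list e ys) * size (enc_list (enc_list e) zs) + 1"
proof -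
  let ?A = "size (enc_list e ys)" and ?B = "size (enc_list (enc_list e) zs)"
  have inner: "size (enc_list (enc_list e) (map ((#) y) zs)) = length zs * (size (e y) + 1) + ?B" for y
    by (induction zs) auto
  have "size (enc_list (enc_list e) (concat (map (\<lambda>y. map ((#) y) zs) ys)))
      = length zs * ?A + length ys * ?B"
    by (induction ys) (simp_all add: size_enc_list_append inner algebra_simps)
  also have "\<dots> \<le> ?B * ?A + ?A * ?B"
    by (intro add_mono mult_right_mono length_le_size_enc_list) auto
  finally show ?thesis by (simp add: expand_def algebra_simps)
qed

lemma size_enc_list_all_lists:
  "size (enc_list (enc_list e) (all_lists ys xs)) \<le> (2 * size (enc_list e ys) + 1) ^ length xs"
proof (induction xs rule: rev_induct)
  case (snoc x xs)
  let ?A = "size (enc_list e ys)"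
  have "size (enc_list (enc_list e) (all_lists ys (xs @ [x])))
      \<le> 2 * ?A * size (enc_list (enc_list e) (all_lists ys xs)) + 1"
    using size_enc_list_expand by (simp add: all_lists_def)
  also have "\<dots> \<le> 2 * ?A * (2 * ?A + 1) ^ length xs + (2 * ?A + 1) ^ length xs"
    using snoc.IH by (intro add_mono mult_left_mono) auto
  finally show ?case by (simp add: algebra_simps)
qed (simp add: all_lists_def)

lemma take_foldl_all_lists:
  "foldl (\<lambda>zs _. expand ys zs) [[]] (take i xs) = all_lists ys (take i xs)"
  by (simp add: all_lists_def)

text \<open>\<open>expand\<close> multiplies the size of the accumulator, so the additive rule does
  not apply and the exponential bound is supplied to the general fold rule.\<close>

lemma time_bounded_all_lists:
  assumes Y: "ptime e (enc_list e1) Y" and L: "ptime e (enc_list e2) L"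
    and b: "poly_bounded (\<lambda>x. size (e x)) b"
      "poly_bounded (\<lambda>x. (2 * size (enc_list e1 (Y x)) + 1) ^ length (L x)) b"
  shows "time_bounded b e (enc_list (enc_list e1)) (\<lambda>x. all_lists (Y x) (L x))"
  unfolding all_lists_def
proof (rule time_bounded_foldl)
  show "time_bounded b e (enc_list e2) L" by (rule time_bounded_mono[OF L b(1)])
  show "time_bounded b e (enc_list (enc_list e1)) (\<lambda>_. [[]])"
    by (rule time_bounded_const[OF b(1)])
  have Y': "ptime (enc_pair (enc_pair e e2) (enc_list (enc_list e1))) (enc_list e1)
      (\<lambda>z. Y (fst (fst z)))"
    by (rule time_bounded_comp[OF _ Y]) (rule ptime_intros)+
  show "ptime (enc_pair (enc_pair e e2) (enc_list (enc_list e1))) (enc_list (enc_list e1))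
      (\<lambda>z. expand (Y (fst (fst z))) (snd z))"
    unfolding expand_def by (rule Y' ptime_intros)+
  show "size (enc_list (enc_list e1) (foldl (\<lambda>zs _. expand (Y x) zs) [[]] (take i (L x))))
      \<le> (2 * size (enc_list e1 (Y x)) + 1) ^ length (L x)" if "i \<le> length (L x)" for x i
    unfolding take_foldl_all_lists
    by (rule order_trans[OF size_enc_list_all_lists]) (use that in \<open>auto intro: power_increasing\<close>)
qed (rule b(2))

section \<open>Computable majorants and functions of elementary growth\<close>

definition double_exp :: "nat \<Rightarrow> nat" where
  "double_exp n = 2 ^ (2 ^ length (bits n))"

lemma bits_power2: "bits (2 ^ n) = replicate n False @ [True]"
proof (induction n)
  case 0
  show ?case by (simp add: bits.simps)
next
  case (Suc n)
  then show ?case by (subst bits.simps) simp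
qed

lemma foldl_double: "foldl (\<lambda>a _. a @ a) (replicate n c) xs = replicate (n * 2 ^ length xs) c"
  by (induction xs arbitrary: n) (auto simp: replicate_add[symmetric] algebra_simps)

lemma foldl_double_singleton: "foldl (\<lambda>a _. a @ a) [c] xs = replicate (2 ^ length xs) c"
  using foldl_double[of 1 c xs] by simp

text \<open>In binary, least significant bit first, the value is a row of
  \<open>2 ^ length (bits n)\<close> zeros followed by a one. The zeros arise by doubling a
  singleton list once per bit of \<open>n\<close>, so one fold suffices and no multiplication has to
  be programmed.\<close>

lemma computable_double_exp: "computable double_exp"
proof -
  define b where "b n = size (enc_nat n) + 2 ^ length (bits n)" for n
  have b: "poly_bounded (\<lambda>n. size (enc_nat n)) b" "poly_bounded (\<lambda>n. 2 ^ length (bits n)) b"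
    by (simp_all add: b_def poly_bounded_le)
  have "time_bounded b enc_nat (enc_list enc_bool) (\<lambda>n. foldl (\<lambda>a _. a @ a) [False] (bits n))"
  proof (rule time_bounded_foldl)
    show "time_bounded b enc_nat (enc_list enc_bool) bits"
      by (rule time_bounded_recode[OF time_bounded_id[OF b(1)]]) (simp add: enc_nat_def)
    have "size (enc_list enc_bool (replicate n False)) = n" for n by (induction n) auto
    then show "size (enc_list enc_bool (foldl (\<lambda>a _. a @ a) [False] (take i (bits n))))
        \<le> 2 ^ length (bits n)" for n i
      by (simp add: foldl_double_singleton power_increasing)
  qed ((rule time_bounded_const[OF b(1)] ptime_intros b(2))+)
  then have "time_bounded b enc_nat (enc_list enc_bool)
      (\<lambda>n. foldl (\<lambda>a _. a @ a) [False] (bits n) @ [True])"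
    by (rule ptime_append) (rule time_bounded_const[OF b(1)])
  then have "time_bounded b enc_nat enc_nat double_exp"
    by (rule time_bounded_recode)
       (simp add: foldl_double_singleton double_exp_def enc_nat_def bits_power2)
  then show ?thesis unfolding time_bounded_def computable_def by blast
qed

lemma computable_funpow: "computable f \<Longrightarrow> computable (f ^^ j)"
proof (induction j)
  case 0
  show ?case unfolding computable_def by (auto intro: run.Ident exI[of _ Ident])
next
  case (Suc j)
  then obtain p q where "\<And>x. \<exists>n. run p (enc_nat x) (enc_nat (f x)) n"
    "\<And>x. \<exists>n. run q (enc_nat x) (enc_nat ((f ^^ j) x)) n"
    unfolding computable_def by blast
  then have "\<exists>n. run (Seq q p) (enc_nat x) (enc_nat ((f ^^ Suc j) x)) n" for x
    using run.Seq by (metis comp_apply funpow.simps(2))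
  then show ?case unfolding computable_def by blast
qed

text \<open>Only growth is restricted. Computability comes from the majorant, so the concrete bounds
  on kernel size and search time never have to be programmed.\<close>

definition elementary :: "(nat \<Rightarrow> nat) \<Rightarrow> bool" where
  "elementary f \<longleftrightarrow> (\<exists>j. \<forall>x. f x \<le> (double_exp ^^ j) x)"

lemma elementary_imp_computable_bound: "elementary f \<Longrightarrow> \<exists>g. computable g \<and> (\<forall>x. f x \<le> g x)"
  using computable_funpow[OF computable_double_exp] unfolding elementary_def by blast

lemma elementary_mono: "elementary g \<Longrightarrow> (\<And>x. f x \<le> g x) \<Longrightarrow> elementary f"
  unfolding elementary_def by (meson order_trans)

lemma less_power2_length_bits: "n < 2 ^ length (bits n)"
proof (induction n rule: bits.induct)
  case (1 n)
  then show ?case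
    by (cases "n = 0") (simp_all add: bits.simps[of n])
qed

lemma length_bits_mono: "m \<le> n \<Longrightarrow> length (bits m) \<le> length (bits n)"
proof (induction m arbitrary: n rule: bits.induct)
  case (1 m)
  have "length (bits (m div 2)) \<le> length (bits (n div 2))" if "m \<noteq> 0"
    using 1 that by (simp add: div_le_mono)
  with 1(2) show ?case by (simp add: bits.simps[of m] bits.simps[of n])
qed

lemma double_exp_mono: "m \<le> n \<Longrightarrow> double_exp m \<le> double_exp n"
  unfolding double_exp_def by (intro power_increasing length_bits_mono) auto

text \<open>The outer exponent is a power of two taken at the bit length of \<open>n\<close>, and
  such a power already exceeds \<open>n\<close>.\<close>

lemma power2_Suc_le_double_exp: "2 ^ Suc n \<le> double_exp n"
  unfolding double_exp_def using less_power2_length_bits[of n] by (intro power_increasing) auto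

lemma less_double_exp: "n < double_exp n"
  using power2_Suc_le_double_exp[of n] less_exp[of "Suc n"] by linarith

lemma funpow_double_exp_mono: "m \<le> n \<Longrightarrow> (double_exp ^^ j) m \<le> (double_exp ^^ j) n"
  by (induction j) (auto intro: double_exp_mono)

lemma add_le_funpow_double_exp: "n + j \<le> (double_exp ^^ j) n"
proof (induction j)
  case (Suc j)
  then show ?case using less_double_exp[of "(double_exp ^^ j) n"] by simp
qed simp

lemma elementary_comp:
  assumes "elementary f" "elementary g"
  shows "elementary (\<lambda>x. f (g x))"
proof -
  from assms obtain i j where "\<And>x. f x \<le> (double_exp ^^ i) x" "\<And>x. g x \<le> (double_exp ^^ j) x"
    unfolding elementary_def by blast
  then have "f (g x) \<le> (double_exp ^^ (i + j)) x" for x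
    unfolding funpow_add comp_apply by (meson funpow_double_exp_mono order_trans)
  then show ?thesis unfolding elementary_def by blast
qed

lemma elementary_poly: "elementary (\<lambda>x. c * (x + 1) ^ d)"
proof -
  \<comment> \<open>Every application of \<open>double_exp\<close> adds at least one, so
    \<open>c + d\<close> of them carry \<open>x\<close> beyond \<open>x + (c + d)\<close>; the
    remaining two absorb the two nested powers of 2.\<close>
  have "c * (x + 1) ^ d \<le> (double_exp ^^ (2 + (c + d))) x" for x
  proof -
    have le: "n + 1 \<le> 2 ^ n" for n :: nat by (simp add: Suc_le_eq)
    have "c * (x + 1) ^ d \<le> 2 ^ c * (2 ^ x) ^ d"
      by (intro mult_mono power_mono le less_imp_le less_exp) auto
    also have "\<dots> = 2 ^ (c + x * d)" by (simp add: power_add power_mult)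
    also have "\<dots> \<le> 2 ^ (2 ^ (x + (c + d)))"
    proof (intro power_increasing)
      have "c + x * d \<le> (x + 1) * (c + d + 1)" by (simp add: algebra_simps)
      also have "\<dots> \<le> 2 ^ x * 2 ^ (c + d)" by (intro mult_mono le) auto
      finally show "c + x * d \<le> 2 ^ (x + (c + d))" by (simp add: power_add)
    qed simp
    also have "\<dots> \<le> double_exp (double_exp (x + (c + d)))"
    proof -
      have exp_le: "2 ^ n \<le> double_exp n" for n
        using power2_Suc_le_double_exp[of n] by simp
      have "(2::nat) ^ (2 ^ (x + (c + d))) \<le> 2 ^ double_exp (x + (c + d))"
        by (intro power_increasing exp_le) simp
      then show ?thesis using exp_le order_trans by blast
    qed
    also have "\<dots> \<le> double_exp (double_exp ((double_exp ^^ (c + d)) x))"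
      by (intro double_exp_mono add_le_funpow_double_exp)
    finally show ?thesis by (simp add: numeral_2_eq_2)
  qed
  then show ?thesis unfolding elementary_def by blast
qed

lemma elementary_max:
  assumes "elementary f" "elementary g"
  shows "elementary (\<lambda>x. max (f x) (g x))"
proof -
  from assms obtain i j where ij: "\<And>x. f x \<le> (double_exp ^^ i) x" "\<And>x. g x \<le> (double_exp ^^ j) x"
    unfolding elementary_def by blast
  have inc: "(double_exp ^^ i) x \<le> (double_exp ^^ (i + j)) x" for i j x
    unfolding funpow_add comp_apply
    using add_le_funpow_double_exp[of x j] by (intro funpow_double_exp_mono) simp
  have "max (f x) (g x) \<le> (double_exp ^^ (i + j)) x" for x
    using ij[of x] inc[of i x j] inc[of j x i] by (simp add: add.commute)
  then show ?thesis unfolding elementary_def by blast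
qed

lemma elementary_mult:
  assumes "elementary f" "elementary g"
  shows "elementary (\<lambda>x. f x * g x)"
proof (rule elementary_mono[OF elementary_comp[OF elementary_poly[of 1 2] elementary_max[OF assms]]])
  show "f x * g x \<le> 1 * (max (f x) (g x) + 1) ^ 2" for x
    unfolding power2_eq_square mult_1 by (intro mult_mono) auto
qed

lemma elementary_add:
  assumes "elementary f" "elementary g"
  shows "elementary (\<lambda>x. f x + g x)"
proof (rule elementary_mono[OF elementary_comp[OF elementary_poly[of 2 1] elementary_max[OF assms]]])
  show "f x + g x \<le> 2 * (max (f x) (g x) + 1) ^ 1" for x by simp
qed

lemma elementary_const: "elementary (\<lambda>_. c)"
  using elementary_poly[of c 0] by simp

lemma elementary_id: "elementary (\<lambda>x. x)"
  by (rule elementary_mono[OF elementary_poly[of 1 1]]) simp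

lemma elementary_power:
  assumes "elementary f" "elementary g"
  shows "elementary (\<lambda>x. f x ^ g x)"
proof -
  have "elementary double_exp" unfolding elementary_def by (rule exI[of _ 1]) simp
  then show ?thesis
  proof (rule elementary_mono[OF elementary_comp[OF _ elementary_mult[OF assms]]])
    show "f x ^ g x \<le> double_exp (f x * g x)" for x
    proof -
      have "f x ^ g x \<le> (2 ^ f x) ^ g x" by (rule power_mono[OF less_imp_le[OF less_exp]]) simp
      also have "\<dots> \<le> 2 ^ Suc (f x * g x)" by (simp add: power_mult)
      also have "\<dots> \<le> double_exp (f x * g x)" by (rule power2_Suc_le_double_exp)
      finally show ?thesis .
    qed
  qed
qed

lemmas elementary_intros = elementary_add elementary_mult elementary_power elementary_max
  elementary_const elementary_id

section \<open>Walks and modular partitions\<close>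

text \<open>In \<open>walk E u r v\<close> the list \<open>r\<close> omits the initial vertex \<open>u\<close>, so its length is the number of
  edges.\<close>

fun walk :: "'a rel \<Rightarrow> 'a \<Rightarrow> 'a list \<Rightarrow> 'a \<Rightarrow> bool" where
  "walk E u [] v \<longleftrightarrow> u = v"
| "walk E u (x # r) v \<longleftrightarrow> (u, x) \<in> E \<and> walk E x r v"

text \<open>Minimality over walks instead of paths makes concatenation and shortcuts free of side
  conditions; by \<open>geodesic_distinct\<close> the minimisers are paths all the same.\<close>

definition geodesic :: "'a rel \<Rightarrow> 'a \<Rightarrow> 'a list \<Rightarrow> 'a \<Rightarrow> bool" where
  "geodesic E u r v \<longleftrightarrow> walk E u r v \<and> (\<forall>s. walk E u s v \<longrightarrow> length r \<le> length s)"

definition strong :: "'a set \<Rightarrow> 'a rel \<Rightarrow> ('a \<Rightarrow> nat) \<Rightarrow> bool" where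
  "strong V E c \<longleftrightarrow> (\<forall>u \<in> V. \<forall>v \<in> V. u \<noteq> v \<longrightarrow>
     (\<exists>r. geodesic E u r v \<and> (\<exists>x \<in> set (u # r). \<forall>y \<in> set (u # r). c y = c x \<longrightarrow> y = x)))"

lemma walk_append: "walk E u (r @ s) v \<longleftrightarrow> (\<exists>w. walk E u r w \<and> walk E w s v)"
  by (induction r arbitrary: u) auto

lemma walk_last: "walk E u r v \<Longrightarrow> last (u # r) = v"
  by (induction r arbitrary: u) (auto split: if_splits)

lemma walk_in_verts: "walk E u r v \<Longrightarrow> E \<subseteq> V \<times> V \<Longrightarrow> u \<in> V \<Longrightarrow> set r \<subseteq> V \<and> v \<in> V"
  by (induction r arbitrary: u) auto

lemma geodesic_walk: "geodesic E u r v \<Longrightarrow> walk E u r v"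
  by (simp add: geodesic_def)

lemma ex_geodesic: "walk E u r v \<Longrightarrow> \<exists>s. geodesic E u s v"
  unfolding geodesic_def
  by (rule exI[of _ "arg_min length (\<lambda>r. walk E u r v)"])
     (use arg_min_nat_lemma[of "\<lambda>r. walk E u r v" r length] in auto)

lemma geodesic_tl: "geodesic E u (x # r) v \<Longrightarrow> geodesic E x r v"
  unfolding geodesic_def by (auto dest: spec[of _ "x # _"])

lemma geodesic_distinct: "geodesic E u r v \<Longrightarrow> distinct (u # r)"
proof (induction r arbitrary: u)
  case (Cons x r)
  have "u \<notin> set (x # r)"
  proof
    assume "u \<in> set (x # r)"
    then obtain as bs where split: "x # r = as @ u # bs" by (meson split_list)
    then have "walk E u (as @ u # bs) v" using geodesic_walk[OF Cons.prems] by simp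
    then have "walk E u bs v" unfolding walk_append by auto
    then have "length (x # r) \<le> length bs"
      using Cons.prems unfolding geodesic_def by blast
    then show False using split by simp
  qed
  with Cons.IH[OF geodesic_tl[OF Cons.prems]] show ?case by simp
qed simp

section \<open>Transfer between graphs with a common quotient\<close>

text \<open>The classes of \<open>\<tau>\<close> are modules and \<open>B\<close> is the adjacency
  of the quotient; nothing is said about edges inside a class. Since \<open>B\<close> is a
  parameter, two graphs can be compared by sharing it.\<close>

definition modular :: "'a set \<Rightarrow> 'a rel \<Rightarrow> ('a \<Rightarrow> 't) \<Rightarrow> ('t \<Rightarrow> 't \<Rightarrow> bool) \<Rightarrow> bool" where
  "modular V E \<tau> B \<longleftrightarrow>
     (\<forall>u \<in> V. \<forall>v \<in> V. \<tau> u \<noteq> \<tau> v \<longrightarrow> ((u, v) \<in> E \<longleftrightarrow> B (\<tau> u) (\<tau> v)))"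

lemma modularD: "modular V E \<tau> B \<Longrightarrow> u \<in> V \<Longrightarrow> v \<in> V \<Longrightarrow> \<tau> u \<noteq> \<tau> v \<Longrightarrow> (u, v) \<in> E \<longleftrightarrow> B (\<tau> u) (\<tau> v)"
  by (simp add: modular_def)

text \<open>A geodesic that leaves the module of a vertex may be entered at any vertex of that module,
  so meeting a module twice would allow a shortcut.\<close>

lemma geodesic_types_distinct:
  assumes "geodesic E u r v" "modular V E \<tau> B" "E \<subseteq> V \<times> V" "u \<in> V" "\<tau> u \<noteq> \<tau> v"
  shows "distinct (map \<tau> (u # r))"
  using assms(1,4,5)
proof (induction r arbitrary: u)
  case (Cons x r)
  have walk: "walk E x r v" "(u, x) \<in> E" using geodesic_walk[OF Cons.prems(1)] by auto
  have x: "x \<in> V" and v: "v \<in> V"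
    using walk_in_verts[OF geodesic_walk[OF Cons.prems(1)] assms(3) Cons.prems(2)] by auto
  show ?case
  proof (cases "\<tau> x = \<tau> v")
    case True
    \<comment> \<open>\<open>x\<close> lies in the module of \<open>v\<close>, so \<open>u\<close>
      is adjacent to \<open>v\<close> itself and the geodesic consists of one edge.\<close>
    then have "(u, v) \<in> E"
      using walk(2) modularD[OF assms(2)] Cons.prems(2,3) x v by metis
    then have "walk E u [v] v" by simp
    then have "length (x # r) \<le> length [v]"
      using Cons.prems(1) unfolding geodesic_def by blast
    then show ?thesis using Cons.prems(3) True by simp
  next
    case False
    have dist: "distinct (map \<tau> (x # r))"
      by (rule Cons.IH[OF geodesic_tl[OF Cons.prems(1)] x False])
    have "\<tau> u \<notin> \<tau> ` set (x # r)"
    proof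
      assume "\<tau> u \<in> \<tau> ` set (x # r)"
      then obtain y as bs where y: "\<tau> y = \<tau> u" and split: "x # r = as @ y # bs"
        by (metis image_iff split_list)
      then have "walk E u (as @ y # bs) v" using geodesic_walk[OF Cons.prems(1)] by simp
      then obtain w where wy: "walk E u as w" "(w, y) \<in> E" "walk E y bs v" unfolding walk_append by auto
      show False
      proof (cases bs)
        case Nil
        then show False using wy y Cons.prems(3) by simp
      next
        case (Cons z bs')
        have "y \<in> V" using wy(2) assms(3) by auto
        moreover have "z \<in> V" "(y, z) \<in> E" using wy(3) Cons assms(3) by auto
        moreover have "\<tau> z \<noteq> \<tau> y" using dist unfolding split Cons by auto
        ultimately have "(u, z) \<in> E"
          using modularD[OF assms(2)] y \<open>u \<in> V\<close> by metis
        then have "walk E u bs v" using wy(3) Cons by simp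
        then have "length (x # r) \<le> length bs"
          using \<open>geodesic E u (x # r) v\<close> unfolding geodesic_def by blast
        then show False using split by simp
      qed
    qed
    with dist show ?thesis by simp
  qed
qed simp

text \<open>Every step of the walk joins two different types, so it depends on \<open>B\<close>
  alone and the vertices can be replaced one at a time by vertices of the same type and colour. The
  last one is prescribed as \<open>v'\<close>, which calls for at least one step: for
  \<open>r = []\<close> the vertices \<open>u'\<close> and \<open>v'\<close> could differ.\<close>

lemma walk_transfer:
  assumes "walk E u r v" "r \<noteq> []" "distinct (map \<tau> (u # r))" "u \<in> V"
    and "modular V E \<tau> B" "modular V' E' \<tau>' B" "E \<subseteq> V \<times> V"
    and "\<And>w. w \<in> V \<Longrightarrow> \<exists>w' \<in> V'. \<tau>' w' = \<tau> w \<and> c' w' = c w"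
    and "u' \<in> V'" "\<tau>' u' = \<tau> u" "v' \<in> V'" "\<tau>' v' = \<tau> v" "c' v' = c v"
  shows "\<exists>r'. walk E' u' r' v' \<and> map \<tau>' r' = map \<tau> r \<and> map c' r' = map c r"
  using assms(1-4,9,10)
proof (induction r arbitrary: u u')
  case (Cons x r)
  have x: "x \<in> V" using Cons.prems(1) assms(7) by auto
  have step: "(u', y) \<in> E'" if "y \<in> V'" "\<tau>' y = \<tau> x" for y
  proof -
    have "\<tau> u \<noteq> \<tau> x" using Cons.prems(3) by auto
    then have "B (\<tau> u) (\<tau> x)" using Cons.prems modularD[OF assms(5)] x by auto
    then show ?thesis
      using modularD[OF assms(6) Cons.prems(5) that(1)] that(2) Cons.prems(6) \<open>\<tau> u \<noteq> \<tau> x\<close> by simp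
  qed
  show ?case
  proof (cases "r = []")
    case True
    then have "x = v" using Cons.prems(1) by simp
    then show ?thesis using True step assms(11-13) by (intro exI[of _ "[v']"]) auto
  next
    case False
    obtain x' where x': "x' \<in> V'" "\<tau>' x' = \<tau> x" "c' x' = c x" using assms(8)[OF x] by blast
    obtain r' where "walk E' x' r' v'" "map \<tau>' r' = map \<tau> r" "map c' r' = map c r"
      using Cons.IH[OF _ False _ x x'(1,2)] Cons.prems by auto
    then show ?thesis using step x' by (intro exI[of _ "x' # r'"]) auto
  qed
qed simp

lemma geodesic_transfer:
  assumes "geodesic E u r v" "\<tau> u \<noteq> \<tau> v" "u \<in> V"
    and "modular V E \<tau> B" "modular V' E' \<tau>' B" "E \<subseteq> V \<times> V"
    and "\<And>w. w \<in> V \<Longrightarrow> \<exists>w' \<in> V'. \<tau>' w' = \<tau> w \<and> c' w' = c w"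
    and "u' \<in> V'" "\<tau>' u' = \<tau> u" "v' \<in> V'" "\<tau>' v' = \<tau> v" "c' v' = c v"
  obtains r' where "walk E' u' r' v'" "map \<tau>' r' = map \<tau> r" "map c' r' = map c r"
proof -
  have "r \<noteq> []" using geodesic_walk[OF assms(1)] assms(2) by auto
  then show ?thesis
    using walk_transfer[OF geodesic_walk[OF assms(1)] _
        geodesic_types_distinct[OF assms(1,4,6,3,2)] assms(3-12)] that by blast
qed

text \<open>\<open>fwd\<close> and \<open>bwd\<close> say that each type carries the same set of
  colours in both graphs. Ends of different types inherit the colour sequence of a geodesic of the
  other graph; ends of the same type are settled locally by \<open>proper\<close> and
  \<open>mates\<close>.\<close>

lemma strong_transfer:
  assumes strong: "strong V E c"
    and mod: "modular V E \<tau> B" "modular V' E' \<tau>' B" and E: "E \<subseteq> V \<times> V" "E' \<subseteq> V' \<times> V'"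
    and fwd: "\<And>w. w \<in> V \<Longrightarrow> \<exists>w' \<in> V'. \<tau>' w' = \<tau> w \<and> c' w' = c w"
    and bwd: "\<And>w'. w' \<in> V' \<Longrightarrow> \<exists>w \<in> V. \<tau> w = \<tau>' w' \<and> c w = c' w'"
    and proper: "\<And>u v. (u, v) \<in> E' \<Longrightarrow> c' u \<noteq> c' v"
    and mates: "\<And>u v. u \<in> V' \<Longrightarrow> v \<in> V' \<Longrightarrow> u \<noteq> v \<Longrightarrow> \<tau>' u = \<tau>' v \<Longrightarrow> (u, v) \<notin> E'
      \<Longrightarrow> \<exists>a. (u, a) \<in> E' \<and> (a, v) \<in> E'"
  shows "strong V' E' c'"
  unfolding strong_def
proof (intro ballI impI)
  fix u' v' assume u': "u' \<in> V'" and v': "v' \<in> V'" and ne: "u' \<noteq> v'"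
  show "\<exists>r. geodesic E' u' r v' \<and> (\<exists>x \<in> set (u' # r). \<forall>y \<in> set (u' # r). c' y = c' x \<longrightarrow> y = x)"
  proof (cases "\<tau>' u' = \<tau>' v'")
    case True
    show ?thesis
    proof (cases "(u', v') \<in> E'")
      case True
      have "geodesic E' u' [v'] v'"
        unfolding geodesic_def
      proof (intro conjI allI impI)
        fix s assume "walk E' u' s v'"
        then show "length [v'] \<le> length s" using ne by (cases s) auto
      qed (use True in simp)
      moreover have "c' u' \<noteq> c' v'" by (rule proper[OF True])
      ultimately show ?thesis by (intro exI[of _ "[v']"]) auto
    next
      case False
      then obtain a where a: "(u', a) \<in> E'" "(a, v') \<in> E'" using mates u' v' ne True by blast
      have "geodesic E' u' [a, v'] v'"
        unfolding geodesic_def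
      proof (intro conjI allI impI)
        fix s assume "walk E' u' s v'"
        then show "length [a, v'] \<le> length s"
          using ne False by (cases s; cases "tl s") auto
      qed (use a in simp)
      \<comment> \<open>The two ends may share a colour; the middle vertex is the one whose colour
        is unique.\<close>
      moreover have "c' u' \<noteq> c' a" "c' v' \<noteq> c' a" using proper a by metis+
      ultimately show ?thesis by (intro exI[of _ "[a, v']"]) auto
    qed
  next
    case False
    obtain u where u: "u \<in> V" "\<tau> u = \<tau>' u'" "c u = c' u'" using bwd[OF u'] by blast
    obtain v where v: "v \<in> V" "\<tau> v = \<tau>' v'" "c v = c' v'" using bwd[OF v'] by blast
    have ne': "\<tau> u \<noteq> \<tau> v" using False u v by simp
    then obtain r x where r: "geodesic E u r v" and x: "x \<in> set (u # r)"
      "\<forall>y \<in> set (u # r). c y = c x \<longrightarrow> y = x"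
      using strong u(1) v(1) unfolding strong_def by metis
    obtain r' where r': "walk E' u' r' v'" "map \<tau>' r' = map \<tau> r" "map c' r' = map c r"
      using geodesic_transfer[OF r ne' u(1) mod E(1) fwd u' u(2)[symmetric] v' v(2)[symmetric]
          v(3)[symmetric]] by blast
    have len: "length r' = length r" using r'(3) by (metis length_map)
    \<comment> \<open>Minimality comes from the reverse transfer: a shorter geodesic between
      \<open>u'\<close> and \<open>v'\<close> would yield an equally short walk between
      \<open>u\<close> and \<open>v\<close>.\<close>
    have "length r' \<le> length s" if "walk E' u' s v'" for s
    proof -
      obtain s' where s': "geodesic E' u' s' v'" using ex_geodesic[OF \<open>walk E' u' s v'\<close>] by blast
      obtain s'' where "walk E u s'' v" "map \<tau> s'' = map \<tau>' s'"
        using geodesic_transfer[OF s' False u' mod(2,1) E(2) bwd u(1,2) v(1,2,3)] by blast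
      then have "length r \<le> length s''" "length s'' = length s'"
        using r unfolding geodesic_def by (blast, metis length_map)
      moreover have "length s' \<le> length s" using s' that unfolding geodesic_def by blast
      ultimately show ?thesis using len by simp
    qed
    with r'(1) have geo: "geodesic E' u' r' v'" unfolding geodesic_def by blast
    have col: "map c' (u' # r') = map c (u # r)" using r' u by simp
    obtain i where i: "i < length (u # r)" "x = (u # r) ! i" using x(1) by (metis in_set_conv_nth)
    \<comment> \<open>Both walks show the same colours position by position, and the vertices of
      \<open>u # r\<close> are distinct, so a colour unique to position \<open>i\<close> on one walk
      is unique to it on the other.\<close>
    have "y = (u' # r') ! i" if y: "y \<in> set (u' # r')" "c' y = c' ((u' # r') ! i)" for y
    proof -
      obtain j where j: "j < length (u' # r')" "y = (u' # r') ! j"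
        using y(1) by (metis in_set_conv_nth)
      have eq: "c' ((u' # r') ! n) = c ((u # r) ! n)" if "n < length (u # r)" for n
        using arg_cong[OF col, of "\<lambda>l. l ! n"] that len by (simp del: list.map)
      have "c ((u # r) ! j) = c x" using y(2) j i eq len by simp
      then have "(u # r) ! j = (u # r) ! i" using x(2) i j len by (metis length_Cons nth_mem)
      then have "j = i"
        using geodesic_distinct[OF r] i j len by (metis length_Cons nth_eq_iff_index_eq)
      then show ?thesis using j by simp
    qed
    then show ?thesis using geo i len
      by (intro exI[of _ r'] conjI bexI[of _ "(u' # r') ! i"] nth_mem) auto
  qed
qed

lemma connected_transfer:
  assumes conn: "\<And>u v. u \<in> V \<Longrightarrow> v \<in> V \<Longrightarrow> \<exists>r. walk E u r v"
    and mod: "modular V E \<tau> B" "modular V' E' \<tau>' B" and E: "E \<subseteq> V \<times> V"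
    and types: "\<tau> ` V = \<tau>' ` V'"
    and mates: "\<And>u v. u \<in> V' \<Longrightarrow> v \<in> V' \<Longrightarrow> u \<noteq> v \<Longrightarrow> \<tau>' u = \<tau>' v \<Longrightarrow> (u, v) \<notin> E'
      \<Longrightarrow> \<exists>a. (u, a) \<in> E' \<and> (a, v) \<in> E'"
    and u': "u' \<in> V'" and v': "v' \<in> V'"
  shows "\<exists>r. walk E' u' r v'"
proof (cases "\<tau>' u' = \<tau>' v'")
  case True
  consider "u' = v'" | "(u', v') \<in> E'" | a where "(u', a) \<in> E'" "(a, v') \<in> E'"
    using mates[OF u' v' _ True] by blast
  then show ?thesis
  proof cases
    case 1
    then show ?thesis by (intro exI[of _ "[]"]) simp
  next
    case 2
    then show ?thesis by (intro exI[of _ "[v']"]) simp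
  next
    case 3
    then show ?thesis by (intro exI[of _ "[a, v']"]) simp
  qed
next
  case False
  \<comment> \<open>All vertices get the colour \<open>()\<close>, which turns the transfer of
    coloured walks into one of plain walks.\<close>
  have to: "\<exists>w' \<in> V'. \<tau>' w' = \<tau> w \<and> () = ()" if "w \<in> V" for w
    using types that by (metis image_iff)
  obtain u where u: "u \<in> V" "\<tau> u = \<tau>' u'" using types u' by (metis image_iff)
  obtain v where v: "v \<in> V" "\<tau> v = \<tau>' v'" using types v' by (metis image_iff)
  obtain r where r: "geodesic E u r v" using conn[OF u(1) v(1)] ex_geodesic by metis
  have "\<tau> u \<noteq> \<tau> v" using False u v by simp
  from geodesic_transfer[OF r this u(1) mod E to u' u(2)[symmetric] v' v(2)[symmetric]]
  show ?thesis by blast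
qed

text \<open>An edge is the only geodesic between its ends, and a path with two vertices is
  conflict-free only if their colours differ.\<close>

lemma strong_imp_proper:
  assumes "strong V E c" "(u, v) \<in> E" "u \<in> V" "v \<in> V" "u \<noteq> v"
  shows "c u \<noteq> c v"
proof -
  obtain r x where r: "geodesic E u r v" and x: "x \<in> set (u # r)"
    "\<forall>y \<in> set (u # r). c y = c x \<longrightarrow> y = x"
    using assms unfolding strong_def by metis
  have "walk E u [v] v" using assms(2) by simp
  then have "length r \<le> 1" using r unfolding geodesic_def by fastforce
  then have "r = [v]" using geodesic_walk[OF r] assms(5) by (cases r) auto
  then show ?thesis using x assms(5) by auto
qed


section \<open>Recolouring one module\<close>

text \<open>\<open>q\<close> names the clique of a vertex, so this is properness of a colouring of a
  disjoint union of cliques.\<close>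

definition proper_on :: "'a set \<Rightarrow> ('a \<Rightarrow> 'q) \<Rightarrow> ('a \<Rightarrow> nat) \<Rightarrow> bool" where
  "proper_on R q c \<longleftrightarrow> (\<forall>u \<in> R. \<forall>w \<in> R. q u = q w \<and> u \<noteq> w \<longrightarrow> c u \<noteq> c w)"

text \<open>If the colour of the deleted vertex is lost, it is moved to a vertex whose colour is repeated;
  such a vertex exists because there are at least as many vertices left as colours.\<close>

lemma recolour_delete:
  assumes "finite D" "finite K" "D \<inter> K = {}" "proper_on (K \<union> D) q c" "card (c ` (K \<union> D)) \<le> card K"
  shows "\<exists>d. proper_on K q d \<and> d ` K = c ` (K \<union> D)"
  using assms
proof (induction D arbitrary: c rule: finite_induct)
  case empty
  then show ?case by auto
next
  case (insert v D)
  let ?R = "K \<union> D"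
  have v: "v \<notin> ?R" using insert by auto
  obtain d where d: "proper_on ?R q d" "d ` ?R = c ` (K \<union> insert v D)"
  proof (cases "c v \<in> c ` ?R")
    case True
    then show ?thesis using insert.prems(3) by (intro that[of c]) (auto simp: proper_on_def)
  next
    case False
    have "card (c ` (K \<union> insert v D)) = Suc (card (c ` ?R))"
      using False insert by (simp add: insert_commute)
    then have "card (c ` ?R) < card K" using insert.prems(4) by simp
    also have "\<dots> \<le> card ?R" using insert by (intro card_mono) auto
    finally have "\<not> inj_on c ?R" using card_image by fastforce
    then obtain w w' where w: "w \<in> ?R" "w' \<in> ?R" "w \<noteq> w'" "c w = c w'" by (auto simp: inj_on_def)
    have "(c(w := c v)) ` ?R = c ` (K \<union> insert v D)"
    proof
      show "(c(w := c v)) ` ?R \<subseteq> c ` (K \<union> insert v D)" by auto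
      show "c ` (K \<union> insert v D) \<subseteq> (c(w := c v)) ` ?R"
      proof
        fix i assume "i \<in> c ` (K \<union> insert v D)"
        then obtain y where y: "i = c y" "y = v \<or> y \<in> ?R" by auto
        show "i \<in> (c(w := c v)) ` ?R"
        proof (cases "y = v \<or> y = w")
          case True
          then show ?thesis using y w
            by (metis (mono_tags, lifting) fun_upd_apply image_iff)
        next
          case False
          then show ?thesis using y by (metis (mono_tags, lifting) fun_upd_apply image_iff)
        qed
      qed
    qed
    moreover have "proper_on ?R q (c(w := c v))"
      using insert.prems(3) False unfolding proper_on_def by auto (metis image_eqI Un_iff)+
    ultimately show ?thesis by (intro that)
  qed
  have "\<exists>d'. proper_on K q d' \<and> d' ` K = d ` ?R"
    using insert.prems d by (intro insert.IH) auto
  with d(2) show ?case by simp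
qed

text \<open>The missing vertices are added one at a time. The clique of \<open>m\<close> is
  completely coloured, with distinct colours, and is at least as large as the clique being filled;
  hence one of its colours is still free there. As that colour is already in use, the colour set
  does not grow.\<close>

lemma recolour_insert:
  assumes "finite R" "K \<subseteq> R" "proper_on K q c" "m \<in> R" "{w \<in> R. q w = q m} \<subseteq> K"
    and max: "\<And>v. v \<in> R \<Longrightarrow> card {w \<in> R. q w = q v} \<le> card {w \<in> R. q w = q m}"
  shows "\<exists>d. proper_on R q d \<and> d ` R = c ` K"
proof -
  let ?M = "{w \<in> R. q w = q m}"
  have "\<exists>d. proper_on (K \<union> D) q d \<and> d ` (K \<union> D) = c ` K" if "finite D" "D \<subseteq> R - K" for D
    using that
  proof (induction D rule: finite_induct)
    case empty
    then show ?case using assms(3) by auto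
  next
    case (insert v D)
    then obtain d where d: "proper_on (K \<union> D) q d" "d ` (K \<union> D) = c ` K" by auto
    let ?S = "{w \<in> K \<union> D. q w = q v}"
    have v: "v \<in> R" "v \<notin> K \<union> D" and sub: "K \<union> D \<subseteq> R" using insert assms(2) by auto
    have "inj_on d ?M"
    proof (rule inj_onI)
      fix x y assume "x \<in> ?M" "y \<in> ?M" "d x = d y"
      moreover from this have "x \<in> K \<union> D" "y \<in> K \<union> D" "q x = q y" using assms(5) by auto
      ultimately show "x = y" using d(1) unfolding proper_on_def by blast
    qed
    \<comment> \<open>\<open>?S\<close> is the coloured part of the clique of \<open>v\<close>. It
      misses \<open>v\<close>, so it has strictly fewer vertices than the largest clique has
      colours.\<close>
    have "card (d ` ?S) \<le> card ?S"
      by (intro card_image_le finite_subset[OF _ assms(1)]) (use sub in auto)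
    also have "\<dots> < card {w \<in> R. q w = q v}"
      using v sub assms(1) by (intro psubset_card_mono) auto
    also have "\<dots> \<le> card (d ` ?M)" using max[OF v(1)] card_image[OF \<open>inj_on d ?M\<close>] by simp
    finally have "\<not> d ` ?M \<subseteq> d ` ?S"
      using card_mono[of "d ` ?S" "d ` ?M"] finite_subset[OF sub assms(1)] by fastforce
    then obtain w where w: "w \<in> ?M" "d w \<notin> d ` ?S" by blast
    have "proper_on (K \<union> insert v D) q (d(v := d w))"
      using d(1) w(2) v(2) unfolding proper_on_def by (auto simp: image_iff)
    moreover have "d w \<in> c ` K" using w(1) assms(5) d(2) by blast
    then have "(d(v := d w)) ` (K \<union> insert v D) = c ` K"
      using d(2) v(2) by (auto simp: image_iff)
    ultimately show ?case by blast
  qed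
  from this[of "R - K"] show ?thesis
    using assms(1,2) by (simp add: Un_absorb1)
qed

section \<open>Graphs with a twin cover\<close>

locale twin_covered =
  fixes V :: "'a set" and E :: "'a rel" and X :: "'a set"
  assumes finite_V: "finite V" and E_sub: "E \<subseteq> V \<times> V" and sym_E: "(u, v) \<in> E \<Longrightarrow> (v, u) \<in> E"
    and irrefl_E: "(u, u) \<notin> E"
    and walks: "u \<in> V \<Longrightarrow> v \<in> V \<Longrightarrow> \<exists>r. walk E u r v"
    and X_sub: "X \<subseteq> V"
    and twins: "(u, v) \<in> E \<Longrightarrow> u \<notin> X \<Longrightarrow> v \<notin> X \<Longrightarrow>
      insert u {w. (u, w) \<in> E} = insert v {w. (v, w) \<in> E}"
begin

definition type :: "'a \<Rightarrow> 'a + 'a set" where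
  "type v = (if v \<in> X then Inl v else Inr {x \<in> X. (v, x) \<in> E})"

text \<open>Adjacent vertices outside \<open>X\<close> are twins and so share a type; hence two
  different types outside \<open>X\<close> are never joined. Edges within a type are not governed by
  this relation.\<close>

fun type_adj :: "'a + 'a set \<Rightarrow> 'a + 'a set \<Rightarrow> bool" where
  "type_adj (Inl x) (Inl y) \<longleftrightarrow> (x, y) \<in> E"
| "type_adj (Inl x) (Inr S) \<longleftrightarrow> x \<in> S"
| "type_adj (Inr S) (Inl x) \<longleftrightarrow> x \<in> S"
| "type_adj (Inr S) (Inr T) \<longleftrightarrow> False"

text \<open>For \<open>v\<close> outside \<open>X\<close> this is the whole component of
  \<open>v\<close> in \<open>G - X\<close>, because adjacency between twins is transitive.\<close>

definition clique_of :: "'a \<Rightarrow> 'a set" where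
  "clique_of v = {w \<in> V - X. w = v \<or> (v, w) \<in> E}"

definition same_type_verts :: "'a \<Rightarrow> 'a set" where
  "same_type_verts v = {w \<in> V - X. type w = type v}"

lemma E_verts: "(u, v) \<in> E \<Longrightarrow> u \<in> V \<and> v \<in> V"
  using E_sub by auto

lemma twins_iff:
  "(u, v) \<in> E \<Longrightarrow> u \<notin> X \<Longrightarrow> v \<notin> X \<Longrightarrow> w = u \<or> (u, w) \<in> E \<longleftrightarrow> w = v \<or> (v, w) \<in> E"
  using twins[of u v] by blast

lemma adjacent_same_type:
  assumes "(u, v) \<in> E" "u \<notin> X" "v \<notin> X"
  shows "type u = type v"
proof -
  have "(u, x) \<in> E \<longleftrightarrow> (v, x) \<in> E" if "x \<in> X" for x
    using twins_iff[OF assms, of x] that assms by auto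
  then show ?thesis using assms by (auto simp: type_def)
qed

lemma modular_type: "modular V E type type_adj"
  unfolding modular_def
proof (intro ballI impI)
  fix u v assume "type u \<noteq> type v"
  then show "(u, v) \<in> E \<longleftrightarrow> type_adj (type u) (type v)"
    using sym_E adjacent_same_type[of u v]
    by (cases "u \<in> X"; cases "v \<in> X") (auto simp: type_def)
qed

lemma clique_of_refl: "v \<in> V - X \<Longrightarrow> v \<in> clique_of v"
  by (simp add: clique_of_def)

text \<open>Twins share their closed neighbourhoods, so \<open>clique_of\<close> is constant on
  components of \<open>G - X\<close> and separates them; this makes it usable as the label
  \<open>q\<close> of \<open>proper_on\<close>.\<close>

lemma clique_of_eq_iff:
  assumes "u \<in> V - X" "v \<in> V - X"
  shows "clique_of u = clique_of v \<longleftrightarrow> u = v \<or> (u, v) \<in> E"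
proof
  assume "clique_of u = clique_of v"
  then have "v \<in> clique_of u" using clique_of_refl[OF assms(2)] by simp
  then show "u = v \<or> (u, v) \<in> E" by (auto simp: clique_of_def)
next
  assume "u = v \<or> (u, v) \<in> E"
  then show "clique_of u = clique_of v"
    using twins_iff[of u v] assms by (auto simp: clique_of_def)
qed

lemma clique_of_eq: "v \<in> V - X \<Longrightarrow> w \<in> clique_of v \<Longrightarrow> clique_of w = clique_of v"
  using clique_of_eq_iff[of v w] by (auto simp: clique_of_def)

lemma clique_of_subset: "v \<in> V - X \<Longrightarrow> clique_of v \<subseteq> same_type_verts v"
  using adjacent_same_type[of v] unfolding clique_of_def same_type_verts_def by fastforce

lemma same_clique_verts:
  assumes "v \<in> V - X"
  shows "{w \<in> same_type_verts v. clique_of w = clique_of v} = clique_of v"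
proof
  show "{w \<in> same_type_verts v. clique_of w = clique_of v} \<subseteq> clique_of v"
    using clique_of_refl unfolding same_type_verts_def by blast
  show "clique_of v \<subseteq> {w \<in> same_type_verts v. clique_of w = clique_of v}"
    using clique_of_eq[OF assms] clique_of_subset[OF assms] by blast
qed

text \<open>All vertices of the clique have the closed neighbourhood of \<open>v\<close>, which
  avoids \<open>X\<close>. A walk that starts in the clique can therefore never leave it, and walks
  reach every vertex.\<close>

lemma no_cover_neighbour:
  assumes "v \<in> V - X" "{x \<in> X. (v, x) \<in> E} = {}"
  shows "V \<subseteq> clique_of v"
proof
  have "w \<in> clique_of v" if "walk E u r w" "u \<in> clique_of v" for u r w
    using that
  proof (induction r arbitrary: u)
    case (Cons x r)
    have "u \<notin> X" "u = v \<or> (v, u) \<in> E" using Cons.prems(2) by (auto simp: clique_of_def)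
    then have "x = v \<or> (v, x) \<in> E"
      using Cons.prems(1) twins_iff[of v u x] assms(1) by auto
    moreover have "x \<in> V" using Cons.prems(1) E_sub by auto
    ultimately have "x \<in> clique_of v" using assms by (auto simp: clique_of_def)
    moreover have "walk E x r w" using Cons.prems(1) by simp
    ultimately show ?case using Cons.IH by blast
  qed simp
  then show "w \<in> clique_of v" if "w \<in> V" for w
    using walks[of v w] that assms(1) clique_of_refl[OF assms(1)] by blast
qed

text \<open>Distinct vertices of equal type lie outside \<open>X\<close> and have the same
  neighbours in \<open>X\<close>. If there were none, the graph would be a single clique and the two
  vertices adjacent.\<close>

lemma type_mates:
  assumes "u \<in> V" "v \<in> V" "u \<noteq> v" "type u = type v" "(u, v) \<notin> E"
  shows "\<exists>x \<in> X. (u, x) \<in> E \<and> (x, v) \<in> E"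
proof -
  have out: "u \<in> V - X" "v \<in> V - X"
    and eq: "{x \<in> X. (u, x) \<in> E} = {x \<in> X. (v, x) \<in> E}"
    using assms by (auto simp: type_def split: if_splits)
  have "{x \<in> X. (u, x) \<in> E} \<noteq> {}"
    using no_cover_neighbour[OF out(1)] assms by (auto simp: clique_of_def)
  then show ?thesis using eq sym_E by blast
qed

lemma proper_on_type:
  assumes "\<And>u v. u \<in> K \<Longrightarrow> v \<in> K \<Longrightarrow> (u, v) \<in> E \<Longrightarrow> c u \<noteq> c v" "K \<subseteq> V - X"
  shows "proper_on K clique_of c"
  using assms clique_of_eq_iff unfolding proper_on_def by blast

section \<open>Recolouring the types and gluing the colourings\<close>

text \<open>The restriction step: a type shows at most \<open>k\<close> colours and never more
  colours than vertices, so enough vertices are left for \<open>recolour_delete\<close>.\<close>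

lemma recolour_kept:
  assumes "proper_on (same_type_verts v) clique_of c"
    and "card (c ` same_type_verts v) \<le> k"
    and "min k (card (same_type_verts v)) \<le> card (K \<inter> same_type_verts v)"
  shows "\<exists>d. proper_on (K \<inter> same_type_verts v) clique_of d \<and>
    d ` (K \<inter> same_type_verts v) = c ` same_type_verts v"
proof -
  have fin: "finite (same_type_verts v)" using finite_V by (simp add: same_type_verts_def)
  have un: "(K \<inter> same_type_verts v) \<union> (same_type_verts v - K) = same_type_verts v" by blast
  have "card (c ` same_type_verts v) \<le> min k (card (same_type_verts v))"
    using assms(2) card_image_le[OF fin] by simp
  also note assms(3)
  finally have le: "card (c ` same_type_verts v) \<le> card (K \<inter> same_type_verts v)" .
  have disj: "(same_type_verts v - K) \<inter> (K \<inter> same_type_verts v) = {}" by blast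
  show ?thesis
    using recolour_delete[of "same_type_verts v - K" "K \<inter> same_type_verts v" clique_of c,
        OF finite_Diff[OF fin] finite_Int[OF disjI2[OF fin]] disj, unfolded un, OF assms(1) le] .
qed

lemma recolour_all:
  assumes "proper_on (K \<inter> same_type_verts v) clique_of c" "m \<in> same_type_verts v"
    and "clique_of m \<subseteq> K"
    and "\<And>w. w \<in> same_type_verts v \<Longrightarrow> card (clique_of w) \<le> card (clique_of m)"
  shows "\<exists>d. proper_on (same_type_verts v) clique_of d \<and>
    d ` same_type_verts v = c ` (K \<inter> same_type_verts v)"
proof -
  have fin: "finite (same_type_verts v)" using finite_V by (simp add: same_type_verts_def)
  have same: "{u \<in> same_type_verts v. clique_of u = clique_of w} = clique_of w"
    if w: "w \<in> same_type_verts v" for w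
  proof -
    have "same_type_verts w = same_type_verts v" "w \<in> V - X"
      using w by (auto simp: same_type_verts_def)
    with same_clique_verts[of w] show ?thesis by metis
  qed
  have sub: "{u \<in> same_type_verts v. clique_of u = clique_of m} \<subseteq> K \<inter> same_type_verts v"
    using same[OF assms(2)] assms(3) by blast
  have max: "card {u \<in> same_type_verts v. clique_of u = clique_of w}
      \<le> card {u \<in> same_type_verts v. clique_of u = clique_of m}"
    if w: "w \<in> same_type_verts v" for w
    using assms(4)[OF w] by (simp only: same[OF w] same[OF assms(2)])
  show ?thesis
    by (rule recolour_insert[of "same_type_verts v" "K \<inter> same_type_verts v" clique_of c m,
          OF fin Int_lower2 assms(1,2) sub max])
qed

text \<open>The types are recoloured independently and then glued, while \<open>X\<close> keeps its
  colours. Going from \<open>V\<close> to the kept set and from the kept set to \<open>V\<close> are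
  two instances of it.\<close>

lemma proper_combine:
  assumes K: "X \<subseteq> K" "K \<subseteq> V" and L: "X \<subseteq> L" "L \<subseteq> V"
    and c: "\<And>u v. u \<in> K \<Longrightarrow> v \<in> K \<Longrightarrow> (u, v) \<in> E \<Longrightarrow> c u \<noteq> c v"
    and ex: "\<And>v. v \<in> V - X \<Longrightarrow> \<exists>d. proper_on (L \<inter> same_type_verts v) clique_of d \<and>
      d ` (L \<inter> same_type_verts v) = c ` (K \<inter> same_type_verts v)"
  shows "\<exists>d. (\<forall>u \<in> L. \<forall>v \<in> L. (u, v) \<in> E \<longrightarrow> d u \<noteq> d v) \<and>
    (\<forall>v \<in> L. \<exists>w \<in> K. type w = type v \<and> c w = d v) \<and>
    (\<forall>w \<in> K. \<exists>v \<in> L. type v = type w \<and> d v = c w)"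
proof -
  let ?S = "\<lambda>t. {w \<in> V - X. type w = t}"
  have S: "same_type_verts v = ?S (type v)" for v by (simp add: same_type_verts_def)
  have "\<forall>t \<in> type ` (V - X). \<exists>d. proper_on (L \<inter> ?S t) clique_of d \<and> d ` (L \<inter> ?S t) = c ` (K \<inter> ?S t)"
  proof
    fix t assume "t \<in> type ` (V - X)"
    then obtain v where v: "v \<in> V - X" "t = type v" by (rule imageE)
    show "\<exists>d. proper_on (L \<inter> ?S t) clique_of d \<and> d ` (L \<inter> ?S t) = c ` (K \<inter> ?S t)"
      using ex[OF v(1)] unfolding S v(2) .
  qed
  from bchoice[OF this] obtain D where D': "\<forall>t \<in> type ` (V - X).
      proper_on (L \<inter> ?S t) clique_of (D t) \<and> D t ` (L \<inter> ?S t) = c ` (K \<inter> ?S t)" ..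
  have D: "proper_on (L \<inter> same_type_verts v) clique_of (D (type v))
      \<and> D (type v) ` (L \<inter> same_type_verts v) = c ` (K \<inter> same_type_verts v)" if "v \<in> V - X" for v
    using bspec[OF D' imageI[OF that]] unfolding S .
  define d where "d v = (if v \<in> X then c v else D (type v) v)" for v
  have into: "\<exists>w \<in> K. type w = type v \<and> c w = d v" if "v \<in> L" for v
  proof (cases "v \<in> X")
    case True
    then show ?thesis using K by (auto simp: d_def)
  next
    case False
    have v: "v \<in> V - X" "v \<in> L \<inter> same_type_verts v"
      using that False L by (auto simp: same_type_verts_def)
    have "D (type v) v \<in> c ` (K \<inter> same_type_verts v)" using D[OF v(1)] v(2) by blast
    then obtain w where "w \<in> K" "w \<in> same_type_verts v" "D (type v) v = c w" by blast
    then show ?thesis using False unfolding same_type_verts_def d_def by auto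
  qed
  have onto: "\<exists>v \<in> L. type v = type w \<and> d v = c w" if "w \<in> K" for w
  proof (cases "w \<in> X")
    case True
    then show ?thesis using L by (auto simp: d_def)
  next
    case False
    have w: "w \<in> V - X" "w \<in> K \<inter> same_type_verts w"
      using that False K by (auto simp: same_type_verts_def)
    have "c w \<in> D (type w) ` (L \<inter> same_type_verts w)" using D[OF w(1)] w(2) by blast
    then obtain v where v: "v \<in> L" "v \<in> same_type_verts w" "c w = D (type w) v" by blast
    then have "type v = type w" "v \<notin> X" by (auto simp: same_type_verts_def)
    then show ?thesis using v by (intro bexI[of _ v]) (simp_all add: d_def)
  qed
  have "d u \<noteq> d v" if uv: "u \<in> L" "v \<in> L" "(u, v) \<in> E" for u v
  proof (cases "type u = type v")
    case True
    then have out: "u \<in> V - X" "v \<in> V - X"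
      using that irrefl_E E_verts by (auto simp: type_def split: if_splits)
    then have "clique_of u = clique_of v" using clique_of_eq_iff that(3) by blast
    moreover have "u \<in> L \<inter> same_type_verts u" "v \<in> L \<inter> same_type_verts u" "u \<noteq> v"
      using that out True irrefl_E by (auto simp: same_type_verts_def)
    ultimately have "D (type u) u \<noteq> D (type u) v"
      using D[OF out(1)] unfolding proper_on_def by blast
    then show ?thesis using out True by (simp add: d_def)
  next
    case False
    \<comment> \<open>For an edge between two types, the new colours come from \<open>c\<close> on
      vertices of the same two types; these vertices are adjacent as well because types are modules,
      so \<open>c\<close> separates them.\<close>
    obtain u' where u': "u' \<in> K" "type u' = type u" "c u' = d u" using into[OF uv(1)] by blast
    obtain v' where v': "v' \<in> K" "type v' = type v" "c v' = d v" using into[OF uv(2)] by blast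
    have "type_adj (type u) (type v)"
      using modularD[OF modular_type _ _ False] E_verts[OF that(3)] that(3) by blast
    then have "(u', v') \<in> E"
      using modularD[OF modular_type, of u' v'] u'(1,2) v'(1,2) False K(2) by auto
    then show ?thesis using c[OF u'(1) v'(1)] u'(3) v'(3) by simp
  qed
  with into onto show ?thesis by blast
qed

text \<open>Both directions have one shape: recolour each type, glue with
  \<open>proper_combine\<close>, and let \<open>strong_transfer\<close> provide the geodesics. The
  injection \<open>lab\<close> is carried along so that the kernel may have other vertex
  names.\<close>

lemma kernel_equivalence:
  assumes K: "X \<subseteq> K" "K \<subseteq> V" and lab: "inj_on lab K"
    and many: "\<And>v. v \<in> V - X \<Longrightarrow> min k (card (same_type_verts v)) \<le> card (K \<inter> same_type_verts v)"
    and large: "\<And>v. v \<in> V - X \<Longrightarrow> \<exists>m \<in> same_type_verts v. clique_of m \<subseteq> K \<and>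
      (\<forall>w \<in> same_type_verts v. card (clique_of w) \<le> card (clique_of m))"
  defines "V' \<equiv> lab ` K" and "E' \<equiv> {(lab u, lab v) | u v. u \<in> K \<and> v \<in> K \<and> (u, v) \<in> E}"
  shows "(\<exists>c. strong V E c \<and> card (c ` V) \<le> k) \<longleftrightarrow> (\<exists>c. strong V' E' c \<and> card (c ` V') \<le> k)"
    and "\<And>u v. u \<in> V' \<Longrightarrow> v \<in> V' \<Longrightarrow> \<exists>r. walk E' u r v"
proof -
  define unlab where "unlab = the_inv_into K lab"
  have unlab: "unlab (lab v) = v" if "v \<in> K" for v
    unfolding unlab_def using the_inv_into_f_f[OF lab that] .
  \<comment> \<open>The kernel inherits its types from the original graph instead of computing its
    own, so that both graphs share the quotient \<open>type_adj\<close>.\<close>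
  define type' where "type' y = type (unlab y)" for y
  have type': "type' (lab v) = type v" if "v \<in> K" for v
    by (simp add: type'_def unlab that)
  have E'_iff: "(lab u, lab v) \<in> E' \<longleftrightarrow> (u, v) \<in> E" if "u \<in> K" "v \<in> K" for u v
    using that inj_onD[OF lab] unfolding E'_def by blast
  have E'_sub: "E' \<subseteq> V' \<times> V'" unfolding E'_def V'_def by blast
  have mod': "modular V' E' type' type_adj"
    using modularD[OF modular_type] K E'_iff type' unfolding modular_def V'_def by (auto simp: subset_iff)
  have mates': "\<exists>a. (u, a) \<in> E' \<and> (a, v) \<in> E'"
    if "u \<in> V'" "v \<in> V'" "u \<noteq> v" "type' u = type' v" "(u, v) \<notin> E'" for u v
  proof -
    obtain u0 v0 where 0: "u = lab u0" "v = lab v0" "u0 \<in> K" "v0 \<in> K"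
      using \<open>u \<in> V'\<close> \<open>v \<in> V'\<close> by (auto simp: V'_def)
    have "u0 \<in> V" "v0 \<in> V" using 0 K by auto
    moreover have "u0 \<noteq> v0" using 0 \<open>u \<noteq> v\<close> by auto
    moreover have "type u0 = type v0" using \<open>type' u = type' v\<close> 0 type' by simp
    moreover have "(u0, v0) \<notin> E" using \<open>(u, v) \<notin> E'\<close> 0 E'_iff by simp
    ultimately obtain x where "x \<in> X" "(u0, x) \<in> E" "(x, v0) \<in> E"
      using type_mates by blast
    \<comment> \<open>The common neighbour lies in \<open>X\<close>, and all of \<open>X\<close> is
      kept.\<close>
    then have "(u, lab x) \<in> E' \<and> (lab x, v) \<in> E'" using 0 K E'_iff by blast
    then show ?thesis by blast
  qed
  have types: "type ` V = type' ` V'"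
  proof -
    have "\<exists>w \<in> K. type w = type v" if "v \<in> V" for v
    proof (cases "v \<in> X")
      case True
      then show ?thesis using K by auto
    next
      case False
      then have v: "v \<in> V - X" using that by simp
      obtain m where m: "m \<in> same_type_verts v" "clique_of m \<subseteq> K" using large[OF v] by blast
      then have "m \<in> K" using clique_of_refl[of m] by (auto simp: same_type_verts_def)
      then show ?thesis using m by (auto simp: same_type_verts_def)
    qed
    then have "type ` V = type ` K" using K(2) by (auto simp: image_iff) (metis image_iff)
    also have "\<dots> = type' ` V'" using type' by (force simp: V'_def)
    finally show ?thesis .
  qed
  show "\<exists>r. walk E' u r v" if "u \<in> V'" "v \<in> V'" for u v
    by (rule connected_transfer[OF walks modular_type mod' E_sub types mates' that])
  show "(\<exists>c. strong V E c \<and> card (c ` V) \<le> k) \<longleftrightarrow> (\<exists>c. strong V' E' c \<and> card (c ` V') \<le> k)"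
  proof
    assume "\<exists>c. strong V E c \<and> card (c ` V) \<le> k"
    then obtain c where c: "strong V E c" "card (c ` V) \<le> k" by blast
    have proper: "c u \<noteq> c v" if "(u, v) \<in> E" for u v
      using strong_imp_proper[OF c(1) that] E_verts[OF that] irrefl_E that by metis
    have "\<exists>d. proper_on (K \<inter> same_type_verts v) clique_of d \<and>
        d ` (K \<inter> same_type_verts v) = c ` (V \<inter> same_type_verts v)" if v: "v \<in> V - X" for v
    proof -
      have V_Int: "V \<inter> same_type_verts v = same_type_verts v" by (auto simp: same_type_verts_def)
      have "card (c ` same_type_verts v) \<le> card (c ` V)"
        using finite_V by (intro card_mono image_mono) (auto simp: same_type_verts_def)
      then show ?thesis
        unfolding V_Int using c(2) many[OF v] proper
        by (intro recolour_kept proper_on_type) (auto simp: same_type_verts_def)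
    qed
    from proper_combine[OF X_sub subset_refl K proper this]
    obtain d where d: "\<forall>u \<in> K. \<forall>v \<in> K. (u, v) \<in> E \<longrightarrow> d u \<noteq> d v"
      and into: "\<forall>v \<in> K. \<exists>w \<in> V. type w = type v \<and> c w = d v"
      and onto: "\<forall>w \<in> V. \<exists>v \<in> K. type v = type w \<and> d v = c w" by blast
    define c' where "c' y = d (unlab y)" for y
    have c': "c' (lab v) = d v" if "v \<in> K" for v using that by (simp add: c'_def unlab)
    have "strong V' E' c'"
    proof (rule strong_transfer[OF c(1) modular_type mod' E_sub E'_sub _ _ _ mates'])
      show "\<exists>w' \<in> V'. type' w' = type w \<and> c' w' = c w" if "w \<in> V" for w
        using onto that type' c' unfolding V'_def by (metis image_eqI)
      show "\<exists>w \<in> V. type w = type' w' \<and> c w = c' w'" if "w' \<in> V'" for w'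
        using into that type' c' unfolding V'_def by (metis imageE)
      show "c' u \<noteq> c' v" if "(u, v) \<in> E'" for u v
        using that d c' unfolding E'_def by auto
    qed
    moreover have "c' ` V' \<subseteq> c ` V"
      using into c' unfolding V'_def by (auto simp: image_iff) (metis)
    then have "card (c' ` V') \<le> k"
      using c(2) card_mono[of "c ` V" "c' ` V'"] finite_V by (meson finite_imageI order_trans)
    ultimately show "\<exists>c. strong V' E' c \<and> card (c ` V') \<le> k" by blast
  next
    assume "\<exists>c. strong V' E' c \<and> card (c ` V') \<le> k"
    then obtain c' where c': "strong V' E' c'" "card (c' ` V') \<le> k" by blast
    define c where "c v = c' (lab v)" for v
    have proper: "c u \<noteq> c v" if "u \<in> K" "v \<in> K" "(u, v) \<in> E" for u v
    proof -
      have "lab u \<noteq> lab v" using that irrefl_E inj_onD[OF lab] by metis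
      then show ?thesis
        using strong_imp_proper[OF c'(1), of "lab u" "lab v"] that E'_iff
        by (auto simp: c_def V'_def)
    qed
    have "\<exists>d. proper_on (V \<inter> same_type_verts v) clique_of d \<and>
        d ` (V \<inter> same_type_verts v) = c ` (K \<inter> same_type_verts v)" if v: "v \<in> V - X" for v
    proof -
      have V_Int: "V \<inter> same_type_verts v = same_type_verts v" by (auto simp: same_type_verts_def)
      obtain m where m: "m \<in> same_type_verts v" "clique_of m \<subseteq> K"
        "\<forall>w \<in> same_type_verts v. card (clique_of w) \<le> card (clique_of m)" using large[OF v] by blast
      have "proper_on (K \<inter> same_type_verts v) clique_of c"
        using proper by (intro proper_on_type) (auto simp: same_type_verts_def)
      then show ?thesis
        unfolding V_Int using m by (intro recolour_all) auto
    qed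
    from proper_combine[OF K X_sub subset_refl proper this]
    obtain d where d: "\<forall>u \<in> V. \<forall>v \<in> V. (u, v) \<in> E \<longrightarrow> d u \<noteq> d v"
      and into: "\<forall>v \<in> V. \<exists>w \<in> K. type w = type v \<and> c w = d v"
      and onto: "\<forall>w \<in> K. \<exists>v \<in> V. type v = type w \<and> d v = c w" by blast
    have "strong V E d"
    proof (rule strong_transfer[OF c'(1) mod' modular_type E'_sub E_sub])
      show "\<exists>w' \<in> V. type w' = type' w \<and> d w' = c' w" if "w \<in> V'" for w
        using onto that type' unfolding V'_def c_def by (metis imageE)
      show "\<exists>w \<in> V'. type' w = type w' \<and> c' w = d w'" if "w' \<in> V" for w'
        using into that type' unfolding V'_def c_def by (metis image_eqI)
      show "d u \<noteq> d v" if "(u, v) \<in> E" for u v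
        using that d E_verts by blast
      show "\<exists>a. (u, a) \<in> E \<and> (a, v) \<in> E"
        if "u \<in> V" "v \<in> V" "u \<noteq> v" "type u = type v" "(u, v) \<notin> E" for u v
        using type_mates[OF that] by blast
    qed
    moreover have "d ` V \<subseteq> c' ` V'"
      using into unfolding V'_def c_def by (auto simp: image_iff) (metis)
    then have "card (d ` V) \<le> k"
      using c'(2) card_mono[of "c' ` V'" "d ` V"] finite_V K(2) finite_subset
      unfolding V'_def by (meson finite_imageI order_trans)
    ultimately show "\<exists>c. strong V E c \<and> card (c ` V) \<le> k" by blast
  qed
qed

lemma large_clique_not_colourable:
  assumes "v \<in> V - X" "k < card (clique_of v)"
  shows "\<not> (\<exists>c. strong V E c \<and> card (c ` V) \<le> k)"
proof
  assume "\<exists>c. strong V E c \<and> card (c ` V) \<le> k"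
  then obtain c where c: "strong V E c" "card (c ` V) \<le> k" by blast
  have "inj_on c (clique_of v)"
  proof (rule inj_onI, rule ccontr)
    fix u w assume u: "u \<in> clique_of v" and w: "w \<in> clique_of v" and "c u = c w" "u \<noteq> w"
    have "u \<in> V - X" "w \<in> V - X" using u w by (auto simp: clique_of_def)
    moreover from this have "(u, w) \<in> E"
      using clique_of_eq[OF assms(1) u] clique_of_eq[OF assms(1) w] clique_of_eq_iff[of u w] \<open>u \<noteq> w\<close>
      by auto
    ultimately show False using strong_imp_proper[OF c(1)] \<open>c u = c w\<close> \<open>u \<noteq> w\<close> by auto
  qed
  then have "card (clique_of v) = card (c ` clique_of v)" by (simp add: card_image)
  also have "\<dots> \<le> card (c ` V)"
    using finite_V by (intro card_mono image_mono) (auto simp: clique_of_def)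
  finally show False using assms(2) c(2) by simp
qed

end

section \<open>The kernelization as a program\<close>

type_synonym adjacency = "(nat \<times> nat list) list"

text \<open>A lookup phrased through \<open>filter\<close>, \<open>map\<close> and
  \<open>concat\<close>, for which time bounds are at hand; a vertex without an entry gets the empty
  list.\<close>

definition neighbours :: "adjacency \<Rightarrow> nat \<Rightarrow> nat list" where
  "neighbours A v = concat (map snd (filter (\<lambda>p. fst p = v) A))"

definition outside :: "adjacency \<Rightarrow> nat list \<Rightarrow> nat list" where
  "outside A X = filter (\<lambda>v. v \<notin> set X) (map fst A)"

definition same_type :: "adjacency \<Rightarrow> nat list \<Rightarrow> nat \<Rightarrow> nat \<Rightarrow> bool" where
  "same_type A X v w \<longleftrightarrow> (\<forall>x \<in> set X. (x \<in> set (neighbours A v)) = (x \<in> set (neighbours A w)))"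

text \<open>These vertices share the type of \<open>v\<close> but need not be twins of
  \<open>v\<close>: they may belong to different cliques.\<close>

definition twin_types :: "adjacency \<Rightarrow> nat list \<Rightarrow> nat \<Rightarrow> nat list" where
  "twin_types A X v = filter (\<lambda>w. same_type A X v w) (outside A X)"

definition clique :: "adjacency \<Rightarrow> nat list \<Rightarrow> nat \<Rightarrow> nat list" where
  "clique A X v = filter (\<lambda>w. w = v \<or> w \<in> set (neighbours A v)) (outside A X)"

text \<open>All vertices of a type yield the same filtered list and hence the same leader, so only
  one largest clique per type is singled out. Among the vertices examined by \<open>kept\<close>,
  the default of \<open>hd0\<close> can arise only inside \<open>X\<close>, which is kept
  anyway.\<close>

definition leader :: "adjacency \<Rightarrow> nat list \<Rightarrow> nat \<Rightarrow> nat" where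
  "leader A X v = hd0 (filter (\<lambda>m. \<forall>w \<in> set (twin_types A X v).
     length (clique A X w) \<le> length (clique A X m)) (twin_types A X v))"

text \<open>On a strictly sorted list this is the index of the entry \<open>v\<close>. It selects
  the first \<open>k\<close> vertices of a type and also supplies the new vertex names, which thus
  fill an initial segment.\<close>

definition rank :: "nat list \<Rightarrow> nat \<Rightarrow> nat" where
  "rank K v = length (filter (\<lambda>w. w < v) K)"

definition kept :: "adjacency \<Rightarrow> nat \<Rightarrow> nat list \<Rightarrow> nat list" where
  "kept A k X = filter (\<lambda>v. v \<in> set X \<or> v \<in> set (clique A X (leader A X v))
     \<or> rank (twin_types A X v) v < k) (map fst A)"

definition relabel :: "adjacency \<Rightarrow> nat list \<Rightarrow> adjacency" where
  "relabel A K = map (\<lambda>v. (rank K v, map (\<lambda>w. rank K w)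
     (filter (\<lambda>w. w \<in> set K) (neighbours A v)))) K"

definition kernelize :: "adjacency \<times> nat \<times> nat list \<Rightarrow> adjacency \<times> nat \<times> nat list" where
  "kernelize z = (let A = fst z; k = fst (snd z); X = snd (snd z) in
     if \<exists>v \<in> set (outside A X). k < length (clique A X v) then ([(0, [1]), (1, [0])], 1, [])
     else (relabel A (kept A k X), k, map (\<lambda>v. rank (kept A k X) v) X))"

abbreviation enc_adjacency :: "adjacency \<Rightarrow> btree" where
  "enc_adjacency \<equiv> enc_list (enc_pair enc_nat (enc_list enc_nat))"

abbreviation enc_lists :: "adjacency \<times> nat \<times> nat list \<Rightarrow> btree" where
  "enc_lists \<equiv> enc_pair enc_adjacency (enc_pair enc_nat (enc_list enc_nat))"

text \<open>Turns the time bound of an uncurried function into an introduction rule for its curried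
  calls, so that each procedure extends \<open>ptime_intros\<close> for the next.\<close>

lemma ptime_comp2:
  assumes "ptime (enc_pair e1 e2) e' (\<lambda>z. f (fst z) (snd z))"
    and "ptime e e1 g" "ptime e e2 h"
  shows "ptime e e' (\<lambda>x. f (g x) (h x))"
  using time_bounded_comp[OF time_bounded_pair[OF assms(2,3)] assms(1)] by simp

lemma ptime_comp3:
  assumes "ptime (enc_pair e1 (enc_pair e2 e3)) e' (\<lambda>z. f (fst z) (fst (snd z)) (snd (snd z)))"
    and "ptime e e1 g" "ptime e e2 h" "ptime e e3 i"
  shows "ptime e e' (\<lambda>x. f (g x) (h x) (i x))"
  using time_bounded_comp[OF time_bounded_pair[OF assms(2) time_bounded_pair[OF assms(3,4)]] assms(1)]
  by simp

lemma ptime_comp4: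
  assumes "ptime (enc_pair e1 (enc_pair e2 (enc_pair e3 e4))) e'
      (\<lambda>z. f (fst z) (fst (snd z)) (fst (snd (snd z))) (snd (snd (snd z))))"
    and "ptime e e1 g" "ptime e e2 h" "ptime e e3 i" "ptime e e4 j"
  shows "ptime e e' (\<lambda>x. f (g x) (h x) (i x) (j x))"
  using time_bounded_comp[OF time_bounded_pair[OF assms(2)
    time_bounded_pair[OF assms(3) time_bounded_pair[OF assms(4,5)]]] assms(1)]
  by simp

lemma ptime_neighbours_aux:
  "ptime (enc_pair enc_adjacency enc_nat) (enc_list enc_nat) (\<lambda>z. neighbours (fst z) (snd z))"
  unfolding neighbours_def by (rule ptime_intros)+

lemmas [ptime_intros] = ptime_comp2[OF ptime_neighbours_aux]

lemma ptime_outside_aux: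
  "ptime (enc_pair enc_adjacency (enc_list enc_nat)) (enc_list enc_nat)
     (\<lambda>z. outside (fst z) (snd z))"
  unfolding outside_def by (rule ptime_intros)+

lemmas [ptime_intros] = ptime_comp2[OF ptime_outside_aux]

lemma ptime_same_type_aux:
  "ptime (enc_pair enc_adjacency (enc_pair (enc_list enc_nat) (enc_pair enc_nat enc_nat))) enc_bool
     (\<lambda>z. same_type (fst z) (fst (snd z)) (fst (snd (snd z))) (snd (snd (snd z))))"
  unfolding same_type_def by (rule ptime_intros)+

lemmas [ptime_intros] = ptime_comp4[OF ptime_same_type_aux]

lemma ptime_twin_types_aux:
  "ptime (enc_pair enc_adjacency (enc_pair (enc_list enc_nat) enc_nat)) (enc_list enc_nat)
     (\<lambda>z. twin_types (fst z) (fst (snd z)) (snd (snd z)))"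
  unfolding twin_types_def by (rule ptime_intros)+

lemmas [ptime_intros] = ptime_comp3[OF ptime_twin_types_aux]

lemma ptime_clique_aux:
  "ptime (enc_pair enc_adjacency (enc_pair (enc_list enc_nat) enc_nat)) (enc_list enc_nat)
     (\<lambda>z. clique (fst z) (fst (snd z)) (snd (snd z)))"
  unfolding clique_def by (rule ptime_intros)+

lemmas [ptime_intros] = ptime_comp3[OF ptime_clique_aux]

lemma ptime_leader_aux:
  "ptime (enc_pair enc_adjacency (enc_pair (enc_list enc_nat) enc_nat)) enc_nat
     (\<lambda>z. leader (fst z) (fst (snd z)) (snd (snd z)))"
  unfolding leader_def by (rule ptime_intros)+

lemmas [ptime_intros] = ptime_comp3[OF ptime_leader_aux]

lemma ptime_rank_aux:
  "ptime (enc_pair (enc_list enc_nat) enc_nat) enc_nat (\<lambda>z. rank (fst z) (snd z))"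
  unfolding rank_def by (rule ptime_intros)+

lemmas [ptime_intros] = ptime_comp2[OF ptime_rank_aux]

lemma ptime_kept_aux:
  "ptime (enc_pair enc_adjacency (enc_pair enc_nat (enc_list enc_nat))) (enc_list enc_nat)
     (\<lambda>z. kept (fst z) (fst (snd z)) (snd (snd z)))"
  unfolding kept_def by (rule ptime_intros)+

lemmas [ptime_intros] = ptime_comp3[OF ptime_kept_aux]

lemma ptime_relabel_aux:
  "ptime (enc_pair enc_adjacency (enc_list enc_nat)) enc_adjacency (\<lambda>z. relabel (fst z) (snd z))"
  unfolding relabel_def by (rule ptime_intros)+

lemmas [ptime_intros] = ptime_comp2[OF ptime_relabel_aux]

lemma ptime_kernelize: "ptime enc_lists enc_lists kernelize"
  unfolding kernelize_def Let_def by (rule ptime_intros)+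


section \<open>The brute-force decision procedure\<close>

definition colour :: "(nat \<times> nat) list \<Rightarrow> nat \<Rightarrow> nat" where
  "colour f x = hd0 (map snd (filter (\<lambda>p. fst p = x) f))"

definition walk_step :: "adjacency \<Rightarrow> bool \<times> nat \<Rightarrow> nat \<Rightarrow> bool \<times> nat" where
  "walk_step A a y = (fst a \<and> y \<in> set (neighbours A (snd a)), y)"

definition is_walk :: "adjacency \<Rightarrow> nat \<Rightarrow> nat list \<Rightarrow> nat \<Rightarrow> bool" where
  "is_walk A u p v \<longleftrightarrow> (case foldl (walk_step A) (True, u) p of (ok, w) \<Rightarrow> ok \<and> w = v)"

definition unique_colour :: "(nat \<times> nat) list \<Rightarrow> nat list \<Rightarrow> bool" where
  "unique_colour f p \<longleftrightarrow> (\<exists>x \<in> set p. \<forall>y \<in> set p. colour f y = colour f x \<longrightarrow> y = x)"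

text \<open>Colours are vertex names, so the number of colours can be counted along the vertex list.
  \<open>W\<close> is meant to contain every geodesic; minimality within \<open>W\<close> is then
  true minimality.\<close>

definition good_colouring ::
  "adjacency \<Rightarrow> nat \<Rightarrow> nat list list \<Rightarrow> (nat \<times> nat) list \<Rightarrow> bool" where
  "good_colouring A k W f \<longleftrightarrow>
     (\<forall>v \<in> set (map fst A). colour f v \<in> set (map fst A)) \<and>
     length (filter (\<lambda>c. \<exists>v \<in> set (map fst A). colour f v = c) (map fst A)) \<le> k \<and>
     (\<forall>u \<in> set (map fst A). \<forall>v \<in> set (map fst A). u = v \<or>
        (\<exists>p \<in> set W. is_walk A u p v \<and> (\<forall>q \<in> set W. is_walk A u q v \<longrightarrow> length p \<le> length q)
           \<and> unique_colour f (u # p)))"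

definition decide :: "adjacency \<times> nat \<times> nat list \<Rightarrow> bool" where
  "decide z = (\<exists>f \<in> set (all_lists (List.product (map fst (fst z)) (map fst (fst z))) (map fst (fst z))).
     good_colouring (fst z) (fst (snd z)) (all_lists (map fst (fst z)) (map fst (fst z))) f)"

lemma ptime_colour_aux:
  "ptime (enc_pair (enc_list (enc_pair enc_nat enc_nat)) enc_nat) enc_nat (\<lambda>z. colour (fst z) (snd z))"
  unfolding colour_def by (rule ptime_intros)+

lemmas [ptime_intros] = ptime_comp2[OF ptime_colour_aux]

lemma ptime_is_walk_aux:
  "ptime (enc_pair enc_adjacency (enc_pair enc_nat (enc_pair (enc_list enc_nat) enc_nat))) enc_bool
     (\<lambda>z. is_walk (fst z) (fst (snd z)) (fst (snd (snd z))) (snd (snd (snd z))))"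
proof -
  let ?E = "enc_pair enc_adjacency (enc_pair enc_nat (enc_pair (enc_list enc_nat) enc_nat))"
  have fold: "ptime ?E (enc_pair enc_bool enc_nat)
      (\<lambda>z. foldl (walk_step (fst z)) (True, fst (snd z)) (fst (snd (snd z))))"
    by (rule time_bounded_foldl_additive[where g = "\<lambda>z. size (enc_nat (snd z)) + 1"])
       (unfold walk_step_def, (rule ptime_intros)+, simp add: enc_bool_True_iff enc_pair_eq,
        intro poly_bounded_intros poly_bounded_size_snd)
  show ?thesis
    unfolding is_walk_def case_prod_unfold by (rule fold ptime_intros)+
qed

lemmas [ptime_intros] = ptime_comp4[OF ptime_is_walk_aux]

lemma ptime_unique_colour_aux:
  "ptime (enc_pair (enc_list (enc_pair enc_nat enc_nat)) (enc_list enc_nat)) enc_bool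
     (\<lambda>z. unique_colour (fst z) (snd z))"
  unfolding unique_colour_def by (rule ptime_intros)+

lemmas [ptime_intros] = ptime_comp2[OF ptime_unique_colour_aux]

lemma ptime_good_colouring_aux:
  "ptime (enc_pair enc_adjacency (enc_pair enc_nat (enc_pair (enc_list (enc_list enc_nat))
      (enc_list (enc_pair enc_nat enc_nat))))) enc_bool
     (\<lambda>z. good_colouring (fst z) (fst (snd z)) (fst (snd (snd z))) (snd (snd (snd z))))"
  unfolding good_colouring_def by (rule ptime_intros)+

lemmas [ptime_intros] = ptime_comp4[OF ptime_good_colouring_aux]

section \<open>Counting the kept vertices\<close>

text \<open>The induction adds a new maximum: earlier ranks do not change, and the rank of the new
  element is the size of the old set.\<close>

lemma card_rank_less:
  fixes S :: "'a::linorder set"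
  assumes "finite S"
  shows "card {v \<in> S. card {w \<in> S. w < v} < k} = min k (card S)"
  using assms
proof (induction S rule: finite_linorder_max_induct)
  case (insert b A)
  have b: "b \<notin> A" using insert by auto
  have rank: "{w \<in> insert b A. w < v} = {w \<in> A. w < v}" if "v \<in> A" for v
    using insert(2) that by (auto dest: less_asym)
  have rank_b: "{w \<in> insert b A. w < b} = A" using insert(2) by auto
  have "{v \<in> insert b A. card {w \<in> insert b A. w < v} < k}
      = {v \<in> A. card {w \<in> A. w < v} < k} \<union> (if card A < k then {b} else {})"
    using rank rank_b by auto
  then show ?case
    using insert(1,3) b by (auto simp: card_insert_if min_def)
qed simp

text \<open>\<open>leader\<close> is abstract here, which separates the counting from the list
  program. \<open>leader_cong\<close> makes a type agree on one clique, and \<open>small\<close>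
  describes the case left after the test for cliques with more than \<open>k\<close>
  vertices.\<close>

locale twin_kernel = twin_covered V E X for V :: "'a::linorder set" and E X +
  fixes k :: nat and leader :: "'a \<Rightarrow> 'a"
  assumes leader_in: "v \<in> V - X \<Longrightarrow> leader v \<in> same_type_verts v"
    and leader_max: "v \<in> V - X \<Longrightarrow> w \<in> same_type_verts v \<Longrightarrow>
      card (clique_of w) \<le> card (clique_of (leader v))"
    and leader_cong: "v \<in> V - X \<Longrightarrow> w \<in> V - X \<Longrightarrow> type v = type w \<Longrightarrow> leader v = leader w"
    and small: "v \<in> V - X \<Longrightarrow> card (clique_of v) \<le> k"
begin

definition kept_verts :: "'a set" where
  "kept_verts = {v \<in> V. v \<in> X \<or> v \<in> clique_of (leader v) \<or> card {w \<in> same_type_verts v. w < v} < k}"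

lemma cover_subset_kept: "X \<subseteq> kept_verts"
  using X_sub by (auto simp: kept_verts_def)

lemma kept_subset: "kept_verts \<subseteq> V"
  by (auto simp: kept_verts_def)

lemma finite_same_type: "finite (same_type_verts v)"
  using finite_V by (simp add: same_type_verts_def)

lemma kept_many:
  assumes "v \<in> V - X"
  shows "min k (card (same_type_verts v)) \<le> card (kept_verts \<inter> same_type_verts v)"
proof -
  let ?S = "same_type_verts v"
  have "same_type_verts w = ?S" if "w \<in> ?S" for w
    using that by (auto simp: same_type_verts_def)
  then have "{w \<in> ?S. card {u \<in> ?S. u < w} < k} \<subseteq> kept_verts \<inter> ?S"
    unfolding kept_verts_def by (auto simp: same_type_verts_def)
  then have "card {w \<in> ?S. card {u \<in> ?S. u < w} < k} \<le> card (kept_verts \<inter> ?S)"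
    by (intro card_mono finite_Int disjI2 finite_same_type)
  then show ?thesis by (simp only: card_rank_less[OF finite_same_type])
qed

text \<open>Whether \<open>w\<close> is kept is decided by the leader of \<open>w\<close>, not of
  \<open>v\<close>; the clique stays inside one type, so the two leaders agree.\<close>

lemma leader_clique_kept:
  assumes "v \<in> V - X"
  shows "clique_of (leader v) \<subseteq> kept_verts"
proof
  fix w assume w: "w \<in> clique_of (leader v)"
  have l: "leader v \<in> V - X" "type (leader v) = type v"
    using leader_in[OF assms] by (auto simp: same_type_verts_def)
  have "w \<in> same_type_verts (leader v)" using clique_of_subset[OF l(1)] w by blast
  then have w': "w \<in> V - X" "type w = type v" using l(2) by (auto simp: same_type_verts_def)
  then have "leader w = leader v" using leader_cong[OF w'(1) assms] by simp
  then show "w \<in> kept_verts" using w w' by (simp add: kept_verts_def)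
qed

lemma kept_large:
  assumes "v \<in> V - X"
  shows "\<exists>m \<in> same_type_verts v. clique_of m \<subseteq> kept_verts \<and>
    (\<forall>w \<in> same_type_verts v. card (clique_of w) \<le> card (clique_of m))"
  using leader_in[OF assms] leader_clique_kept[OF assms] leader_max[OF assms] by blast

lemma card_kept_type: "card {v \<in> kept_verts - X. type v = t} \<le> 2 * k"
proof (cases "\<exists>v \<in> kept_verts - X. type v = t")
  case True
  then obtain v where v: "v \<in> V - X" "type v = t" using kept_subset by auto
  let ?S = "same_type_verts v" and ?C = "clique_of (leader v)"
  have "{w \<in> kept_verts - X. type w = t} \<subseteq> ?C \<union> {w \<in> ?S. card {u \<in> ?S. u < w} < k}"
  proof
    fix w assume "w \<in> {w \<in> kept_verts - X. type w = t}"
    then have w: "w \<in> kept_verts" "w \<in> V - X" "type w = type v" using v kept_subset by auto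
    have "leader w = leader v" using leader_cong[OF w(2) v(1)] w(3) by simp
    moreover have "same_type_verts w = ?S" "w \<in> ?S" using w by (auto simp: same_type_verts_def)
    ultimately show "w \<in> ?C \<union> {w \<in> ?S. card {u \<in> ?S. u < w} < k}"
      using w(1,2) by (auto simp: kept_verts_def)
  qed
  moreover have "finite ?C" using finite_V by (simp add: clique_of_def)
  ultimately have "card {w \<in> kept_verts - X. type w = t}
      \<le> card (?C \<union> {w \<in> ?S. card {u \<in> ?S. u < w} < k})"
    using finite_same_type by (intro card_mono) auto
  also have "\<dots> \<le> card ?C + card {w \<in> ?S. card {u \<in> ?S. u < w} < k}"
    by (rule card_Un_le)
  also have "\<dots> \<le> k + k"
    using small[of "leader v"] leader_in[OF v(1)] card_rank_less[OF finite_same_type, of v k]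
    by (intro add_mono) (auto simp: same_type_verts_def)
  finally show ?thesis by simp
next
  case False
  then have empty: "{v \<in> kept_verts - X. type v = t} = {}" by blast
  show ?thesis unfolding empty by simp
qed

text \<open>Each type outside \<open>X\<close> keeps at most \<open>2 * k\<close> vertices. For
  nonempty \<open>X\<close> the bounds \<open>2 \<le> card X + 1\<close> and
  \<open>2 ^ card X \<le> 2 ^ (card X + k - 1)\<close> give the stated form. For empty
  \<open>X\<close> the first one fails, but then the graph is one clique with at most
  \<open>k\<close> vertices.\<close>

lemma card_kept:
  assumes "1 \<le> k"
  shows "card kept_verts \<le> card X + (card X + 1) * k * 2 ^ (card X + k - 1)"
proof (cases "X = {}")
  case True
  show ?thesis
  proof (cases "V = {}")
    case True
    then show ?thesis using kept_subset by simp
  next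
    case False
    then obtain v where v: "v \<in> V - X" using True by blast
    then have "V \<subseteq> clique_of v" using no_cover_neighbour[OF v] True by simp
    then have "card kept_verts \<le> card (clique_of v)"
      using kept_subset finite_V by (intro card_mono) (auto simp: clique_of_def)
    also have "\<dots> \<le> k * 1" using small[OF v] by simp
    also have "\<dots> \<le> k * 2 ^ (k - 1)" by (intro mult_le_mono2) simp
    finally show ?thesis using True by simp
  qed
next
  case False
  have fin: "finite X" using finite_V X_sub finite_subset by blast
  then have t: "1 \<le> card X" using False by (simp add: Suc_le_eq card_gt_0_iff)
  have "kept_verts - X \<subseteq> (\<Union>S \<in> Pow X. {v \<in> kept_verts - X. type v = Inr S})" (is "_ \<subseteq> ?U")
  proof
    fix v assume v: "v \<in> kept_verts - X"
    then have "type v = Inr {x \<in> X. (v, x) \<in> E}" by (simp add: type_def)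
    with v have mem: "v \<in> {w \<in> kept_verts - X. type w = Inr {x \<in> X. (v, x) \<in> E}}" by simp
    show "v \<in> ?U"
      by (rule UN_I[where a = "{x \<in> X. (v, x) \<in> E}"]) (rule PowI Collect_restrict mem)+
  qed
  then have "card (kept_verts - X) \<le> card (\<Union>S \<in> Pow X. {v \<in> kept_verts - X. type v = Inr S})"
    using finite_subset[OF kept_subset finite_V] fin by (intro card_mono) auto
  also have "\<dots> \<le> (\<Sum>S \<in> Pow X. card {v \<in> kept_verts - X. type v = Inr S})"
    using fin by (intro card_UN_le) simp
  also have "\<dots> \<le> (\<Sum>S \<in> Pow X. 2 * k)" by (intro sum_mono card_kept_type)
  also have "\<dots> = 2 * k * 2 ^ card X" using fin by (simp add: card_Pow)
  also have "\<dots> \<le> (card X + 1) * k * 2 ^ (card X + k - 1)"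
    using t assms by (intro mult_mono power_increasing) auto
  finally have "card (kept_verts - X) \<le> (card X + 1) * k * 2 ^ (card X + k - 1)" .
  moreover have "card X \<le> card kept_verts"
    by (rule card_mono[OF finite_subset[OF kept_subset finite_V] cover_subset_kept])
  then have "card kept_verts = card X + card (kept_verts - X)"
    by (simp add: card_Diff_subset[OF fin cover_subset_kept])
  ultimately show ?thesis by simp
qed

end


section \<open>Translation of the graph notions\<close>

lemma connected_graphI:
  assumes "finite (pverts G)" "parcs G \<subseteq> pverts G \<times> pverts G" "pverts G \<noteq> {}"
    and sym: "\<And>u v. (u, v) \<in> parcs G \<Longrightarrow> (v, u) \<in> parcs G" and irrefl: "\<And>u. (u, u) \<notin> parcs G"
    and walks: "\<And>u v. u \<in> pverts G \<Longrightarrow> v \<in> pverts G \<Longrightarrow> \<exists>r. walk (parcs G) u r v"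
  shows "connected_graph G"
proof -
  have pg: "pair_graph G"
  proof
    show "symmetric (with_proj G)" using sym by (auto simp: symmetric_def intro: symI)
    show "finite (parcs G)" using assms(1,2) finite_subset by blast
    show "fst e \<noteq> snd e" if "e \<in> parcs G" for e using that irrefl by (cases e) auto
  qed (use assms in auto)
  have "(u, v) \<in> rtrancl_on (pverts G) ((parcs G)\<^sup>s)" if "walk (parcs G) u r v" "u \<in> pverts G" for u v r
    using that
  proof (induction r arbitrary: u)
    case (Cons x r)
    then have "(u, x) \<in> (parcs G)\<^sup>s" "x \<in> pverts G" using assms(2) by (auto simp: symcl_def)
    with Cons show ?case by (auto intro: converse_rtrancl_on_into_rtrancl_on)
  qed auto
  then have "Digraph_Component.connected (with_proj G)"
    using walks assms(3) unfolding connected_conv by auto blast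
  with pg show ?thesis unfolding connected_graph_def by blast
qed

lemma connected_graphD:
  assumes "connected_graph G"
  shows "finite (pverts G)" "parcs G \<subseteq> pverts G \<times> pverts G" "pverts G \<noteq> {}"
    and "\<And>u v. (u, v) \<in> parcs G \<Longrightarrow> (v, u) \<in> parcs G" "\<And>u. (u, u) \<notin> parcs G"
    and "\<And>u v. u \<in> pverts G \<Longrightarrow> v \<in> pverts G \<Longrightarrow> \<exists>r. walk (parcs G) u r v"
proof -
  interpret pair_graph G using assms by (simp add: connected_graph_def)
  show "finite (pverts G)" by (rule pair_finite_verts)
  show sub: "parcs G \<subseteq> pverts G \<times> pverts G" using in_arcsD1 in_arcsD2 by auto
  show sym: "(v, u) \<in> parcs G" if "(u, v) \<in> parcs G" for u v using that by (rule arcs_symmetric)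
  show "(u, u) \<notin> parcs G" for u using pair_no_loops[of "(u, u)"] by auto
  have conn: "pverts G \<noteq> {}"
    "\<And>u v. u \<in> pverts G \<Longrightarrow> v \<in> pverts G \<Longrightarrow> (u, v) \<in> rtrancl_on (pverts G) ((parcs G)\<^sup>s)"
    using assms unfolding connected_graph_def connected_conv by auto
  then show "pverts G \<noteq> {}" by simp
  have "\<exists>r. walk (parcs G) u r v" if "(u, v) \<in> rtrancl_on (pverts G) ((parcs G)\<^sup>s)" for u v
    using that
  proof (induction rule: rtrancl_on_induct)
    case base
    show ?case by (rule exI[of _ "[]"]) simp
  next
    case (step y z)
    then obtain r where "walk (parcs G) u r y" by blast
    moreover have "(y, z) \<in> parcs G" using step sym by (auto simp: symcl_def)
    ultimately have "walk (parcs G) u (r @ [z]) z" by (auto simp: walk_append)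
    then show ?case by blast
  qed
  with conn show "\<exists>r. walk (parcs G) u r v" if "u \<in> pverts G" "v \<in> pverts G" for u v
    using that by blast
qed

lemma twin_cover_iff:
  assumes "connected_graph G"
  shows "twin_cover G X \<longleftrightarrow> X \<subseteq> pverts G \<and> (\<forall>u v. (u, v) \<in> parcs G \<and> u \<notin> X \<and> v \<notin> X \<longrightarrow>
    insert u {w. (u, w) \<in> parcs G} = insert v {w. (v, w) \<in> parcs G})"
proof -
  have arc: "(u, v) \<in> arcs (with_proj G \<restriction> (pverts G - X)) \<longleftrightarrow> (u, v) \<in> parcs G \<and> u \<notin> X \<and> v \<notin> X" for u v
    using connected_graphD(2)[OF assms] by (auto simp: induce_subgraph_def)
  have twins: "true_twins G u v \<longleftrightarrow> insert u {w. (u, w) \<in> parcs G} = insert v {w. (v, w) \<in> parcs G}"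
    if "(u, v) \<in> parcs G" for u v
    using connected_graphD(2,5)[OF assms] that unfolding true_twins_def closed_nbhd_def by blast
  show ?thesis
    unfolding twin_cover_def Ball_def split_paired_All case_prod_conv arc using twins by blast
qed

lemma twin_coveredI:
  assumes "connected_graph G" "twin_cover G X"
  shows "twin_covered (pverts G) (parcs G) X"
  using connected_graphD[OF assms(1)] assms(2) unfolding twin_cover_iff[OF assms(1)]
  by unfold_locales auto

lemma path_between_imp_walk:
  assumes "path_between G u p v"
  obtains r where "p = u # r" "walk (parcs G) u r v" "distinct p"
proof -
  have "walk (parcs G) (hd p) (tl p) (last p)" if "set (vwalk_arcs p) \<subseteq> parcs G" "p \<noteq> []" for p
    using that by (induction p rule: vwalk_arcs.induct) auto
  then have "walk (parcs G) u (tl p) v" "p = u # tl p" "distinct p"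
    using assms by (auto simp: path_between_def vpath_def vwalk_def)
  then show ?thesis using that by blast
qed

lemma walk_imp_path_between:
  assumes "walk (parcs G) u r v" "distinct (u # r)" "u \<in> pverts G" "parcs G \<subseteq> pverts G \<times> pverts G"
  shows "path_between G u (u # r) v"
proof -
  have "set (vwalk_arcs (u # r)) \<subseteq> parcs G" using assms(1)
    by (induction r arbitrary: u) auto
  then show ?thesis
    using assms walk_in_verts[OF assms(1,4,3)] walk_last[OF assms(1)]
    by (auto simp: path_between_def vpath_def vwalk_def)
qed

text \<open>A shortest walk repeats no vertex, so minimality among paths and among walks is the
  same. The list \<open>p\<close> contains the initial vertex that \<open>r\<close> omits.\<close>

lemma shortest_path_iff:
  assumes "connected_graph G" "u \<in> pverts G"
  shows "shortest_path G u p v \<longleftrightarrow> (\<exists>r. p = u # r \<and> geodesic (parcs G) u r v)"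
proof
  note E = connected_graphD(2)[OF assms(1)]
  {
    assume "shortest_path G u p v"
    then have p: "path_between G u p v" and min: "\<And>q. path_between G u q v \<Longrightarrow> length p - 1 \<le> length q - 1"
      by (auto simp: shortest_path_def)
    obtain r where r: "p = u # r" "walk (parcs G) u r v" using p by (rule path_between_imp_walk)
    have "length r \<le> length s" if "walk (parcs G) u s v" for s
    proof -
      obtain s' where s': "geodesic (parcs G) u s' v" using ex_geodesic[OF \<open>walk (parcs G) u s v\<close>] by blast
      have "path_between G u (u # s') v"
        by (rule walk_imp_path_between[OF geodesic_walk[OF s'] geodesic_distinct[OF s'] assms(2) E])
      then have "length r \<le> length s'" using min r(1) by fastforce
      also have "\<dots> \<le> length s" using s' that unfolding geodesic_def by blast
      finally show ?thesis .
    qed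
    with r show "\<exists>r. p = u # r \<and> geodesic (parcs G) u r v" unfolding geodesic_def by blast
  }
  assume "\<exists>r. p = u # r \<and> geodesic (parcs G) u r v"
  then obtain r where r: "p = u # r" "geodesic (parcs G) u r v" by blast
  have "path_between G u p v"
    unfolding r(1)
    by (rule walk_imp_path_between[OF geodesic_walk[OF r(2)] geodesic_distinct[OF r(2)] assms(2) E])
  moreover have "length p - 1 \<le> length q - 1" if "path_between G u q v" for q
  proof -
    obtain s where "q = u # s" "walk (parcs G) u s v"
      using \<open>path_between G u q v\<close> by (rule path_between_imp_walk)
    then show ?thesis using r unfolding geodesic_def by simp
  qed
  ultimately show "shortest_path G u p v" by (simp add: shortest_path_def)
qed

lemma conflict_free_iff: "conflict_free c p \<longleftrightarrow> (\<exists>x \<in> set p. \<forall>y \<in> set p. c y = c x \<longrightarrow> y = x)"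
  unfolding conflict_free_def by blast

lemma strong_cfvc_coloring_iff:
  assumes "connected_graph G"
  shows "strong_cfvc_coloring G c \<longleftrightarrow> strong (pverts G) (parcs G) c"
  unfolding strong_cfvc_coloring_def strong_def conflict_free_iff
proof (intro ball_cong refl imp_cong)
  fix u v assume "u \<in> pverts G"
  show "(\<exists>p. shortest_path G u p v \<and> (\<exists>x \<in> set p. \<forall>y \<in> set p. c y = c x \<longrightarrow> y = x)) \<longleftrightarrow>
    (\<exists>r. geodesic (parcs G) u r v \<and> (\<exists>x \<in> set (u # r). \<forall>y \<in> set (u # r). c y = c x \<longrightarrow> y = x))"
    unfolding shortest_path_iff[OF assms \<open>u \<in> pverts G\<close>] by blast
qed

text \<open>If all colours differ, any geodesic is conflict-free. This guarantees that the minimum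
  defining \<open>svcfc\<close> is attained.\<close>

lemma strong_inj:
  assumes "connected_graph G" "inj_on c (pverts G)"
  shows "strong (pverts G) (parcs G) c"
  unfolding strong_def
proof (intro ballI impI)
  fix u v assume u: "u \<in> pverts G" and v: "v \<in> pverts G"
  obtain r where r: "geodesic (parcs G) u r v"
    using connected_graphD(6)[OF assms(1) u v] ex_geodesic by metis
  have "set (u # r) \<subseteq> pverts G"
    using walk_in_verts[OF geodesic_walk[OF r] connected_graphD(2)[OF assms(1)] u] u by simp
  then have "\<forall>y \<in> set (u # r). c y = c u \<longrightarrow> y = u" using inj_onD[OF assms(2)] u by blast
  then have "\<exists>x \<in> set (u # r). \<forall>y \<in> set (u # r). c y = c x \<longrightarrow> y = x" by (rule bexI) simp
  from conjI[OF r this]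
  show "\<exists>r. geodesic (parcs G) u r v \<and> (\<exists>x \<in> set (u # r). \<forall>y \<in> set (u # r). c y = c x \<longrightarrow> y = x)"
    by (rule exI)
qed

lemma svcfc_le_iff:
  assumes "connected_graph G"
  shows "svcfc G \<le> k \<longleftrightarrow> (\<exists>c. strong (pverts G) (parcs G) c \<and> card (c ` pverts G) \<le> k)"
proof -
  let ?P = "\<lambda>m. \<exists>c. strong_cfvc_coloring G c \<and> card (c ` pverts G) = m"
  obtain c :: "'a \<Rightarrow> nat" where "inj_on c (pverts G)"
    using finite_imp_inj_to_nat_seg[OF connected_graphD(1)[OF assms]] by auto
  then have "strong_cfvc_coloring G c"
    using strong_inj[OF assms] strong_cfvc_coloring_iff[OF assms] by simp
  then have "\<exists>m. ?P m" by blast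
  then have ex: "?P (svcfc G)" unfolding svcfc_def by (rule LeastI_ex)
  have least: "svcfc G \<le> card (d ` pverts G)" if "strong (pverts G) (parcs G) d" for d
    unfolding svcfc_def by (rule Least_le) (use that strong_cfvc_coloring_iff[OF assms] in blast)
  show ?thesis
  proof
    assume "svcfc G \<le> k"
    with ex show "\<exists>c. strong (pverts G) (parcs G) c \<and> card (c ` pverts G) \<le> k"
      unfolding strong_cfvc_coloring_iff[OF assms] by auto
  next
    assume "\<exists>c. strong (pverts G) (parcs G) c \<and> card (c ` pverts G) \<le> k"
    then show "svcfc G \<le> k" using least order_trans by blast
  qed
qed

section \<open>Correctness of the programs\<close>

definition adjacency_of :: "nat pair_pre_digraph \<Rightarrow> adjacency" where
  "adjacency_of G = map (\<lambda>v. (v, sorted_list_of_set {w. (v, w) \<in> parcs G})) (sorted_list_of_set (pverts G))"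

definition lists_of :: "svcfc_instance \<Rightarrow> adjacency \<times> nat \<times> nat list" where
  "lists_of i = (adjacency_of (fst i), fst (snd i), sorted_list_of_set (snd (snd i)))"

text \<open>The bridge between graphs and programs: sets are encoded by their sorted lists, so the
  instance and its list form are the same tree.\<close>

lemma enc_lists_lists_of: "enc_lists (lists_of i) = enc_instance i"
proof -
  have "enc_list (enc_pair enc_nat (enc_list enc_nat)) (map (\<lambda>v. (v, sorted_list_of_set (S v))) vs)
      = enc_list (enc_pair enc_nat enc_nat_set) (map (\<lambda>v. (v, S v)) vs)" for S vs
    by (induction vs) (simp_all add: enc_nat_set_def)
  then show ?thesis
    by (cases i) (simp add: lists_of_def adjacency_of_def enc_instance_def enc_graph_def enc_nat_set_def)
qed

section \<open>Sorted lists and ranks\<close>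

lemma filter_fst_eq: "distinct vs \<Longrightarrow>
    filter (\<lambda>p. fst p = v) (map (\<lambda>v. (v, f v)) vs) = (if v \<in> set vs then [(v, f v)] else [])"
  by (induction vs) auto

lemma filter_sorted_list_of_set:
  "finite S \<Longrightarrow> filter P (sorted_list_of_set S) = sorted_list_of_set {x \<in> S. P x}"
  using sorted_list_of_set.idem_if_sorted_distinct[of "filter P (sorted_list_of_set S)"]
  by (simp add: sorted_filter[where f = "\<lambda>x. x", simplified] Int_def conj_commute)

text \<open>Thanks to this, increasing labels may be applied entry by entry and the lists remain
  sorted; the kernelization contains no sorting routine.\<close>

lemma sorted_list_of_set_image:
  assumes "strict_mono_on T f" "S \<subseteq> T" "finite S"
  shows "sorted_list_of_set (f ` S) = map f (sorted_list_of_set S)"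
proof -
  have "sorted_wrt (<) (map f (sorted_list_of_set S))"
    unfolding sorted_wrt_map
    by (rule sorted_wrt_mono_rel[OF _ strict_sorted_list_of_set])
       (use assms in \<open>auto dest: strict_mono_onD\<close>)
  then have "sorted_list_of_set (set (map f (sorted_list_of_set S))) = map f (sorted_list_of_set S)"
    by (intro sorted_list_of_set.idem_if_sorted_distinct) (simp_all add: strict_sorted_iff)
  then show ?thesis using assms(3) by simp
qed

lemma hd0_in_set: "x \<in> set xs \<Longrightarrow> hd0 xs \<in> set xs"
  by (cases xs) auto

lemma rank_eq: "distinct K \<Longrightarrow> rank K v = card {w \<in> set K. w < v}"
  unfolding rank_def using distinct_card[of "filter (\<lambda>w. w < v) K"] by simp

lemma rank_strict_mono: "distinct K \<Longrightarrow> strict_mono_on (set K) (rank K)"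
  by (rule strict_mono_onI) (auto simp: rank_eq intro!: psubset_card_mono)

lemma rank_less: "distinct K \<Longrightarrow> v \<in> set K \<Longrightarrow> rank K v < length K"
  unfolding rank_eq distinct_card[symmetric] by (intro psubset_card_mono) auto

section \<open>The list functions compute the graph notions\<close>

context
  fixes G :: "nat pair_pre_digraph"
  assumes conn: "connected_graph G"
begin

lemma map_fst_adjacency_of: "map fst (adjacency_of G) = sorted_list_of_set (pverts G)"
  by (simp add: adjacency_of_def comp_def)

lemma set_map_fst_adjacency_of: "set (map fst (adjacency_of G)) = pverts G"
  using connected_graphD(1)[OF conn] by (simp only: map_fst_adjacency_of set_sorted_list_of_set)

lemma finite_neighbourhood: "finite {w. (v, w) \<in> parcs G}"
  by (rule finite_subset[OF _ connected_graphD(1)[OF conn]]) (use connected_graphD(2)[OF conn] in auto)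

lemma neighbours_adjacency_of: "neighbours (adjacency_of G) v = sorted_list_of_set {w. (v, w) \<in> parcs G}"
proof (cases "v \<in> pverts G")
  case True
  then show ?thesis
    using connected_graphD(1)[OF conn] by (simp add: neighbours_def adjacency_of_def filter_fst_eq)
next
  case False
  then have empty: "{w. (v, w) \<in> parcs G} = {}" using connected_graphD(2)[OF conn] by auto
  show ?thesis
    unfolding empty using False connected_graphD(1)[OF conn]
    by (simp add: neighbours_def adjacency_of_def filter_fst_eq)
qed

lemma set_neighbours: "set (neighbours (adjacency_of G) v) = {w. (v, w) \<in> parcs G}"
  by (simp add: neighbours_adjacency_of finite_neighbourhood)

end

context
  fixes G :: "nat pair_pre_digraph" and X :: "nat set"
  assumes conn: "connected_graph G" and cover: "twin_cover G X"
begin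

interpretation twin_covered "pverts G" "parcs G" X
  by (rule twin_coveredI[OF conn cover])

lemma set_Xs: "set (sorted_list_of_set X) = X"
  using finite_subset[OF X_sub finite_V] by simp

lemma set_outside: "set (outside (adjacency_of G) (sorted_list_of_set X)) = pverts G - X"
  unfolding outside_def set_filter set_map_fst_adjacency_of[OF conn] set_Xs by blast

lemma distinct_outside: "distinct (outside (adjacency_of G) (sorted_list_of_set X))"
  unfolding outside_def map_fst_adjacency_of[OF conn] by simp

lemma same_type_iff:
  assumes "v \<notin> X" "w \<notin> X"
  shows "same_type (adjacency_of G) (sorted_list_of_set X) v w \<longleftrightarrow> type w = type v"
proof -
  have types: "type v = Inr {x \<in> X. (v, x) \<in> parcs G}" "type w = Inr {x \<in> X. (w, x) \<in> parcs G}"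
    using assms by (simp_all add: type_def)
  show ?thesis
    unfolding types sum.inject same_type_def set_neighbours[OF conn] set_Xs by blast
qed

lemma set_twin_types:
  assumes "v \<in> pverts G - X"
  shows "set (twin_types (adjacency_of G) (sorted_list_of_set X) v) = same_type_verts v"
  unfolding twin_types_def set_filter set_outside same_type_verts_def
  by (rule Collect_cong, rule conj_cong[OF refl], rule same_type_iff) (use assms in blast)+

lemma distinct_twin_types: "distinct (twin_types (adjacency_of G) (sorted_list_of_set X) v)"
  unfolding twin_types_def using distinct_outside by simp

lemma set_clique: "set (clique (adjacency_of G) (sorted_list_of_set X) v) = clique_of v"
  unfolding clique_def set_filter set_outside set_neighbours[OF conn] clique_of_def by blast

lemma length_clique: "length (clique (adjacency_of G) (sorted_list_of_set X) v) = card (clique_of v)"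
proof -
  have "distinct (clique (adjacency_of G) (sorted_list_of_set X) v)" unfolding clique_def using distinct_outside by simp
  from distinct_card[OF this] show ?thesis by (simp add: set_clique)
qed

lemma leader_props:
  assumes v: "v \<in> pverts G - X"
  shows "leader (adjacency_of G) (sorted_list_of_set X) v \<in> same_type_verts v"
    and "w \<in> same_type_verts v \<Longrightarrow> card (clique_of w) \<le> card (clique_of (leader (adjacency_of G) (sorted_list_of_set X) v))"
proof -
  let ?L = "filter (\<lambda>m. \<forall>w \<in> set (twin_types (adjacency_of G) (sorted_list_of_set X) v). length (clique (adjacency_of G) (sorted_list_of_set X) w) \<le> length (clique (adjacency_of G) (sorted_list_of_set X) m))
    (twin_types (adjacency_of G) (sorted_list_of_set X) v)"
  have set_L: "set ?L = {m \<in> same_type_verts v. \<forall>w \<in> same_type_verts v. card (clique_of w) \<le> card (clique_of m)}"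
    unfolding set_filter set_twin_types[OF v] length_clique by blast
  have "v \<in> same_type_verts v" using v by (simp add: same_type_verts_def)
  moreover have fin: "finite ((\<lambda>w. card (clique_of w)) ` same_type_verts v)"
    using finite_V by (simp add: same_type_verts_def)
  ultimately have "Max ((\<lambda>w. card (clique_of w)) ` same_type_verts v)
      \<in> (\<lambda>w. card (clique_of w)) ` same_type_verts v"
    by (intro Max_in) auto
  then obtain m where m: "m \<in> same_type_verts v"
    "Max ((\<lambda>w. card (clique_of w)) ` same_type_verts v) = card (clique_of m)" by (rule imageE)
  have "card (clique_of w) \<le> card (clique_of m)" if "w \<in> same_type_verts v" for w
    using Max_ge[OF fin imageI[OF that]] m(2) by simp
  with m(1) have "m \<in> set ?L" unfolding set_L by blast
  \<comment> \<open>A maximal clique size is attained, so \<open>?L\<close> is nonempty and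
    \<open>hd0\<close> does not return its default.\<close>
  then have "hd0 ?L \<in> set ?L" by (rule hd0_in_set)
  then have "leader (adjacency_of G) (sorted_list_of_set X) v \<in> set ?L" unfolding leader_def .
  then show "leader (adjacency_of G) (sorted_list_of_set X) v \<in> same_type_verts v"
    and "w \<in> same_type_verts v \<Longrightarrow> card (clique_of w) \<le> card (clique_of (leader (adjacency_of G) (sorted_list_of_set X) v))"
    unfolding set_L by blast+
qed

lemma leader_cong:
  assumes "v \<in> pverts G - X" "w \<in> pverts G - X" "type v = type w"
  shows "leader (adjacency_of G) (sorted_list_of_set X) v = leader (adjacency_of G) (sorted_list_of_set X) w"
proof -
  have "twin_types (adjacency_of G) (sorted_list_of_set X) v = twin_types (adjacency_of G) (sorted_list_of_set X) w"
    unfolding twin_types_def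
  proof (rule filter_cong[OF refl])
    fix u assume "u \<in> set (outside (adjacency_of G) (sorted_list_of_set X))"
    then have u: "u \<notin> X" unfolding set_outside by blast
    have v: "v \<notin> X" and w: "w \<notin> X" using assms by blast+
    show "same_type (adjacency_of G) (sorted_list_of_set X) v u = same_type (adjacency_of G) (sorted_list_of_set X) w u"
      unfolding same_type_iff[OF v u] same_type_iff[OF w u] assms(3) ..
  qed
  then show ?thesis unfolding leader_def by simp
qed

lemma twin_kernel_leader:
  assumes "\<And>v. v \<in> pverts G - X \<Longrightarrow> card (clique_of v) \<le> k"
  shows "twin_kernel (pverts G) (parcs G) X k (leader (adjacency_of G) (sorted_list_of_set X))"
proof -
  have "twin_covered (pverts G) (parcs G) X" by (rule twin_coveredI[OF conn cover])
  moreover have "twin_kernel_axioms (pverts G) (parcs G) X k (leader (adjacency_of G) (sorted_list_of_set X))"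
  proof (rule twin_kernel_axioms.intro)
    fix v w assume v: "v \<in> pverts G - X"
    show "leader (adjacency_of G) (sorted_list_of_set X) v \<in> same_type_verts v" by (rule leader_props(1)[OF v])
    show "card (clique_of v) \<le> k" by (rule assms[OF v])
    assume "w \<in> same_type_verts v"
    then show "card (clique_of w) \<le> card (clique_of (leader (adjacency_of G) (sorted_list_of_set X) v))" by (rule leader_props(2)[OF v])
  next
    fix v w assume "v \<in> pverts G - X" "w \<in> pverts G - X" "type v = type w"
    then show "leader (adjacency_of G) (sorted_list_of_set X) v = leader (adjacency_of G) (sorted_list_of_set X) w" by (rule leader_cong)
  qed
  ultimately show ?thesis by (rule twin_kernel.intro)
qed

lemma kept_eq:
  assumes "twin_kernel (pverts G) (parcs G) X k (leader (adjacency_of G) (sorted_list_of_set X))"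
  shows "kept (adjacency_of G) k (sorted_list_of_set X) = sorted_list_of_set (twin_kernel.kept_verts (pverts G) (parcs G) X k (leader (adjacency_of G) (sorted_list_of_set X)))"
proof -
  interpret twin_kernel "pverts G" "parcs G" X k "leader (adjacency_of G) (sorted_list_of_set X)" by (rule assms)
  have "kept (adjacency_of G) k (sorted_list_of_set X) = sorted_list_of_set {v \<in> pverts G. v \<in> X \<or> v \<in> clique_of (leader (adjacency_of G) (sorted_list_of_set X) v)
      \<or> rank (twin_types (adjacency_of G) (sorted_list_of_set X) v) v < k}"
    unfolding kept_def map_fst_adjacency_of[OF conn] filter_sorted_list_of_set[OF finite_V]
      set_Xs set_clique ..
  also have "{v \<in> pverts G. v \<in> X \<or> v \<in> clique_of (leader (adjacency_of G) (sorted_list_of_set X) v) \<or> rank (twin_types (adjacency_of G) (sorted_list_of_set X) v) v < k}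
      = kept_verts"
    unfolding kept_verts_def rank_eq[OF distinct_twin_types]
  proof (rule Collect_cong)
    fix v
    show "(v \<in> pverts G \<and> (v \<in> X \<or> v \<in> clique_of (leader (adjacency_of G) (sorted_list_of_set X) v)
        \<or> card {w \<in> set (twin_types (adjacency_of G) (sorted_list_of_set X) v). w < v} < k)) \<longleftrightarrow>
      (v \<in> pverts G \<and> (v \<in> X \<or> v \<in> clique_of (leader (adjacency_of G) (sorted_list_of_set X) v)
        \<or> card {w \<in> same_type_verts v. w < v} < k))"
    proof (cases "v \<in> pverts G - X")
      case True
      show ?thesis unfolding set_twin_types[OF True] ..
    next
      case False
      \<comment> \<open>For a vertex of \<open>X\<close> the two rank conditions may differ, but
        membership in \<open>X\<close> already settles the test.\<close>
      then show ?thesis by blast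
    qed
  qed
  finally show ?thesis .
qed

lemma kernelize_large:
  assumes "v \<in> pverts G - X" "k < card (clique_of v)"
  shows "kernelize (lists_of (G, k, X)) = ([(0, [1]), (1, [0])], 1, [])"
proof -
  have "\<exists>v \<in> set (outside (adjacency_of G) (sorted_list_of_set X)). k < length (clique (adjacency_of G) (sorted_list_of_set X) v)"
    unfolding set_outside length_clique using assms by blast
  then show ?thesis unfolding kernelize_def lists_of_def Let_def by simp
qed

lemma kernelize_small:
  assumes "\<And>v. v \<in> pverts G - X \<Longrightarrow> card (clique_of v) \<le> k"
  shows "kernelize (lists_of (G, k, X)) =
    (relabel (adjacency_of G) (kept (adjacency_of G) k (sorted_list_of_set X)), k, map (\<lambda>v. rank (kept (adjacency_of G) k (sorted_list_of_set X)) v) (sorted_list_of_set X))"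
proof -
  have "\<not> (\<exists>v \<in> set (outside (adjacency_of G) (sorted_list_of_set X)). k < length (clique (adjacency_of G) (sorted_list_of_set X) v))"
    unfolding set_outside length_clique using assms by (auto simp: not_less)
  then show ?thesis unfolding kernelize_def lists_of_def Let_def by simp
qed

end

section \<open>The kernel as a graph\<close>

definition induced_relabelled :: "nat pair_pre_digraph \<Rightarrow> nat set \<Rightarrow> (nat \<Rightarrow> nat) \<Rightarrow> nat pair_pre_digraph" where
  "induced_relabelled G K lab =
     \<lparr>pverts = lab ` K, parcs = {(lab u, lab v) | u v. u \<in> K \<and> v \<in> K \<and> (u, v) \<in> parcs G}\<rparr>"

text \<open>The program must output exactly the encoding of a graph, that is, its sorted adjacency
  list; it does so because \<open>rank Ks\<close> is increasing on \<open>K\<close>.\<close>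

lemma relabel_eq:
  assumes conn: "connected_graph G" and K: "K \<subseteq> pverts G"
    and "Ks = sorted_list_of_set K" and lab: "lab = rank Ks"
  shows "relabel (adjacency_of G) Ks = adjacency_of (induced_relabelled G K lab)"
proof -
  have fin: "finite K" using connected_graphD(1)[OF conn] K finite_subset by blast
  have set_Ks: "set Ks = K" "distinct Ks" using assms(3) fin by auto
  have mono: "strict_mono_on K lab" using rank_strict_mono[OF set_Ks(2)] unfolding lab set_Ks(1) .
  have inj: "inj_on lab K" by (rule strict_mono_on_imp_inj_on[OF mono])
  have nb: "sorted_list_of_set {y. (lab v, y) \<in> parcs (induced_relabelled G K lab)} =
      map lab (filter (\<lambda>w. w \<in> set Ks) (neighbours (adjacency_of G) v))" if "v \<in> K" for v
  proof -
    have "{y. (lab v, y) \<in> parcs (induced_relabelled G K lab)} = lab ` {w \<in> K. (v, w) \<in> parcs G}"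
      using that inj_onD[OF inj] unfolding induced_relabelled_def by auto
    also have "sorted_list_of_set \<dots> = map lab (sorted_list_of_set {w \<in> K. (v, w) \<in> parcs G})"
      using fin by (intro sorted_list_of_set_image[OF mono]) auto
    also have "{w \<in> K. (v, w) \<in> parcs G} = {w \<in> {w. (v, w) \<in> parcs G}. w \<in> K}" by blast
    also have "sorted_list_of_set \<dots> = filter (\<lambda>w. w \<in> K) (neighbours (adjacency_of G) v)"
      unfolding neighbours_adjacency_of[OF conn]
      by (rule filter_sorted_list_of_set[OF finite_neighbourhood[OF conn], symmetric])
    finally show ?thesis unfolding set_Ks(1) .
  qed
  have "sorted_list_of_set (pverts (induced_relabelled G K lab)) = map lab Ks"
    using sorted_list_of_set_image[OF mono subset_refl fin] assms(3) by (simp add: induced_relabelled_def)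
  then show ?thesis
    using nb set_Ks(1) unfolding relabel_def adjacency_of_def[of "induced_relabelled G K lab"]
    by (auto simp: lab)
qed

definition edge_graph :: "nat pair_pre_digraph" where
  "edge_graph = \<lparr>pverts = {0, 1}, parcs = {(0, 1), (1, 0)}\<rparr>"

lemma connected_edge_graph: "connected_graph edge_graph"
proof (rule connected_graphI)
  fix u v assume "u \<in> pverts edge_graph" "v \<in> pverts edge_graph"
  then have "walk (parcs edge_graph) u (if u = v then [] else [v]) v" by (auto simp: edge_graph_def)
  then show "\<exists>r. walk (parcs edge_graph) u r v" by blast
qed (auto simp: edge_graph_def)

lemma twin_cover_edge_graph: "twin_cover edge_graph {}"
  unfolding twin_cover_iff[OF connected_edge_graph] by (auto simp: edge_graph_def)

lemma lists_of_edge_graph: "lists_of (edge_graph, 1, {}) = ([(0, [1]), (1, [0])], 1, [])"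
proof -
  have "{w. (0, w) \<in> parcs edge_graph} = {1}" "{w. (1, w) \<in> parcs edge_graph} = {0}"
    by (auto simp: edge_graph_def)
  moreover have "sorted_list_of_set (pverts edge_graph) = [0, 1]"
    by (simp add: edge_graph_def)
  ultimately show ?thesis by (simp add: lists_of_def adjacency_of_def)
qed

lemma svcfc_edge_graph: "\<not> svcfc edge_graph \<le> 1"
proof
  assume "svcfc edge_graph \<le> 1"
  then obtain c where c: "strong (pverts edge_graph) (parcs edge_graph) c"
    "card (c ` pverts edge_graph) \<le> 1"
    using svcfc_le_iff[OF connected_edge_graph] by blast
  have "c 0 \<noteq> c 1" by (rule strong_imp_proper[OF c(1)]) (auto simp: edge_graph_def)
  then show False using c(2) by (simp add: edge_graph_def)
qed

abbreviation (input) kernel_bound :: "nat \<Rightarrow> nat \<Rightarrow> nat" where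
  "kernel_bound t k \<equiv> max 2 (t + (t + 1) * k * 2 ^ (t + k - 1))"

text \<open>The graph \<open>G'\<close> is only asserted to exist, with the list output of the
  program as its list form. A bound on the number of vertices would not bound the encoding, hence
  the additional bound on their names.\<close>

lemma kernelize_correct:
  assumes "connected_graph G" "1 \<le> k" "twin_cover G X"
  shows "\<exists>G' k' X'. connected_graph G' \<and> 1 \<le> k' \<and> twin_cover G' X' \<and>
    (svcfc G \<le> k \<longleftrightarrow> svcfc G' \<le> k') \<and> card (pverts G') \<le> kernel_bound (card X) k \<and>
    pverts G' \<subseteq> {..<kernel_bound (card X) k} \<and> k' \<le> k \<and> card X' \<le> card X \<and>
    lists_of (G', k', X') = kernelize (lists_of (G, k, X))"
proof -
  interpret twin_covered "pverts G" "parcs G" X by (rule twin_coveredI[OF assms(1,3)])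
  show ?thesis
  proof (cases "\<exists>v \<in> pverts G - X. k < card (clique_of v)")
    case True
    then obtain v where v: "v \<in> pverts G - X" "k < card (clique_of v)" by blast
    have "\<not> svcfc G \<le> k"
      unfolding svcfc_le_iff[OF assms(1)] by (rule large_clique_not_colourable[OF v])
    then have "svcfc G \<le> k \<longleftrightarrow> svcfc edge_graph \<le> 1" using svcfc_edge_graph by simp
    \<comment> \<open>This two-vertex graph is the reason for the 2 in
      \<open>kernel_bound\<close>.\<close>
    moreover have "card (pverts edge_graph) \<le> kernel_bound (card X) k"
      "pverts edge_graph \<subseteq> {..<kernel_bound (card X) k}" by (auto simp: edge_graph_def)
    ultimately show ?thesis
      using connected_edge_graph twin_cover_edge_graph lists_of_edge_graph
        kernelize_large[OF assms(1,3) v] assms(2)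
      by (intro exI[of _ edge_graph] exI[of _ 1] exI[of _ "{}"]) simp
  next
    case False
    then have small: "\<And>v. v \<in> pverts G - X \<Longrightarrow> card (clique_of v) \<le> k" by (simp add: not_less)
    let ?A = "adjacency_of G" and ?Xs = "sorted_list_of_set X"
    have tk: "twin_kernel (pverts G) (parcs G) X k (leader ?A ?Xs)"
      by (rule twin_kernel_leader[OF assms(1,3) small])
    interpret twin_kernel "pverts G" "parcs G" X k "leader ?A ?Xs" by (rule tk)
    define Ks where "Ks = kept ?A k ?Xs"
    have Ks: "Ks = sorted_list_of_set kept_verts" unfolding Ks_def by (rule kept_eq[OF assms(1,3) tk])
    have fin: "finite kept_verts" by (rule finite_subset[OF kept_subset finite_V])
    have set_Ks: "set Ks = kept_verts" "distinct Ks" unfolding Ks using fin by auto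
    define lab where "lab = rank Ks"
    have mono: "strict_mono_on kept_verts lab"
      using rank_strict_mono[OF set_Ks(2)] unfolding lab_def set_Ks(1) .
    have inj: "inj_on lab kept_verts" by (rule strict_mono_on_imp_inj_on[OF mono])
    let ?G' = "induced_relabelled G kept_verts lab"
    have verts': "pverts ?G' = lab ` kept_verts"
      and arcs': "parcs ?G' = {(lab u, lab v) | u v. u \<in> kept_verts \<and> v \<in> kept_verts \<and> (u, v) \<in> parcs G}"
      by (simp_all add: induced_relabelled_def)
    note equiv = kernel_equivalence[OF cover_subset_kept kept_subset inj kept_many kept_large,
        folded verts' arcs']
    have arc_iff: "(lab u, lab v) \<in> parcs ?G' \<longleftrightarrow> (u, v) \<in> parcs G"
      if "u \<in> kept_verts" "v \<in> kept_verts" for u v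
      using that inj_onD[OF inj] unfolding arcs' by blast
    have conn': "connected_graph ?G'"
    proof (rule connected_graphI)
      obtain v where v: "v \<in> pverts G" using connected_graphD(3)[OF assms(1)] by blast
      have "kept_verts \<noteq> {}"
      proof (cases "v \<in> X")
        case True
        then show ?thesis using cover_subset_kept by blast
      next
        case False
        then have "leader ?A ?Xs v \<in> kept_verts"
          using v leader_in[of v] leader_clique_kept[of v] clique_of_refl
          unfolding same_type_verts_def by blast
        then show ?thesis by blast
      qed
      then show "pverts ?G' \<noteq> {}" unfolding verts' by simp
      show "finite (pverts ?G')" unfolding verts' using fin by simp
      show "parcs ?G' \<subseteq> pverts ?G' \<times> pverts ?G'" unfolding verts' arcs' by blast
      show "(v, u) \<in> parcs ?G'" if "(u, v) \<in> parcs ?G'" for u v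
        using that sym_E unfolding arcs' by blast
      show "(u, u) \<notin> parcs ?G'" for u
        using inj_onD[OF inj] irrefl_E unfolding arcs' by blast
    qed (rule equiv(2))
    have "twin_cover ?G' (lab ` X)"
      unfolding twin_cover_iff[OF conn']
    proof (intro conjI allI impI)
      show "lab ` X \<subseteq> pverts ?G'" unfolding verts' using cover_subset_kept by blast
      fix u' v' assume uv: "(u', v') \<in> parcs ?G' \<and> u' \<notin> lab ` X \<and> v' \<notin> lab ` X"
      then obtain u v where u: "u' = lab u" "u \<in> kept_verts" "u \<notin> X"
        and v: "v' = lab v" "v \<in> kept_verts" "v \<notin> X" and "(u, v) \<in> parcs G"
        unfolding arcs' by blast
      \<comment> \<open>Closed neighbourhoods in the kernel are the images of the old ones cut down
        to the kept vertices, so twins remain twins.\<close>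
      have nb: "insert (lab w) {y. (lab w, y) \<in> parcs ?G'}
          = lab ` (kept_verts \<inter> insert w {y. (w, y) \<in> parcs G})" if "w \<in> kept_verts" for w
        using that arc_iff[OF that] unfolding arcs' by blast
      show "insert u' {w. (u', w) \<in> parcs ?G'} = insert v' {w. (v', w) \<in> parcs ?G'}"
        unfolding u(1) v(1) nb[OF u(2)] nb[OF v(2)] twins[OF \<open>(u, v) \<in> parcs G\<close> u(3) v(3)] ..
    qed
    moreover have "svcfc G \<le> k \<longleftrightarrow> svcfc ?G' \<le> k"
      unfolding svcfc_le_iff[OF assms(1)] svcfc_le_iff[OF conn'] by (rule equiv(1))
    moreover have card': "card kept_verts \<le> kernel_bound (card X) k"
      using card_kept[OF assms(2)] by simp
    then have "card (pverts ?G') \<le> kernel_bound (card X) k"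
      unfolding verts' using card_image[OF inj] by simp
    moreover have "pverts ?G' \<subseteq> {..<kernel_bound (card X) k}"
    proof -
      have "length Ks = card kept_verts" using distinct_card[OF set_Ks(2)] set_Ks(1) by simp
      then have "lab v < kernel_bound (card X) k" if "v \<in> kept_verts" for v
        using rank_less[OF set_Ks(2), of v] that card' unfolding set_Ks(1) lab_def
        by (metis order.strict_trans2)
      then show ?thesis unfolding verts' image_subset_iff lessThan_iff by blast
    qed
    moreover have "card (lab ` X) \<le> card X"
      by (rule card_image_le[OF finite_subset[OF X_sub finite_V]])
    moreover have "lists_of (?G', k, lab ` X) = kernelize (lists_of (G, k, X))"
    proof -
      have "sorted_list_of_set (lab ` X) = map (\<lambda>v. rank Ks v) ?Xs"
        using sorted_list_of_set_image[OF mono cover_subset_kept finite_subset[OF X_sub finite_V]]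
        by (simp add: lab_def)
      then show ?thesis
        using relabel_eq[OF assms(1) kept_subset Ks lab_def] kernelize_small[OF assms(1,3) small]
        by (simp add: lists_of_def Ks_def)
    qed
    ultimately show ?thesis using conn' assms(2)
      by (intro exI[of _ ?G'] exI[of _ k] exI[of _ "lab ` X"]) simp
  qed
qed

section \<open>Correctness and running time of the search\<close>

lemma foldl_walk_step:
  assumes "connected_graph G"
  shows "foldl (walk_step (adjacency_of G)) (b, u) p =
    (b \<and> walk (parcs G) u p (last (u # p)), last (u # p))"
  by (induction p arbitrary: b u) (auto simp: walk_step_def set_neighbours[OF assms])

lemma is_walk_iff:
  assumes "connected_graph G"
  shows "is_walk (adjacency_of G) u p v \<longleftrightarrow> walk (parcs G) u p v"
  unfolding is_walk_def foldl_walk_step[OF assms] case_prod_conv using walk_last by fastforce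

lemma decide_correct:
  assumes "connected_graph G"
  shows "decide (lists_of (G, k, X)) \<longleftrightarrow> svcfc G \<le> k"
proof -
  let ?V = "pverts G" and ?E = "parcs G" and ?vs = "sorted_list_of_set (pverts G)"
  let ?W = "set (all_lists ?vs ?vs)" and ?F = "set (all_lists (List.product ?vs ?vs) ?vs)"
  have fin: "finite ?V" by (rule connected_graphD(1)[OF assms])
  have W: "?W = {p. set p \<subseteq> ?V \<and> length p \<le> card ?V}"
    and F: "?F = {f. set f \<subseteq> ?V \<times> ?V \<and> length f \<le> card ?V}"
    unfolding set_all_lists using fin by (simp_all del: set_product add: set_product)
  \<comment> \<open>The vertices of a geodesic are distinct, so its length stays within the
    enumerated range.\<close>
  have geo_W: "p \<in> ?W" if "geodesic ?E u p v" "u \<in> ?V" for u p v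
  proof -
    have sub: "set (u # p) \<subseteq> ?V"
      using walk_in_verts[OF geodesic_walk[OF that(1)] connected_graphD(2)[OF assms] that(2)] that(2)
      by simp
    have "length (u # p) = card (set (u # p))"
      using distinct_card[OF geodesic_distinct[OF that(1)]] by simp
    also have "\<dots> \<le> card ?V" by (rule card_mono[OF fin sub])
    finally show ?thesis using sub unfolding W by simp
  qed
  have geo: "p \<in> ?W \<and> walk ?E u p v \<and> (\<forall>q \<in> ?W. walk ?E u q v \<longrightarrow> length p \<le> length q)
      \<longleftrightarrow> geodesic ?E u p v" if "u \<in> ?V" for u p v
  proof
    assume p: "p \<in> ?W \<and> walk ?E u p v \<and> (\<forall>q \<in> ?W. walk ?E u q v \<longrightarrow> length p \<le> length q)"
    have "length p \<le> length s" if "walk ?E u s v" for s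
    proof -
      obtain s' where s': "geodesic ?E u s' v" using ex_geodesic[OF \<open>walk ?E u s v\<close>] by blast
      have "s' \<in> ?W" by (rule geo_W[OF s' \<open>u \<in> ?V\<close>])
      then have "length p \<le> length s'" using p geodesic_walk[OF s'] by blast
      also have "\<dots> \<le> length s" using s' that unfolding geodesic_def by blast
      finally show ?thesis .
    qed
    with p show "geodesic ?E u p v" unfolding geodesic_def by blast
  next
    assume "geodesic ?E u p v"
    then show "p \<in> ?W \<and> walk ?E u p v \<and> (\<forall>q \<in> ?W. walk ?E u q v \<longrightarrow> length p \<le> length q)"
      using geo_W[OF _ that] unfolding geodesic_def by blast
  qed
  have good: "good_colouring (adjacency_of G) k (all_lists ?vs ?vs) f \<longleftrightarrow>
      colour f ` ?V \<subseteq> ?V \<and> card (colour f ` ?V) \<le> k \<and> strong ?V ?E (colour f)" for f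
  proof -
    have "length (filter (\<lambda>c. \<exists>v \<in> ?V. colour f v = c) ?vs) = card {c \<in> ?V. \<exists>v \<in> ?V. colour f v = c}"
      using distinct_card[of "filter (\<lambda>c. \<exists>v \<in> ?V. colour f v = c) ?vs"] fin by (simp add: Int_def conj_commute)
    also have "\<dots> = card (colour f ` ?V)" if "colour f ` ?V \<subseteq> ?V"
      using that by (intro arg_cong[of _ _ card]) auto
    finally have "colour f ` ?V \<subseteq> ?V \<Longrightarrow>
      length (filter (\<lambda>c. \<exists>v \<in> ?V. colour f v = c) ?vs) = card (colour f ` ?V)" .
    moreover have "(\<forall>u \<in> ?V. \<forall>v \<in> ?V. u = v \<or> (\<exists>p \<in> ?W. walk ?E u p v \<and>
        (\<forall>q \<in> ?W. walk ?E u q v \<longrightarrow> length p \<le> length q) \<and> unique_colour f (u # p)))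
        \<longleftrightarrow> strong ?V ?E (colour f)"
      unfolding strong_def
    proof (intro ball_cong refl)
      fix u v assume u: "u \<in> ?V"
      have "(\<exists>p \<in> ?W. walk ?E u p v \<and> (\<forall>q \<in> ?W. walk ?E u q v \<longrightarrow> length p \<le> length q)
            \<and> unique_colour f (u # p)) \<longleftrightarrow> (\<exists>p. geodesic ?E u p v \<and> unique_colour f (u # p))"
        using geo[OF u] by blast
      then show "(u = v \<or> (\<exists>p \<in> ?W. walk ?E u p v \<and> (\<forall>q \<in> ?W. walk ?E u q v \<longrightarrow> length p \<le> length q)
            \<and> unique_colour f (u # p))) \<longleftrightarrow>
          (u \<noteq> v \<longrightarrow> (\<exists>r. geodesic ?E u r v \<and>
            (\<exists>x \<in> set (u # r). \<forall>y \<in> set (u # r). colour f y = colour f x \<longrightarrow> y = x)))"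
        unfolding unique_colour_def by blast
    qed
    moreover have "(\<forall>v \<in> ?V. colour f v \<in> ?V) \<longleftrightarrow> colour f ` ?V \<subseteq> ?V" by blast
    ultimately show ?thesis
      unfolding good_colouring_def map_fst_adjacency_of[OF assms] is_walk_iff[OF assms]
        set_sorted_list_of_set[OF fin] by auto
  qed
  have "decide (lists_of (G, k, X)) \<longleftrightarrow>
      (\<exists>f \<in> ?F. colour f ` ?V \<subseteq> ?V \<and> card (colour f ` ?V) \<le> k \<and> strong ?V ?E (colour f))"
    unfolding decide_def lists_of_def fst_conv snd_conv map_fst_adjacency_of[OF assms] good ..
  also have "\<dots> \<longleftrightarrow> (\<exists>c. strong ?V ?E c \<and> card (c ` ?V) \<le> k)"
  proof
    assume "\<exists>c. strong ?V ?E c \<and> card (c ` ?V) \<le> k"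
    then obtain c where c: "strong ?V ?E c" "card (c ` ?V) \<le> k" by blast
    \<comment> \<open>At most \<open>card ?V\<close> colours occur, so they can be renamed
      injectively to vertex names; neither their number nor conflict-freeness changes.\<close>
    obtain g where g: "inj_on g (c ` ?V)" "g ` c ` ?V \<subseteq> ?V"
      using card_le_inj[OF finite_imageI[OF fin] fin card_image_le[OF fin, of c]] by auto
    define f where "f = map (\<lambda>v. (v, g (c v))) ?vs"
    have col: "colour f v = g (c v)" if "v \<in> ?V" for v
      using that fin unfolding colour_def f_def by (simp add: filter_fst_eq)
    have "f \<in> ?F" unfolding F f_def using g(2) fin by (auto simp: image_subset_iff)
    moreover have "colour f ` ?V = g ` c ` ?V" unfolding image_image using col by (rule image_cong[OF refl])
    then have "colour f ` ?V \<subseteq> ?V" "card (colour f ` ?V) \<le> k"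
      using g c(2) card_image[OF g(1)] by simp_all
    moreover have "strong ?V ?E (colour f)"
      unfolding strong_def
    proof (intro ballI impI)
      fix u v assume u: "u \<in> ?V" and v: "v \<in> ?V" "u \<noteq> v"
      then obtain r x where r: "geodesic ?E u r v" and x: "x \<in> set (u # r)"
        "\<forall>y \<in> set (u # r). c y = c x \<longrightarrow> y = x"
        using c(1) unfolding strong_def by meson
      have sub: "set (u # r) \<subseteq> ?V"
        using walk_in_verts[OF geodesic_walk[OF r] connected_graphD(2)[OF assms] u] u by simp
      have "y = x" if y: "y \<in> set (u # r)" "colour f y = colour f x" for y
      proof -
        have V: "y \<in> ?V" "x \<in> ?V" using y(1) x(1) sub by blast+
        have "g (c y) = g (c x)" using y(2) unfolding col[OF V(1)] col[OF V(2)] .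
        from inj_onD[OF g(1) this imageI[OF V(1)] imageI[OF V(2)]] have "c y = c x" .
        then show ?thesis using x(2) y(1) by blast
      qed
      then have "\<exists>x \<in> set (u # r). \<forall>y \<in> set (u # r). colour f y = colour f x \<longrightarrow> y = x"
        using x(1) by blast
      from conjI[OF r this]
      show "\<exists>r. geodesic ?E u r v \<and> (\<exists>x \<in> set (u # r). \<forall>y \<in> set (u # r). colour f y = colour f x \<longrightarrow> y = x)"
        by (rule exI)
    qed
    ultimately show "\<exists>f \<in> ?F. colour f ` ?V \<subseteq> ?V \<and> card (colour f ` ?V) \<le> k \<and> strong ?V ?E (colour f)"
      by blast
  qed blast
  also have "\<dots> \<longleftrightarrow> svcfc G \<le> k" by (rule svcfc_le_iff[OF assms, symmetric])
  finally show ?thesis .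
qed

lemma product_eq_concat: "List.product xs ys = concat (map (\<lambda>x. map (\<lambda>y. (x, y)) ys) xs)"
  by (induction xs) auto

text \<open>Monotonicity of \<open>B\<close> allows the size of the kernel to be replaced by its
  bound in the parameter, and elementary growth survives that substitution.\<close>

lemma decide_time:
  obtains B where "mono B" "elementary B"
    "time_bounded (\<lambda>z. B (size (enc_lists z))) enc_lists enc_bool decide"
proof -
  let ?vs = "\<lambda>z :: adjacency \<times> nat \<times> nat list. map fst (fst z)"
  have vs: "ptime enc_lists (enc_list enc_nat) ?vs" by (rule ptime_intros)+
  have prod: "ptime enc_lists (enc_list (enc_pair enc_nat enc_nat)) (\<lambda>z. List.product (?vs z) (?vs z))"
    unfolding product_eq_concat by (rule ptime_intros)+
  obtain c d where c: "\<And>z. size (enc_list (enc_pair enc_nat enc_nat) (List.product (?vs z) (?vs z)))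
      \<le> c * (size (enc_lists z) + 1) ^ d"
    using time_bounded_size_output[OF prod] unfolding poly_bounded_def by blast
  obtain c' d' where c': "\<And>z. size (enc_list enc_nat (?vs z)) \<le> c' * (size (enc_lists z) + 1) ^ d'"
    using time_bounded_size_output[OF vs] unfolding poly_bounded_def by blast
  \<comment> \<open>The summands pay for the input, the table of candidate colourings and the table
    of candidate walks; the exponent bounds the number of vertices by the input size.\<close>
  define B where "B n = n + ((2 * (c * (n + 1) ^ d) + 1) ^ n + (2 * (c' * (n + 1) ^ d') + 1) ^ n)" for n
  let ?b = "\<lambda>z. B (size (enc_lists z))"
  have mono_pow: "(2 * (c * (m + 1) ^ d) + 1) ^ m \<le> (2 * (c * (n + 1) ^ d) + 1) ^ n"
    if "m \<le> n" for c d m n :: nat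
  proof -
    have "(2 * (c * (m + 1) ^ d) + 1) ^ m \<le> (2 * (c * (n + 1) ^ d) + 1) ^ m"
      using that by (intro power_mono add_mono mult_left_mono) auto
    also have "\<dots> \<le> (2 * (c * (n + 1) ^ d) + 1) ^ n" using that by (intro power_increasing) auto
    finally show ?thesis .
  qed
  have "mono B" unfolding B_def by (intro monoI add_mono mono_pow) auto
  moreover have "elementary B" unfolding B_def by (intro elementary_intros)
  moreover have "time_bounded ?b enc_lists enc_bool decide"
  proof -
    have b: "poly_bounded (\<lambda>z. size (enc_lists z)) ?b"
      by (rule poly_bounded_le) (simp add: B_def)
    have len: "length (?vs z) \<le> size (enc_lists z)" for z
    proof -
      have "length (?vs z) \<le> size (enc_adjacency (fst z))"
        using length_le_size_enc_list[of "fst z"] by simp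
      also have "\<dots> \<le> size (enc_lists z)" by (simp add: enc_pair_eq)
      finally show ?thesis .
    qed
    have pow_le: "(2 * s + 1) ^ length (?vs z) \<le> (2 * (c * (size (enc_lists z) + 1) ^ d) + 1) ^ size (enc_lists z)"
      if "s \<le> c * (size (enc_lists z) + 1) ^ d" for s c d z
    proof -
      have "(2 * s + 1) ^ length (?vs z) \<le> (2 * (c * (size (enc_lists z) + 1) ^ d) + 1) ^ length (?vs z)"
        using that by (intro power_mono) auto
      also have "\<dots> \<le> (2 * (c * (size (enc_lists z) + 1) ^ d) + 1) ^ size (enc_lists z)"
        using len by (intro power_increasing) auto
      finally show ?thesis .
    qed
    have F: "time_bounded ?b enc_lists (enc_list (enc_list (enc_pair enc_nat enc_nat)))
        (\<lambda>z. all_lists (List.product (?vs z) (?vs z)) (?vs z))"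
      by (rule time_bounded_all_lists[OF prod vs b])
         (rule poly_bounded_le, rule order_trans[OF pow_le[OF c]], simp add: B_def)
    have W: "time_bounded ?b enc_lists (enc_list (enc_list enc_nat)) (\<lambda>z. all_lists (?vs z) (?vs z))"
      by (rule time_bounded_all_lists[OF vs vs b])
         (rule poly_bounded_le, rule order_trans[OF pow_le[OF c']], simp add: B_def)
    let ?e = "enc_pair enc_lists (enc_pair (enc_list (enc_list (enc_pair enc_nat enc_nat)))
        (enc_list (enc_list enc_nat)))"
    have "ptime ?e enc_bool (\<lambda>y. \<exists>f \<in> set (fst (snd y)).
        good_colouring (fst (fst y)) (fst (snd (fst y))) (snd (snd y)) f)"
      by (rule ptime_intros)+
    \<comment> \<open>Both tables are written out first. The check is polynomial in the size of the
      tables, hence polynomial in \<open>B\<close>.\<close>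
    from time_bounded_comp[OF time_bounded_pair[OF time_bounded_id[OF b] time_bounded_pair[OF F W]] this]
    show ?thesis by (rule time_bounded_recode) (simp only: decide_def fst_conv snd_conv)
  qed
  ultimately show ?thesis by (rule that)
qed


section \<open>Size of the kernel\<close>

text \<open>A linear bound on binary numbers is crude but sufficient, as any computable bound on the
  kernel will do.\<close>

lemma size_enc_nat_le: "size (enc_nat n) \<le> 2 * n"
proof (induction n)
  case (Suc n)
  then show ?case using size_enc_nat_Suc[of n] by simp
qed simp

lemma size_enc_list_le:
  assumes "length xs \<le> n" "\<And>x. x \<in> set xs \<Longrightarrow> size (e x) \<le> m"
  shows "size (enc_list e xs) \<le> n * (m + 1)"
proof -
  have "size (enc_list e xs) \<le> length xs * (m + 1)"
    using assms(2)
  proof (induction xs)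
    case (Cons x xs)
    have "size (e x) \<le> m" "size (enc_list e xs) \<le> length xs * (m + 1)" using Cons by auto
    then show ?case by simp
  qed simp
  also have "\<dots> \<le> n * (m + 1)" using assms(1) by (intro mult_le_mono1)
  finally show ?thesis .
qed

lemma size_enc_sorted_le:
  assumes "S \<subseteq> {..<n}"
  shows "size (enc_list enc_nat (sorted_list_of_set S)) \<le> n * (2 * n + 1)"
proof (rule size_enc_list_le)
  have fin: "finite S" by (rule finite_subset[OF assms]) simp
  show "length (sorted_list_of_set S) \<le> n"
    using card_mono[OF _ assms] by simp
  fix x assume "x \<in> set (sorted_list_of_set S)"
  then have "x < n" using assms fin by auto
  then show "size (enc_nat x) \<le> 2 * n" using size_enc_nat_le[of x] by simp
qed

lemma size_enc_instance_le:
  assumes "connected_graph G" "twin_cover G X" "pverts G \<subseteq> {..<n}"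
  shows "size (enc_instance (G, k, X)) \<le> n * (2 * n + n * (2 * n + 1) + 2) + (2 * k + n * (2 * n + 1) + 2)"
proof -
  have "size (enc_adjacency (adjacency_of G)) \<le> n * ((2 * n + n * (2 * n + 1) + 1) + 1)"
  proof (rule size_enc_list_le)
    show "length (adjacency_of G) \<le> n"
      using card_mono[OF _ assms(3)] by (simp add: adjacency_of_def)
    fix p assume "p \<in> set (adjacency_of G)"
    then obtain v where v: "v \<in> pverts G" "p = (v, sorted_list_of_set {w. (v, w) \<in> parcs G})"
      using connected_graphD(1)[OF assms(1)] by (auto simp: adjacency_of_def)
    have "size (enc_nat v) \<le> 2 * n" using size_enc_nat_le[of v] v(1) assms(3) by force
    moreover have "size (enc_list enc_nat (sorted_list_of_set {w. (v, w) \<in> parcs G})) \<le> n * (2 * n + 1)"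
      by (rule size_enc_sorted_le) (use connected_graphD(2)[OF assms(1)] assms(3) in auto)
    ultimately show "size (enc_pair enc_nat (enc_list enc_nat) p) \<le> 2 * n + n * (2 * n + 1) + 1"
      by (simp add: v(2))
  qed
  moreover have "X \<subseteq> {..<n}" using assms(2,3) unfolding twin_cover_def by blast
  then have "size (enc_list enc_nat (sorted_list_of_set X)) \<le> n * (2 * n + 1)"
    by (rule size_enc_sorted_le)
  moreover have "size (enc_nat k) \<le> 2 * k" by (rule size_enc_nat_le)
  ultimately show ?thesis
    unfolding enc_lists_lists_of[symmetric] by (simp add: lists_of_def)
qed

theorem theorem1:
  shows "(\<exists>f. poly_time_computable enc_instance enc_instance svcfc_instances f \<and>
            (\<forall>G k X G' k' X'.
               connected_graph G \<and> 1 \<le> k \<and> twin_cover G X \<and> f (G, k, X) = (G', k', X') \<longrightarrow>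
                 connected_graph G' \<and> 1 \<le> k' \<and> twin_cover G' X' \<and>
                 (svcfc G \<le> k \<longleftrightarrow> svcfc G' \<le> k') \<and>
                 card (pverts G') \<le> max 2 (card X + (card X + 1) * k * 2 ^ (card X + k - 1))))
       \<and> admits_kernel enc_instance svcfc_instances svcfc_yes svcfc_parameter
       \<and> fixed_parameter_tractable enc_instance svcfc_instances svcfc_yes svcfc_parameter"
proof -
  \<comment> \<open>The vertex bound expressed in \<open>\<kappa> = t + k\<close> alone:
    \<open>t\<close>, \<open>k\<close> and the exponent \<open>t + k - 1\<close> are at most
    \<open>\<kappa>\<close>, and a sum replaces the maximum.\<close>
  define N where "N \<kappa> = 2 + (\<kappa> + (\<kappa> + 1) * \<kappa> * 2 ^ \<kappa>)" for \<kappa> :: nat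
  define S where "S \<kappa> = N \<kappa> * (2 * N \<kappa> + N \<kappa> * (2 * N \<kappa> + 1) + 2)
    + (2 * \<kappa> + N \<kappa> * (2 * N \<kappa> + 1) + 2) + \<kappa>" for \<kappa>
  have "elementary N" unfolding N_def by (intro elementary_intros)
  then have S: "elementary S" unfolding S_def by (intro elementary_intros)
  have ex: "\<exists>j. j \<in> svcfc_instances \<and> lists_of j = kernelize (lists_of i) \<and> (svcfc_yes j \<longleftrightarrow> svcfc_yes i)
      \<and> card (pverts (fst j)) \<le> kernel_bound (card (snd (snd i))) (fst (snd i))
      \<and> size (enc_instance j) + svcfc_parameter j \<le> S (svcfc_parameter i)"
    if inst: "i \<in> svcfc_instances" for i
  proof -
    obtain G k X where i: "i = (G, k, X)" by (cases i)
    have G: "connected_graph G" "1 \<le> k" "twin_cover G X" using inst by (auto simp: i svcfc_instances_def)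
    obtain G' k' X' where j: "connected_graph G'" "1 \<le> k'" "twin_cover G' X'"
      "svcfc G \<le> k \<longleftrightarrow> svcfc G' \<le> k'" "card (pverts G') \<le> kernel_bound (card X) k"
      "pverts G' \<subseteq> {..<kernel_bound (card X) k}" "k' \<le> k" "card X' \<le> card X"
      "lists_of (G', k', X') = kernelize (lists_of (G, k, X))"
      using kernelize_correct[OF G] by blast
    let ?\<kappa> = "card X + k"
    have "card X + (card X + 1) * k * 2 ^ (card X + k - 1) \<le> ?\<kappa> + (?\<kappa> + 1) * ?\<kappa> * 2 ^ ?\<kappa>"
      by (intro add_mono mult_mono power_increasing) auto
    then have "kernel_bound (card X) k \<le> N ?\<kappa>" unfolding N_def by linarith
    then have "pverts G' \<subseteq> {..<N ?\<kappa>}" using j(6) by force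
    from size_enc_instance_le[OF j(1,3) this, of k'] j(7,8)
    have "size (enc_instance (G', k', X')) + svcfc_parameter (G', k', X') \<le> S ?\<kappa>"
      unfolding S_def svcfc_parameter_def by simp
    then show ?thesis using j unfolding i
      by (intro exI[of _ "(G', k', X')"])
         (simp add: svcfc_instances_def svcfc_yes_def svcfc_parameter_def)
  qed
  \<comment> \<open>The map on graphs is obtained by choice, yet it is computed by the program for
    \<open>kernelize\<close>: the list form fixes the encoding of the chosen instance.\<close>
  from bchoice[OF ballI[OF ex]] obtain f where f': "\<forall>i \<in> svcfc_instances.
      f i \<in> svcfc_instances \<and> lists_of (f i) = kernelize (lists_of i) \<and> (svcfc_yes (f i) \<longleftrightarrow> svcfc_yes i)
      \<and> card (pverts (fst (f i))) \<le> kernel_bound (card (snd (snd i))) (fst (snd i))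
      \<and> size (enc_instance (f i)) + svcfc_parameter (f i) \<le> S (svcfc_parameter i)" ..
  have f: "f i \<in> svcfc_instances" "lists_of (f i) = kernelize (lists_of i)"
    "svcfc_yes (f i) \<longleftrightarrow> svcfc_yes i"
    "card (pverts (fst (f i))) \<le> kernel_bound (card (snd (snd i))) (fst (snd i))"
    "size (enc_instance (f i)) + svcfc_parameter (f i) \<le> S (svcfc_parameter i)"
    if "i \<in> svcfc_instances" for i
    using bspec[OF f' that] by simp_all
  have enc_f: "enc_lists (kernelize (lists_of i)) = enc_instance (f i)" if "i \<in> svcfc_instances" for i
    using f(2)[OF that] enc_lists_lists_of[of "f i"] by simp
  have "poly_time_computable enc_lists enc_lists UNIV kernelize"
    by (rule ptime_imp_poly_time_computable[OF ptime_kernelize])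
  then obtain p c d where p: "\<And>z. \<exists>n. run p (enc_lists z) (enc_lists (kernelize z)) n
      \<and> n \<le> c * (size (enc_lists z) + 1) ^ d"
    unfolding poly_time_computable_def by blast
  have p': "\<exists>n. run p (enc_instance i) (enc_instance (f i)) n \<and> n \<le> c * (size (enc_instance i) + 1) ^ d"
    if "i \<in> svcfc_instances" for i
    using p[of "lists_of i"] unfolding enc_f[OF that] enc_lists_lists_of .
  then have poly: "poly_time_computable enc_instance enc_instance svcfc_instances f"
    unfolding poly_time_computable_def by blast
  have "connected_graph G' \<and> 1 \<le> k' \<and> twin_cover G' X' \<and> (svcfc G \<le> k \<longleftrightarrow> svcfc G' \<le> k') \<and>
      card (pverts G') \<le> kernel_bound (card X) k"
    if "connected_graph G \<and> 1 \<le> k \<and> twin_cover G X \<and> f (G, k, X) = (G', k', X')" for G k X G' k' X'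
  proof -
    have "(G, k, X) \<in> svcfc_instances" using that by (simp add: svcfc_instances_def)
    from f(1,3,4)[OF this] show ?thesis using that by (simp add: svcfc_instances_def svcfc_yes_def)
  qed
  with poly have part1: "\<exists>f. poly_time_computable enc_instance enc_instance svcfc_instances f \<and>
            (\<forall>G k X G' k' X'.
               connected_graph G \<and> 1 \<le> k \<and> twin_cover G X \<and> f (G, k, X) = (G', k', X') \<longrightarrow>
                 connected_graph G' \<and> 1 \<le> k' \<and> twin_cover G' X' \<and>
                 (svcfc G \<le> k \<longleftrightarrow> svcfc G' \<le> k') \<and>
                 card (pverts G') \<le> max 2 (card X + (card X + 1) * k * 2 ^ (card X + k - 1)))"
    by blast
  obtain s where s: "computable s" "\<And>\<kappa>. S \<kappa> \<le> s \<kappa>" using elementary_imp_computable_bound[OF S] by blast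
  have "size (enc_instance (f i)) + svcfc_parameter (f i) \<le> s (svcfc_parameter i)"
    if "i \<in> svcfc_instances" for i
    using f(5)[OF that] s(2) by (rule order_trans)
  then have part2: "admits_kernel enc_instance svcfc_instances svcfc_yes svcfc_parameter"
    unfolding admits_kernel_def using poly s(1) f(1,3) by blast
  obtain B where B: "mono B" "elementary B"
    "time_bounded (\<lambda>z. B (size (enc_lists z))) enc_lists enc_bool decide"
    by (rule decide_time)
  obtain q c' d' where q: "\<And>z. \<exists>n. run q (enc_lists z) (enc_bool (decide z)) n
      \<and> n \<le> c' * (B (size (enc_lists z)) + 1) ^ d'"
    using B(3) unfolding time_bounded_def poly_bounded_def by blast
  \<comment> \<open>\<open>c\<close> pays for the kernelization, the middle term for the search on
    an instance of size at most \<open>S \<kappa>\<close>, and the 2 for the input size and the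
    extra unit charged by \<open>Seq\<close>.\<close>
  define T where "T \<kappa> = c + c' * (B (S \<kappa>) + 1) ^ d' + 2" for \<kappa>
  have "elementary (\<lambda>\<kappa>. B (S \<kappa>))" by (rule elementary_comp[OF B(2) S])
  then have "elementary T" unfolding T_def by (intro elementary_intros)
  from elementary_imp_computable_bound[OF this]
  obtain g where g: "computable g" "\<And>\<kappa>. T \<kappa> \<le> g \<kappa>" by blast
  have "\<exists>n. run (Seq p q) (enc_instance i) (enc_bool (svcfc_yes i)) n
      \<and> n \<le> g (svcfc_parameter i) * (size (enc_instance i) + 1) ^ (d + 1)"
    if inst: "i \<in> svcfc_instances" for i
  proof -
    let ?n = "size (enc_instance i)" and ?\<kappa> = "svcfc_parameter i"
    obtain m where m: "run p (enc_instance i) (enc_instance (f i)) m" "m \<le> c * (?n + 1) ^ d"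
      using p'[OF inst] by blast
    obtain G' k' X' where j: "f i = (G', k', X')" by (cases "f i")
    have "connected_graph G'" using f(1)[OF inst] by (simp add: j svcfc_instances_def)
    from decide_correct[OF this, of k' X'] have "decide (lists_of (f i)) \<longleftrightarrow> svcfc_yes i"
      using f(3)[OF inst] by (simp add: j svcfc_yes_def)
    then obtain l where l: "run q (enc_instance (f i)) (enc_bool (svcfc_yes i)) l"
      "l \<le> c' * (B (size (enc_instance (f i))) + 1) ^ d'"
      using q[of "lists_of (f i)"] unfolding enc_lists_lists_of by auto
    have "size (enc_instance (f i)) \<le> S ?\<kappa>" using f(5)[OF inst] by simp
    then have "B (size (enc_instance (f i))) \<le> B (S ?\<kappa>)" using B(1) by (simp add: monoD)
    then have l': "l \<le> c' * (B (S ?\<kappa>) + 1) ^ d'"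
      using l(2) by (meson add_le_mono1 mult_le_mono2 order_trans power_mono zero_le)
    have one: "1 \<le> (?n + 1) ^ (d + 1)" by (rule one_le_power) simp
    have collect: "c * K + a * K + K + K = (c + a + 2) * K" for a K :: nat
      by (simp add: algebra_simps)
    have "m + l + ?n + 1 \<le> c * (?n + 1) ^ (d + 1) + c' * (B (S ?\<kappa>) + 1) ^ d' * (?n + 1) ^ (d + 1)
        + (?n + 1) ^ (d + 1) + (?n + 1) ^ (d + 1)"
    proof (intro add_mono)
      show "m \<le> c * (?n + 1) ^ (d + 1)"
        by (rule order_trans[OF m(2)]) (intro mult_le_mono2 power_increasing; simp)
      show "l \<le> c' * (B (S ?\<kappa>) + 1) ^ d' * (?n + 1) ^ (d + 1)"
        using order_trans[OF l' mult_le_mono2[OF one, of "c' * (B (S ?\<kappa>) + 1) ^ d'", unfolded mult_1_right]] .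
      \<comment> \<open>The exponent \<open>d + 1\<close> instead of \<open>d\<close> keeps this
        true for \<open>d = 0\<close>.\<close>
      have "(?n + 1) ^ 1 \<le> (?n + 1) ^ (d + 1)" by (intro power_increasing) auto
      then show "?n \<le> (?n + 1) ^ (d + 1)" by simp
    qed (rule one)
    also have "\<dots> = T ?\<kappa> * (?n + 1) ^ (d + 1)" unfolding T_def by (rule collect)
    also have "\<dots> \<le> g ?\<kappa> * (?n + 1) ^ (d + 1)" by (intro mult_le_mono1 g(2))
    finally show ?thesis using run.Seq[OF m(1) l(1)] by blast
  qed
  then have part3: "fixed_parameter_tractable enc_instance svcfc_instances svcfc_yes svcfc_parameter"
    unfolding fixed_parameter_tractable_def using g(1) by blast
  from part1 part2 part3 show ?thesis by blast
qed

end
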